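(* Let $n\in\{2,3\}$, $g>0$, $\sigma\ge 0$, and $c=(c',0)\in\mathbb{R}^{n-1}\times\mathbb{R}$ with $c\neq 0$. Let $\eta\in C^2(\mathbb{R}^{n-1})$, let $\Omega=\{(x',x_n)\in\mathbb{R}^{n-1}\times\mathbb{R}: x_n<\eta(x')\}$ with boundary $S=\{x_n=\eta(x')\}$ and outward unit normal $N$, and let $\varphi\in C^2(\overline{\Omega})$. Suppose that \begin{align*} \Delta\varphi&=0 && \text{in }\Omega,\\ \nabla\varphi\cdot N&=c\cdot N && \text{on }S,\\ \tfrac12|\nabla\varphi|^2-c\cdot\nabla\varphi+g\eta&=-\sigma\nabla\cdot N && \text{on }S,\\ \eta&\to0 && \text{as }|x'|\to\infty,\\ \varphi,\nabla\varphi&\to0 && \text{as }|x|\to\infty, \end{align*} and that, for some $\varepsilon\in(0,1)$ and all indices $i,j$, $$\varphi=o\Big(\frac1{|x|^{n-2}}\Big)\ \text{ as }|x|\to\infty,$$ $$\eta=O\Big(\frac1{|x'|^{n-1+\varepsilon}}\Big),\quad \frac{\partial\eta}{\partial x'_i}=O\Big(\frac1{|x'|^{n+\varepsilon}}\Big),\quad \frac{\partial^2\eta}{\partial x'_i\partial x'_j}=O\Big(\frac1{|x'|^{n+1+\varepsilon}}\Big)\ \text{ as }|x'|\to\infty.$$ Let $p=(p',0)\in\mathbb{R}^{n-1}\times\mathbb{R}$ be the dipole moment of $\varphi$ (defined in the context). Then $$\frac12\int_\Omega|\nabla\varphi|^2\,dx=-\frac{\pi^{n/2}}{2\,\Gamma(\frac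 n2)}\,(c\cdot p).$$
   Context: Write $x=(x',x_n)\in\mathbb{R}^{n-1}\times\mathbb{R}$, with $x'$ horizontal and $x_n$ vertical. The function $\eta$ is the free surface profile, $\varphi$ the velocity potential, $c$ the wave speed, $g$ the gravitational acceleration, $\sigma$ the coefficient of surface tension. The unit normal pointing out of $\Omega$ depends only on $x'$: $N=N(x')=(-\nabla\eta,1)/\sqrt{1+|\nabla\eta|^2}$, so that $\nabla\cdot N=-\nabla\cdot\big(\nabla\eta/\sqrt{1+|\nabla\eta|^2}\big)$. Limits and asymptotic statements for $\varphi,\nabla\varphi$ as $|x|\to\infty$ are taken over $x\in\overline\Omega$. Dipole moment: under the stated hypotheses there exists a vector $p=(p',0)\in\mathbb{R}^{n-1}\times\mathbb{R}$, called the dipole moment, such that $$\varphi=\frac{p\cdot x}{|x|^n}+O\Big(\frac1{|x|^{n-1+\varepsilon}}\Big),\qquad \nabla\varphi=\nabla\frac{p\cdot x}{|x|^n}+O\Big(\frac1{|x|^{n+\varepsilon}}\Big)\qquad\text{as }|x|\to\infty.$$ $\Gamma$ is the Gamma function. *)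

theory Defs
  imports "HOL-Analysis.Analysis" "HOL-Library.Landau_Symbols"
begin

definition gradient :: "('a::euclidean_space \<Rightarrow> real) \<Rightarrow> 'a \<Rightarrow> 'a" where
  "gradient f x = (THE D. GDERIV f x :> D)"

definition divergence :: "('a::euclidean_space \<Rightarrow> 'a) \<Rightarrow> 'a \<Rightarrow> real" where
  "divergence F x = (\<Sum>b\<in>Basis. frechet_derivative F (at x) b \<bullet> b)"

definition laplacian :: "('a::euclidean_space \<Rightarrow> real) \<Rightarrow> 'a \<Rightarrow> real" where
  "laplacian f x = divergence (gradient f) x"

(* f is C^2 on the open set U and f, its gradient and its Hessian extend continuously
   to the closure of U; G and H are these extensions.
   For U = UNIV this is the ordinary class C^2 on the whole space. *)
definition C2_closure :: "'a::euclidean_space set \<Rightarrow> ('a \<Rightarrow> real) \<Rightarrow> bool" where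
  "C2_closure U f \<longleftrightarrow>
     continuous_on (closure U) f \<and>
     (\<exists>(G :: 'a \<Rightarrow> 'a) (H :: 'a \<Rightarrow> 'a \<Rightarrow>\<^sub>L 'a).
        (\<forall>x\<in>U. GDERIV f x :> G x) \<and>
        (\<forall>x\<in>U. (G has_derivative blinfun_apply (H x)) (at x)) \<and>
        continuous_on (closure U) G \<and>
        continuous_on (closure U) H)"

(* The gradient of f in U, continuously extended to the closure of U: this gives meaning to
   the gradient at boundary points, where f need not be differentiable as a total function. *)
definition gradient_closure :: "'a::euclidean_space set \<Rightarrow> ('a \<Rightarrow> real) \<Rightarrow> 'a \<Rightarrow> 'a" where
  "gradient_closure U f x =
     (if x \<in> U then gradient f x else Lim (at x within U) (gradient f))"

definition upward_normal :: "(real ^ 'm \<Rightarrow> real) \<Rightarrow> real ^ 'm \<Rightarrow> (real ^ 'm) \<times> real" where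
  "upward_normal \<eta> x' =
     (1 / sqrt (1 + (norm (gradient \<eta> x'))\<^sup>2)) *\<^sub>R (- gradient \<eta> x', 1)"

(* |x| tends to infinity with x ranging over A *)
definition at_infinity_within :: "'a::real_normed_vector set \<Rightarrow> 'a filter" where
  "at_infinity_within A = inf at_infinity (principal A)"

(* The dipole moment is specified by its defining far-field expansion. It is always
   horizontal, i.e. of the form (p', 0); n is the dimension of the ambient space. *)
definition is_dipole_moment ::
  "nat \<Rightarrow> real \<Rightarrow> ((real ^ 'm) \<times> real) set \<Rightarrow> ((real ^ 'm) \<times> real \<Rightarrow> real)
     \<Rightarrow> (real ^ 'm) \<times> real \<Rightarrow> bool" where
  "is_dipole_moment n \<epsilon> \<Omega> \<phi> p \<longleftrightarrow>
     snd p = 0 \<and>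
     (\<lambda>x. \<phi> x - p \<bullet> x / norm x ^ n)
       \<in> O[at_infinity_within (closure \<Omega>)](\<lambda>x. 1 / norm x powr (real n - 1 + \<epsilon>)) \<and>
     (\<lambda>x. norm (gradient_closure \<Omega> \<phi> x - gradient (\<lambda>y. p \<bullet> y / norm y ^ n) x))
       \<in> O[at_infinity_within (closure \<Omega>)](\<lambda>x. 1 / norm x powr (real n + \<epsilon>))"

end

theory Submission
  imports Defs
begin

text \<open>
  All identities come from the divergence theorem in \<open>\<Omega>\<close>, applied to fields multiplied by a cutoff
  \<open>(1 - (|x| / R)\<^sup>n)\<^sub>+\<^sup>2\<close>. With this exponent the cutoff error, after the substitution \<open>x = R y\<close>, is an
  average over the lower half ball of a bounded quantity, and converges as \<open>R \<rightarrow> \<infinity>\<close>; so no surface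
  integrals over spheres occur.

  Two fields are used. For \<open>K = \<phi>\<nabla>\<phi> - \<phi> c + (c \<bullet> x)\<nabla>\<phi>\<close> one has \<open>div K = |\<nabla>\<phi>|\<^sup>2\<close>; the kinematic condition
  reduces its flux through the surface to that of \<open>(c \<bullet> x) c\<close>, which is \<open>|c|\<^sup>2 \<integral> \<eta>\<close>, and its flux through
  infinity only sees the dipole. For \<open>Z = (c \<bullet> \<nabla>\<phi>) e - (\<partial>\<^sub>e\<phi>) c - |\<nabla>\<phi>|\<^sup>2 e / 2 + (\<partial>\<^sub>e\<phi>)\<nabla>\<phi>\<close>, with \<open>e\<close> the
  vertical unit vector, the divergence and the flux through infinity vanish, and the dynamic condition
  turns the flux through the surface into \<open>g \<integral> \<eta>\<close> minus \<open>\<sigma>\<close> times the integral of the mean curvature,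
  which is zero. Hence \<open>\<integral> \<eta> = 0\<close>.
\<close>

section \<open>Integration and measure-preserving maps\<close>

text \<open>A dipole makes \<open>K\<close> decay exactly like |x|^(1-n), the rate at which fluxes
  through large spheres neither vanish nor blow up, so the cutoff error must be computed, not
  estimated away. For such a field |x|^(n-2) (x . F) is asymptotically homogeneous of degree 0; the
  cutoff gradient is -2n R^(-n) (1 - (|x|/R)^n)_+ |x|^(n-2) x, and the Jacobian R^n cancels its
  R^(-n). For \<open>K\<close> the degree-0 limit is -n (p . y)(c . y) / |y|^2. With \<omega> the
  volume of the unit ball, the weight (1 - |y|^n)_+ has integral \<omega>/2, its second moments in
  y/|y| are 1/n of this by symmetry, and the half ball gets half. Hence 2n (-n) (c . p)/n \<omega>/4
  = -(n \<omega>/2)(c . p), where n \<omega>/2 = \<pi>^(n/2) / \<Gamma>(n/2). The field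
  \<open>Z\<close> enters because \<open>K\<close> leaves a term |c|^2 \<integral> \<eta> to be
  evaluated; being of order |\<nabla>\<phi>| = O(|x|^(-n)), it lies one power below the borderline.
  The fields are differentiable only inside \<Omega>, with continuous extensions to the closure, so
  the surface is always reached from inside, by one-dimensional calculus on lines.\<close>

lemma integral_distr_invariant:
  fixes T :: "'a::euclidean_space \<Rightarrow> 'a" and f :: "'a \<Rightarrow> real"
  assumes T: "distr lborel borel T = lborel" and meas: "T \<in> borel_measurable borel"
    and f: "f \<in> borel_measurable borel"
  shows "integral\<^sup>L lborel (\<lambda>x. f (T x)) = integral\<^sup>L lborel f"
    and "integrable lborel (\<lambda>x. f (T x)) \<longleftrightarrow> integrable lborel f"
proof -
  have "integral\<^sup>L (distr lborel borel T) f = integral\<^sup>L lborel (\<lambda>x. f (T x))"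
    by (rule integral_distr) (use meas f in simp_all)
  then show "integral\<^sup>L lborel (\<lambda>x. f (T x)) = integral\<^sup>L lborel f"
    by (simp add: T)
  have "integrable (distr lborel borel T) f \<longleftrightarrow> integrable lborel (\<lambda>x. f (T x))"
    by (rule integrable_distr_eq) (use meas f in simp_all)
  then show "integrable lborel (\<lambda>x. f (T x)) \<longleftrightarrow> integrable lborel f"
    by (simp add: T)
qed

lemma distr_lborel_translation:
  fixes a :: "'a::euclidean_space"
  shows "distr lborel borel (\<lambda>x. x + a) = lborel"
proof -
  have "(\<lambda>x. x + a) = (+) a" by (auto simp: add.commute)
  then show ?thesis by (simp add: lborel_distr_plus)
qed

text \<open>On each vertical line the shear is a translation, so Tonelli reduces the claim to
  translation invariance in one dimension. It is the map that flattens the surface to a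
  hyperplane.\<close>

lemma distr_lborel_shear:
  fixes \<eta> :: "'a::euclidean_space \<Rightarrow> real"
  assumes [measurable]: "\<eta> \<in> borel_measurable borel"
  shows "distr lborel borel (\<lambda>x. (fst x, snd x + \<eta> (fst x))) = lborel"
proof (rule measure_eqI)
  let ?T = "\<lambda>x::'a \<times> real. (fst x, snd x + \<eta> (fst x))"
  show "sets (distr lborel borel ?T) = sets lborel" by simp
  fix A assume "A \<in> sets (distr lborel borel ?T)"
  then have A[measurable]: "A \<in> sets borel" by simp
  have T[measurable]: "?T \<in> borel_measurable borel"
    unfolding borel_prod[symmetric] by measurable
  have ind[measurable]: "(indicator A :: _ \<Rightarrow> ennreal) \<in> borel_measurable borel" by simp
  have ind1: "(\<lambda>x. indicator A (?T x) :: ennreal) \<in> borel_measurable borel" by measurable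
  have sec: "Pair x -` A \<in> sets borel" for x
    by (rule sets_Pair1[of A borel borel]) (use A in \<open>unfold borel_prod\<close>)
  have tr: "(\<integral>\<^sup>+ t. indicator A (x, t + \<eta> x) \<partial>lborel) = (\<integral>\<^sup>+ t. indicator A (x, t) \<partial>lborel)" for x
  proof -
    have m: "(\<lambda>t. indicator A (x, t) :: ennreal) \<in> borel_measurable borel"
      using sec[of x] by (simp add: indicator_vimage[symmetric] flip: o_def)
    have "(\<integral>\<^sup>+ t. indicator A (x, t) \<partial>lborel)
        = (\<integral>\<^sup>+ t. indicator A (x, t) \<partial>(distr lborel borel (\<lambda>t. t + \<eta> x)))"
      by (simp add: distr_lborel_translation)
    also have "\<dots> = (\<integral>\<^sup>+ t. indicator A (x, t + \<eta> x) \<partial>lborel)"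
      by (rule nn_integral_distr) (use m in simp_all)
    finally show ?thesis by simp
  qed
  have "emeasure (distr lborel borel ?T) A = (\<integral>\<^sup>+ z. indicator A z \<partial>(distr lborel borel ?T))"
    by simp
  also have "\<dots> = (\<integral>\<^sup>+ z. indicator A (?T z) \<partial>lborel)"
    by (rule nn_integral_distr) (use T in simp_all)
  also have "\<dots> = (\<integral>\<^sup>+ z. indicator A (?T z) \<partial>(lborel \<Otimes>\<^sub>M lborel))"
    by (simp add: lborel_prod)
  also have "\<dots> = (\<integral>\<^sup>+ x. \<integral>\<^sup>+ t. indicator A (?T (x, t)) \<partial>lborel \<partial>lborel)"
    by (rule lborel.nn_integral_fst[symmetric]) (use ind1 in \<open>simp add: lborel_prod\<close>)
  also have "\<dots> = (\<integral>\<^sup>+ x. \<integral>\<^sup>+ t. indicator A (x, t) \<partial>lborel \<partial>lborel)"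
    by (simp add: tr)
  also have "\<dots> = (\<integral>\<^sup>+ z. indicator A z \<partial>(lborel \<Otimes>\<^sub>M lborel))"
    by (rule lborel.nn_integral_fst) (use ind in \<open>simp add: lborel_prod\<close>)
  also have "\<dots> = emeasure lborel A" by (simp add: lborel_prod)
  finally show "emeasure (distr lborel borel ?T) A = emeasure lborel A" .
qed

lemma integral_lborel_scaleR:
  fixes f :: "'a::euclidean_space \<Rightarrow> real"
  assumes R: "R \<noteq> 0" and [measurable]: "f \<in> borel_measurable borel"
  shows "integral\<^sup>L lborel f = \<bar>R\<bar> ^ DIM('a) * integral\<^sup>L lborel (\<lambda>y. f (R *\<^sub>R y))"
proof -
  have "integral\<^sup>L lborel f
      = integral\<^sup>L (density (distr lborel borel (\<lambda>x. R *\<^sub>R x)) (\<lambda>_. \<bar>R\<bar> ^ DIM('a))) f"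
    by (subst lborel_affine[OF R, of 0]) simp
  also have "\<dots> = integral\<^sup>L (distr lborel borel (\<lambda>x. R *\<^sub>R x)) (\<lambda>x. \<bar>R\<bar> ^ DIM('a) *\<^sub>R f x)"
    by (rule integral_density) auto
  also have "\<dots> = integral\<^sup>L lborel (\<lambda>y. \<bar>R\<bar> ^ DIM('a) *\<^sub>R f (R *\<^sub>R y))"
    by (rule integral_distr) auto
  finally show ?thesis by simp
qed

text \<open>Integrating the fundamental theorem of calculus over all segments \<open>[x, x + e]\<close> and exchanging
  the integrals, translation invariance leaves the integral of the derivative on one side and
  \<open>0\<close> on the other.\<close>

lemma integral_directional_derivative_eq_0:
  fixes f f' :: "'a::euclidean_space \<Rightarrow> real"
  assumes f: "integrable lborel f" and f': "integrable lborel f'"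
    and FTC: "\<And>x. ((\<lambda>s. f' (x + s *\<^sub>R e)) has_integral (f (x + e) - f x)) {0..1}"
  shows "integral\<^sup>L lborel f' = 0"
proof -
  have [measurable]: "f \<in> borel_measurable borel" "f' \<in> borel_measurable borel"
    using f f' by auto
  define h where "h = (\<lambda>z::real \<times> 'a. indicator {0..1} (fst z) * f' (snd z + fst z *\<^sub>R e))"
  have hm: "h \<in> borel_measurable (lborel \<Otimes>\<^sub>M lborel)"
    unfolding h_def lborel_prod by (simp add: borel_prod[symmetric])
  have trans: "integral\<^sup>L lborel (\<lambda>x. g (x + a)) = integral\<^sup>L lborel g"
              "integrable lborel (\<lambda>x. g (x + a)) \<longleftrightarrow> integrable lborel g"
    if "g \<in> borel_measurable borel" for g :: "'a \<Rightarrow> real" and a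
    using integral_distr_invariant[OF distr_lborel_translation _ that, of a] by simp_all
  have hi: "integrable (lborel \<Otimes>\<^sub>M lborel) h"
  proof (rule lborel_pair.Fubini_integrable[OF hm])
    have "(\<integral>x. norm (h (s, x)) \<partial>lborel) = indicator {0..1} s * (\<integral>x. norm (f' x) \<partial>lborel)" for s
      using trans(1)[of "\<lambda>x. \<bar>f' x\<bar>" "s *\<^sub>R e"] by (simp add: h_def abs_mult)
    then show "integrable lborel (\<lambda>s. \<integral>x. norm (h (s, x)) \<partial>lborel)" by simp
    show "AE s in lborel. integrable lborel (\<lambda>x. h (s, x))"
      using trans(2)[of f'] f' by (simp add: h_def)
  qed
  have hi2: "integrable (lborel \<Otimes>\<^sub>M lborel) (\<lambda>(s, x). h (s, x))" using hi by simp
  have swap: "(\<integral>x. (\<integral>s. h (s, x) \<partial>lborel) \<partial>lborel) = (\<integral>s. (\<integral>x. h (s, x) \<partial>lborel) \<partial>lborel)"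
    using lborel_pair.Fubini_integral[OF hi2] by simp
  have "(\<integral>s. (\<integral>x. h (s, x) \<partial>lborel) \<partial>lborel) = (\<integral>s. indicator {0..1::real} s * integral\<^sup>L lborel f' \<partial>lborel)"
    using trans(1)[of f'] by (simp add: h_def)
  also have "\<dots> = integral\<^sup>L lborel f'" by simp
  finally have 1: "(\<integral>s. (\<integral>x. h (s, x) \<partial>lborel) \<partial>lborel) = integral\<^sup>L lborel f'" .
  have "AE x in lborel. integrable lborel (\<lambda>s. h (s, x))"
    using lborel_pair.AE_integrable_snd[OF hi2] by simp
  then have "AE x in lborel. (\<integral>s. h (s, x) \<partial>lborel) = f (x + e) - f x"
  proof (eventually_elim)
    case (elim x)
    have si: "set_integrable lborel {0..1} (\<lambda>s. f' (x + s *\<^sub>R e))"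
      using elim by (simp add: set_integrable_def h_def)
    have "(\<integral>s. h (s, x) \<partial>lborel) = (LINT s:{0..1}|lborel. f' (x + s *\<^sub>R e))"
      by (simp add: set_lebesgue_integral_def h_def)
    also have "\<dots> = f (x + e) - f x"
      using set_borel_integral_eq_integral(2)[OF si] FTC[of x] by (simp add: integral_unique)
    finally show ?case .
  qed
  moreover have "(\<lambda>x. \<integral>s. h (s, x) \<partial>lborel) \<in> borel_measurable lborel"
    using lborel_pair.integrable_snd[OF hi2] by auto
  ultimately have "(\<integral>x. (\<integral>s. h (s, x) \<partial>lborel) \<partial>lborel) = (\<integral>x. f (x + e) - f x \<partial>lborel)"
    by (intro integral_cong_AE) auto
  also have "\<dots> = 0"
    using trans[of f e] f by simp
  finally show ?thesis using 1 swap by simp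
qed

section \<open>The divergence theorem below a graph\<close>

text \<open>The uniform bound \<open>M\<close> controls \<open>dom\<close> at large scales: points
  with vertical coordinate below \<open>- M\<close> lie inside and those above \<open>M\<close>
  outside, which makes the rescaled domains converge to a half space.\<close>

locale C1_subgraph =
  fixes \<eta> :: "'a::euclidean_space \<Rightarrow> real" and G :: "'a \<Rightarrow> 'a" and M :: real
  assumes deriv_eta: "\<And>x. (\<eta> has_derivative (\<lambda>h. G x \<bullet> h)) (at x)"
    and cont_G: "continuous_on UNIV G"
    and eta_bound: "\<And>x. \<bar>\<eta> x\<bar> \<le> M"
begin

definition dom :: "('a \<times> real) set" where
  "dom = {x. snd x < \<eta> (fst x)}"

lemma cont_eta: "continuous_on UNIV \<eta>"
  by (rule has_derivative_continuous_on) (use deriv_eta in auto)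

lemma cont_eta_comp [continuous_intros]:
  "continuous_on S f \<Longrightarrow> continuous_on S (\<lambda>x. \<eta> (f x))"
  by (rule continuous_on_compose2[OF cont_eta]) auto

lemma cont_G_comp [continuous_intros]:
  "continuous_on S f \<Longrightarrow> continuous_on S (\<lambda>x. G (f x))"
  by (rule continuous_on_compose2[OF cont_G]) auto

lemma open_dom: "open dom"
  unfolding dom_def by (intro open_Collect_less continuous_intros)

lemma closure_dom: "closure dom = {x. snd x \<le> \<eta> (fst x)}"
proof (rule antisym)
  have "closed {x. snd x \<le> \<eta> (fst x)}"
    by (intro closed_Collect_le continuous_intros)
  then show "closure dom \<subseteq> {x. snd x \<le> \<eta> (fst x)}"
    by (rule closure_minimal[rotated]) (auto simp: dom_def)
  show "{x. snd x \<le> \<eta> (fst x)} \<subseteq> closure dom"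
  proof
    fix x assume x: "x \<in> {x. snd x \<le> \<eta> (fst x)}"
    have "(\<lambda>k. x - (0, 1 / real (Suc k))) \<longlonglongrightarrow> x - (0, 0)"
      using LIMSEQ_Suc[OF lim_1_over_n[where 'a=real]] by (intro tendsto_intros)
    moreover have "\<forall>k. x - (0, 1 / real (Suc k)) \<in> dom"
    proof
      fix k
      define d where "d = 1 / real (Suc k)"
      have "d > 0" by (simp add: d_def)
      then show "x - (0, 1 / real (Suc k)) \<in> dom"
        using x unfolding dom_def d_def[symmetric] by auto
    qed
    moreover have "x - (0, 0) = x" by (simp add: prod_eq_iff)
    ultimately have "(\<forall>k. x - (0, 1 / real (Suc k)) \<in> dom) \<and> (\<lambda>k. x - (0, 1 / real (Suc k))) \<longlonglongrightarrow> x"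
      by metis
    then show "x \<in> closure dom"
      unfolding closure_sequential by (intro exI[of _ "\<lambda>k. x - (0, 1 / real (Suc k))"])
  qed
qed

lemma measurable_on_dom:
  fixes f :: "'a \<times> real \<Rightarrow> real"
  assumes "continuous_on (closure dom) f"
  shows "(\<lambda>x. indicator dom x * f x) \<in> borel_measurable borel"
proof -
  have "continuous_on dom f"
    using assms closure_subset continuous_on_subset by blast
  then have "(\<lambda>x. indicator dom x *\<^sub>R f x) \<in> borel_measurable borel"
    by (rule borel_measurable_continuous_on_indicator[rotated]) (simp add: open_dom)
  then show ?thesis by simp
qed

lemma integrable_on_dom:
  fixes f :: "'a \<times> real \<Rightarrow> real"
  assumes cont: "continuous_on (closure dom) f"
    and supp: "\<And>x. x \<in> dom \<Longrightarrow> norm x > R \<Longrightarrow> f x = 0"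
  shows "integrable lborel (\<lambda>x. indicator dom x * f x)"
proof -
  have "compact (closure dom \<inter> cball 0 R)"
    by (intro closed_Int_compact) auto
  moreover have "continuous_on (closure dom \<inter> cball 0 R) f"
    using cont continuous_on_subset by blast
  ultimately have "bounded (f ` (closure dom \<inter> cball 0 R))"
    using compact_continuous_image compact_imp_bounded by blast
  then obtain B where "\<forall>y\<in>f ` (closure dom \<inter> cball 0 R). norm y \<le> B"
    unfolding bounded_iff by blast
  then have B: "\<bar>f x\<bar> \<le> B" if "x \<in> closure dom \<inter> cball 0 R" for x
    using that by auto
  show ?thesis
  proof (rule Bochner_Integration.integrable_bound)
    show "integrable lborel (\<lambda>x::'a \<times> real. indicator (cball 0 R) x * B)"
      using emeasure_bounded_finite[of "cball (0::'a \<times> real) R"] by (simp add: less_top)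
    show "(\<lambda>x. indicator dom x * f x) \<in> borel_measurable lborel"
      using measurable_on_dom[OF cont] by simp
    show "AE x in lborel. norm (indicator dom x * f x) \<le> norm (indicator (cball 0 R) x * B)"
    proof (rule AE_I2)
      fix x :: "'a \<times> real"
      show "norm (indicator dom x * f x) \<le> norm (indicator (cball 0 R) x * B)"
        using supp[of x] B[of x] closure_subset[of dom]
        by (cases "x \<in> dom"; cases "norm x \<le> R") (auto simp: indicator_def)
    qed
  qed
qed

text \<open>Fubini and the fundamental theorem of calculus on each vertical line: the lower end
  contributes nothing by the support condition, and the upper end is the point on the
  surface.\<close>

lemma integral_vertical_derivative:
  fixes f D :: "'a \<times> real \<Rightarrow> real"
  assumes cont: "continuous_on (closure dom) f" "continuous_on (closure dom) D"
    and deriv: "\<And>x t. (x, t) \<in> dom \<Longrightarrow> ((\<lambda>t. f (x, t)) has_real_derivative D (x, t)) (at t)"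
    and supp: "\<And>x. x \<in> dom \<Longrightarrow> norm x > R \<Longrightarrow> f x = 0"
      "\<And>x. x \<in> dom \<Longrightarrow> norm x > R \<Longrightarrow> D x = 0"
  shows "integral\<^sup>L lborel (\<lambda>x. indicator dom x * D x) = integral\<^sup>L lborel (\<lambda>x. f (x, \<eta> x))"
proof -
  have int: "integrable (lborel \<Otimes>\<^sub>M lborel) (\<lambda>x. indicator dom x * D x)"
    using integrable_on_dom[OF cont(2) supp(2)] by (simp add: lborel_prod)
  have inner: "integral\<^sup>L lborel (\<lambda>t. indicator dom (x, t) * D (x, t)) = f (x, \<eta> x)" for x
  proof -
    \<comment> \<open>A height below both the surface and the ball of radius \<open>R\<close>: from
      \<open>a\<close> downwards the line stays in \<open>dom\<close> and outside the
      support.\<close>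
    define a where "a = min (\<eta> x) (- R) - 1"
    have a: "a < \<eta> x" "a < - R" by (auto simp: a_def)
    have below: "(x, t) \<in> dom" "norm (x, t) > R" if "t \<le> a" for t
    proof -
      show "(x, t) \<in> dom" using that a by (simp add: dom_def)
      have "\<bar>t\<bar> \<le> norm (x, t)" using norm_snd_le[of t x] by simp
      then show "norm (x, t) > R" using that a by linarith
    qed
    have line: "(\<lambda>t. (x, t)) ` {a..\<eta> x} \<subseteq> closure dom" by (auto simp: closure_dom)
    have c: "continuous_on {a..\<eta> x} (\<lambda>t. f (x, t))" "continuous_on {a..\<eta> x} (\<lambda>t. D (x, t))"
      by (rule continuous_on_compose2[OF cont(1) _ line] continuous_on_compose2[OF cont(2) _ line];
          intro continuous_intros)+
    have "((\<lambda>t. D (x, t)) has_integral (f (x, \<eta> x) - f (x, a))) {a..\<eta> x}"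
    \<comment> \<open>The interior version is used because at t = \<open>\<eta> x\<close> the
      function is known to be continuous only, not differentiable.\<close>
    proof (rule fundamental_theorem_of_calculus_interior)
      fix t assume "t \<in> {a<..<\<eta> x}"
      then show "((\<lambda>t. f (x, t)) has_vector_derivative D (x, t)) (at t)"
        using deriv[of x t] by (simp add: dom_def has_real_derivative_iff_has_vector_derivative)
    qed (use a c in auto)
    then have 1: "integral {a..\<eta> x} (\<lambda>t. D (x, t)) = f (x, \<eta> x)"
      using supp(1)[OF below, of a] by (simp add: integral_unique)
    have "integral\<^sup>L lborel (\<lambda>t. indicator dom (x, t) * D (x, t))
        = (LINT t:{a..\<eta> x}|lborel. D (x, t))"
      unfolding set_lebesgue_integral_def
    proof (rule integral_cong_AE)
      \<comment> \<open>The closed interval contains the surface point and the open set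
        \<open>dom\<close> does not; this single point is the only place where the indicators
        disagree on the support.\<close>
      have "AE t in lborel. t \<noteq> \<eta> x" by (rule AE_lborel_singleton)
      then show "AE t in lborel. indicator dom (x, t) * D (x, t)
          = indicator {a..\<eta> x} t *\<^sub>R D (x, t)"
      proof eventually_elim
        case (elim t)
        then show ?case
          using supp(2)[OF below, of t] by (cases "t \<le> a") (auto simp: dom_def indicator_def)
      qed
      show "(\<lambda>t. indicator dom (x, t) * D (x, t)) \<in> borel_measurable lborel"
        using measurable_compose[OF _ measurable_on_dom[OF cont(2)], of "Pair x" lborel]
        by simp
      show "(\<lambda>t. indicator {a..\<eta> x} t *\<^sub>R D (x, t)) \<in> borel_measurable lborel"
        using borel_integrable_atLeastAtMost'[OF c(2)] by (auto simp: set_integrable_def)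
    qed
    also have "\<dots> = f (x, \<eta> x)"
      using set_borel_integral_eq_integral(2)[OF borel_integrable_atLeastAtMost'[OF c(2)]] 1 by simp
    finally show ?thesis .
  qed
  have "integral\<^sup>L lborel (\<lambda>x. indicator dom x * D x)
      = integral\<^sup>L (lborel \<Otimes>\<^sub>M lborel) (\<lambda>x. indicator dom x * D x)"
    by (simp add: lborel_prod)
  also have "\<dots> = (\<integral>x. (\<integral>t. indicator dom (x, t) * D (x, t) \<partial>lborel) \<partial>lborel)"
    by (rule lborel_pair.integral_fst'[OF int, symmetric])
  finally show ?thesis by (simp add: inner)
qed

text \<open>The vector field \<open>(e, G \<bullet> e)\<close> is tangential to all vertical translates of the graph, so
  after flattening it becomes a constant horizontal field.\<close>

lemma integral_tangential_derivative:
  fixes f :: "'a \<times> real \<Rightarrow> real" and D :: "'a \<times> real \<Rightarrow> 'a \<times> real \<Rightarrow> real"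
  assumes cont: "continuous_on (closure dom) f" "\<And>h. continuous_on (closure dom) (\<lambda>x. D x h)"
    and deriv: "\<And>x. x \<in> dom \<Longrightarrow> (f has_derivative D x) (at x)"
    and supp: "\<And>x. x \<in> dom \<Longrightarrow> norm x > R \<Longrightarrow> f x = 0"
      "\<And>x h. x \<in> dom \<Longrightarrow> norm x > R \<Longrightarrow> D x h = 0"
  shows "integral\<^sup>L lborel (\<lambda>x. indicator dom x * (D x (e, 0) + (G (fst x) \<bullet> e) * D x (0, 1))) = 0"
proof -
  define T where "T = (\<lambda>x::'a \<times> real. (fst x, snd x + \<eta> (fst x)))"
  define g where "g = (\<lambda>x. indicator dom x * f x)"
  define g' where "g' = (\<lambda>x. indicator dom x * (D x (e, 0) + (G (fst x) \<bullet> e) * D x (0, 1)))"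
  have eta_m: "\<eta> \<in> borel_measurable borel"
    by (rule borel_measurable_continuous_onI[OF cont_eta])
  have T_inv: "distr lborel borel T = lborel"
    unfolding T_def by (rule distr_lborel_shear[OF eta_m])
  have T_m: "T \<in> borel_measurable borel"
    unfolding T_def by (intro borel_measurable_continuous_onI continuous_intros)
  have gi: "integrable lborel g"
    unfolding g_def by (rule integrable_on_dom[OF cont(1) supp(1)])
  have g'i: "integrable lborel g'"
    unfolding g'_def
    by (rule integrable_on_dom[where R=R]) (use supp in \<open>auto intro!: continuous_intros cont\<close>)
  have gm: "g \<in> borel_measurable borel" "g' \<in> borel_measurable borel"
    using gi g'i by auto
  have "integral\<^sup>L lborel (\<lambda>x. g' (T x)) = 0"
  proof (rule integral_directional_derivative_eq_0)
    show "integrable lborel (\<lambda>x. g (T x))" "integrable lborel (\<lambda>x. g' (T x))"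
      using integral_distr_invariant(2)[OF T_inv T_m] gm gi g'i by auto
    fix z :: "'a \<times> real"
    obtain x y where z: "z = (x, y)" by (cases z)
    \<comment> \<open>In flattened coordinates \<open>dom\<close> is the half space
      \<open>y < 0\<close>, so a horizontal segment lies wholly inside or wholly outside and the
      indicator never cuts it.\<close>
    have dom_iff: "T (z + s *\<^sub>R (e, 0)) \<in> dom \<longleftrightarrow> y < 0" for s
      by (simp add: z T_def dom_def)
    show "((\<lambda>s. g' (T (z + s *\<^sub>R (e, 0)))) has_integral g (T (z + (e, 0))) - g (T z)) {0..1}"
    proof (cases "y < 0")
      case False
      then have "T (z + s *\<^sub>R (e, 0)) \<notin> dom" for s using dom_iff by simp
      moreover from this[of 0] this[of 1] have "T z \<notin> dom" "T (z + (e, 0)) \<notin> dom"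
        by (simp_all add: z)
      ultimately show ?thesis by (simp add: g_def g'_def)
    next
      case True
      have in_dom: "T (z + s *\<^sub>R (e, 0)) \<in> dom" for s using dom_iff True by simp
      have lin: "D w (e, t) = D w (e, 0) + t * D w (0, 1)" if "w \<in> dom" for w t
      proof -
        have l: "linear (D w)" using deriv[OF that] has_derivative_linear by blast
        show ?thesis
          using linear_add[OF l, of "(e, 0)" "(0, t)"] linear_scale[OF l, of t "(0, 1)"] by simp
      qed
      have "((\<lambda>s. D (T (z + s *\<^sub>R (e, 0))) (e, G (x + s *\<^sub>R e) \<bullet> e)) has_integral
          f (T (z + 1 *\<^sub>R (e, 0))) - f (T (z + 0 *\<^sub>R (e, 0)))) {0..1}"
      proof (rule fundamental_theorem_of_calculus)
        fix s :: real
        have p: "((\<lambda>s. x + s *\<^sub>R e) has_derivative (\<lambda>h. h *\<^sub>R e)) (at s within {0..1})"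
          by (auto intro!: derivative_eq_intros)
        have "((\<lambda>s. \<eta> (x + s *\<^sub>R e)) has_derivative (\<lambda>h. G (x + s *\<^sub>R e) \<bullet> (h *\<^sub>R e))) (at s within {0..1})"
          by (rule has_derivative_compose[OF p deriv_eta])
        then have q: "((\<lambda>s. T (z + s *\<^sub>R (e, 0))) has_derivative
            (\<lambda>h. (h *\<^sub>R e, G (x + s *\<^sub>R e) \<bullet> (h *\<^sub>R e)))) (at s within {0..1})"
          unfolding T_def z by (auto intro!: derivative_eq_intros)
        have l: "linear (D (T (z + s *\<^sub>R (e, 0))))"
          using deriv[OF in_dom] has_derivative_linear by blast
        have "((\<lambda>s. f (T (z + s *\<^sub>R (e, 0)))) has_derivative
            (\<lambda>h. D (T (z + s *\<^sub>R (e, 0))) (h *\<^sub>R e, G (x + s *\<^sub>R e) \<bullet> (h *\<^sub>R e)))) (at s within {0..1})"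
          by (rule has_derivative_compose[OF q deriv[OF in_dom]])
        moreover have "(h *\<^sub>R e, G (x + s *\<^sub>R e) \<bullet> (h *\<^sub>R e)) = h *\<^sub>R (e, G (x + s *\<^sub>R e) \<bullet> e)" for h
          by simp
        ultimately show "((\<lambda>s. f (T (z + s *\<^sub>R (e, 0)))) has_vector_derivative
            D (T (z + s *\<^sub>R (e, 0))) (e, G (x + s *\<^sub>R e) \<bullet> e)) (at s within {0..1})"
          unfolding has_vector_derivative_def by (simp only: linear_scale[OF l])
      qed simp
      moreover have "g' (T (z + s *\<^sub>R (e, 0))) = D (T (z + s *\<^sub>R (e, 0))) (e, G (x + s *\<^sub>R e) \<bullet> e)" for s
        using in_dom[of s] lin[OF in_dom[of s], of "G (x + s *\<^sub>R e) \<bullet> e"]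
        by (simp add: g'_def) (simp add: T_def z)
      moreover have "g (T (z + s *\<^sub>R (e, 0))) = f (T (z + s *\<^sub>R (e, 0)))" for s
        using in_dom[of s] by (simp add: g_def)
      from this[of 0] this[of 1] have "g (T z) = f (T (z + 0 *\<^sub>R (e, 0)))" "g (T (z + (e, 0))) = f (T (z + 1 *\<^sub>R (e, 0)))"
        by (simp_all add: z)
      ultimately show ?thesis by simp
    qed
  qed
  then show ?thesis
    using integral_distr_invariant(1)[OF T_inv T_m gm(2)] by (simp add: g'_def)
qed

end

section \<open>Radial cutoffs and their derivatives\<close>

text \<open>Away from the origin this is the chain rule. At the origin, where the norm itself is not
  differentiable, the difference quotient is |y|^(n-1), which tends to 0 because n >= 2.\<close>

lemma has_derivative_norm_power:
  fixes x :: "'a::real_inner"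
  assumes n: "n \<ge> 2"
  shows "((\<lambda>x. norm x ^ n) has_derivative (\<lambda>h. real n * norm x ^ (n - 2) * (x \<bullet> h))) (at x)"
proof (cases "x = 0")
  case False
  have "((\<lambda>x. norm x ^ n) has_derivative (\<lambda>h. real n * (h \<bullet> sgn x) * norm x ^ (n - 1))) (at x)"
    using False GDERIV_norm[of x] by (auto simp: gderiv_def intro!: derivative_eq_intros)
  moreover have "norm x ^ (n - 1) = norm x * norm x ^ (n - 2)"
    using n by (metis Suc_1 Suc_diff_le diff_Suc_Suc power_Suc)
  ultimately show ?thesis
    using False by (simp add: sgn_div_norm inner_commute field_simps)
next
  case True
  have "(\<lambda>y::'a. norm y ^ (n - 1)) \<midarrow>0\<rightarrow> norm (0::'a) ^ (n - 1)"
    by (intro tendsto_intros)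
  moreover have "norm y ^ n / norm y = norm y ^ (n - 1)" for y :: 'a
    using n by (cases "y = 0") (auto simp: power_diff)
  ultimately show ?thesis
    using n True by (simp add: has_derivative_iff_norm power_0_left)
qed

text \<open>Squaring removes the corner of the positive part at 0; this is why the cutoff carries a
  square.\<close>

lemma has_real_derivative_pos_part_square:
  "((\<lambda>u. (max 0 u)\<^sup>2) has_real_derivative 2 * max 0 u) (at u)" for u :: real
proof -
  consider "u < 0" | "u = 0" | "u > 0" by linarith
  then show ?thesis
  proof cases
    case 1
    have "((\<lambda>u::real. 0) has_real_derivative 2 * max 0 u) (at u)" using 1 by simp
    then show ?thesis
      by (rule has_field_derivative_transform_within_open[of _ _ _ "{..<0}"]) (use 1 in auto)
  next
    case 3
    have "((\<lambda>u::real. u\<^sup>2) has_real_derivative 2 * max 0 u) (at u)"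
      using 3 by (auto intro!: derivative_eq_intros)
    then show ?thesis
      by (rule has_field_derivative_transform_within_open[of _ _ _ "{0<..}"]) (use 3 in auto)
  next
    case 2
    have "((\<lambda>h. (max 0 h)\<^sup>2 / h) \<longlongrightarrow> 0) (at (0::real))"
    proof (rule Lim_null_comparison)
      show "\<forall>\<^sub>F h in at (0::real). norm ((max 0 h)\<^sup>2 / h) \<le> \<bar>h\<bar>"
        by (intro always_eventually allI) (auto simp: max_def power2_eq_square)
      show "((\<lambda>h::real. \<bar>h\<bar>) \<longlongrightarrow> 0) (at 0)" by (rule tendsto_rabs_zero) (rule tendsto_ident_at)
    qed
    then show ?thesis using 2 by (simp add: DERIV_def)
  qed
qed

text \<open>The square gives differentiability on the sphere of radius \<open>R\<close>, the power
  \<open>n\<close> differentiability at the origin. Taking \<open>n\<close> to be the dimension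
  makes the factor \<open>R ^ n\<close> in the derivative match the Jacobian of the dilation by
  \<open>R\<close>.\<close>

definition cutoff :: "nat \<Rightarrow> real \<Rightarrow> 'a::real_inner \<Rightarrow> real" where
  "cutoff n R x = (max 0 (1 - (norm x / R) ^ n))\<^sup>2"

definition cutoff_deriv :: "nat \<Rightarrow> real \<Rightarrow> 'a::real_inner \<Rightarrow> 'a \<Rightarrow> real" where
  "cutoff_deriv n R x h =
     - (2 * real n / R ^ n) * (max 0 (1 - (norm x / R) ^ n) * (norm x ^ (n - 2) * (x \<bullet> h)))"

lemma has_derivative_cutoff:
  assumes "n \<ge> 2"
  shows "(cutoff n R has_derivative cutoff_deriv n R x) (at x)"
proof -
  have 1: "((\<lambda>x. 1 - (norm x / R) ^ n) has_derivative
      (\<lambda>h. - (real n / R ^ n * (norm x ^ (n - 2) * (x \<bullet> h))))) (at x)"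
  proof -
    have "((\<lambda>x. 1 - norm x ^ n * inverse (R ^ n)) has_derivative
        (\<lambda>h. 0 - (real n * norm x ^ (n - 2) * (x \<bullet> h)) * inverse (R ^ n))) (at x)"
      by (intro has_derivative_diff has_derivative_const has_derivative_mult_left
          has_derivative_norm_power assms)
    then show ?thesis
      by (simp add: divide_inverse power_mult_distrib power_inverse mult_ac)
  qed
  have "((\<lambda>x. (max 0 (1 - (norm x / R) ^ n))\<^sup>2) has_derivative
      (\<lambda>h. - (real n / R ^ n * (norm x ^ (n - 2) * (x \<bullet> h))) * (2 * max 0 (1 - (norm x / R) ^ n)))) (at x)"
    using has_derivative_compose[OF 1 has_real_derivative_pos_part_square[unfolded has_field_derivative_def]]
    by (simp add: mult_ac)
  then show ?thesis
    unfolding cutoff_def[abs_def] cutoff_deriv_def[abs_def] by (simp add: mult_ac)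
qed

lemma continuous_on_cutoff [continuous_intros]: "continuous_on S (cutoff n R)"
  unfolding cutoff_def[abs_def] divide_inverse by (intro continuous_intros)

lemma continuous_on_cutoff_deriv [continuous_intros]:
  "continuous_on S f \<Longrightarrow> continuous_on S (\<lambda>x. cutoff_deriv n R x (f x))"
  unfolding cutoff_deriv_def[abs_def] divide_inverse by (intro continuous_intros)

lemma cutoff_outside:
  assumes "R > 0" "norm x > R"
  shows "cutoff n R x = 0" "cutoff_deriv n R x h = 0"
proof -
  have "1 \<le> (norm x / R) ^ n" using assms by (intro one_le_power) simp
  then show "cutoff n R x = 0" "cutoff_deriv n R x h = 0"
    by (simp_all add: cutoff_def cutoff_deriv_def max_def)
qed

lemma cutoff_bounds: "0 \<le> cutoff n R x" "R > 0 \<Longrightarrow> cutoff n R x \<le> 1"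
proof -
  show "0 \<le> cutoff n R x" by (simp add: cutoff_def)
  assume "R > 0"
  then have "(norm x / R) ^ n \<ge> 0" by simp
  then show "cutoff n R x \<le> 1"
    unfolding cutoff_def by (intro power_le_one) auto
qed

lemma cutoff_tendsto_1:
  assumes "n > 0"
  shows "(\<lambda>k. cutoff n (real (Suc k)) x) \<longlonglongrightarrow> 1"
proof -
  have "(\<lambda>k. norm x * (1 / real (Suc k))) \<longlonglongrightarrow> norm x * 0"
    by (rule tendsto_mult[OF tendsto_const LIMSEQ_Suc[OF lim_1_over_n[where 'a=real]]])
  then have "(\<lambda>k. (max 0 (1 - (norm x * (1 / real (Suc k))) ^ n))\<^sup>2) \<longlonglongrightarrow> (max 0 (1 - (norm x * 0) ^ n))\<^sup>2"
    by (intro tendsto_power tendsto_max tendsto_const tendsto_diff)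
  then show ?thesis
    using assms by (simp add: cutoff_def power_0_left)
qed

lemma integrable_continuous_compact_support:
  fixes f :: "'a::euclidean_space \<Rightarrow> real"
  assumes cont: "continuous_on UNIV f" and supp: "\<And>x. norm x > R \<Longrightarrow> f x = 0"
  shows "integrable lborel f"
proof -
  have "integrable lborel (\<lambda>x. indicator (cball 0 R) x *\<^sub>R f x)"
    by (rule borel_integrable_compact) (use cont continuous_on_subset in auto)
  moreover have "(\<lambda>x. indicator (cball 0 R) x *\<^sub>R f x) = f"
    using supp by (force simp: indicator_def)
  ultimately show ?thesis by simp
qed

section \<open>Divergence theorem for compactly supported and cut-off fields\<close>

context C1_subgraph
begin

text \<open>The length of this unnormalized normal is the area element of the graph, so fluxes
  through the surface become Lebesgue integrals over the horizontal space.\<close>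

definition surface_normal :: "'a \<Rightarrow> 'a \<times> real" where
  "surface_normal x = (- G x, 1)"

text \<open>A horizontal direction \<open>(e, 0)\<close> is the tangential field
  \<open>(e, G \<bullet> e)\<close> minus \<open>G \<bullet> e\<close> times the vertical one. The
  tangential derivative integrates to 0, so only vertical derivatives remain, and these produce the
  surface term.\<close>

lemma integral_derivative_compact_support:
  fixes f :: "'a \<times> real \<Rightarrow> real" and D :: "'a \<times> real \<Rightarrow> 'a \<times> real \<Rightarrow> real"
  assumes cont: "continuous_on (closure dom) f" "\<And>h. continuous_on (closure dom) (\<lambda>x. D x h)"
    and deriv: "\<And>x. x \<in> dom \<Longrightarrow> (f has_derivative D x) (at x)"
    and supp: "\<And>x. x \<in> closure dom \<Longrightarrow> norm x > R \<Longrightarrow> f x = 0"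
      "\<And>x h. x \<in> closure dom \<Longrightarrow> norm x > R \<Longrightarrow> D x h = 0"
  shows "integral\<^sup>L lborel (\<lambda>x. indicator dom x * D x v)
       = integral\<^sup>L lborel (\<lambda>x. f (x, \<eta> x) * (v \<bullet> surface_normal x))"
    and "integrable lborel (\<lambda>x. f (x, \<eta> x) * (v \<bullet> surface_normal x))"
proof -
  obtain e s where v: "v = (e, s)" by (cases v)
  have supp': "\<And>x. x \<in> dom \<Longrightarrow> norm x > R \<Longrightarrow> f x = 0"
      "\<And>x h. x \<in> dom \<Longrightarrow> norm x > R \<Longrightarrow> D x h = 0"
    using supp subsetD[OF closure_subset] by blast+
  have graph: "(x, \<eta> x) \<in> closure dom" for x by (simp add: closure_dom)
  have cf: "continuous_on UNIV (\<lambda>x. f (x, \<eta> x))"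
    by (rule continuous_on_compose2[OF cont(1)]) (auto intro!: continuous_intros simp: graph)
  have sf: "f (x, \<eta> x) = 0" if "norm x > R" for x
    using supp(1)[OF graph[of x]] norm_fst_le[of x "\<eta> x"] that by simp
  have int_surf: "integrable lborel (\<lambda>x. f (x, \<eta> x) * w x)" if "continuous_on UNIV w" for w
    by (rule integrable_continuous_compact_support[of _ R])
      (use that sf in \<open>auto intro!: continuous_intros cf\<close>)
  show "integrable lborel (\<lambda>x. f (x, \<eta> x) * (v \<bullet> surface_normal x))"
    by (rule int_surf) (auto simp: surface_normal_def intro!: continuous_intros)
  have deriv_v: "((\<lambda>t. f (x, t)) has_real_derivative D (x, t) (0, 1)) (at t)" if "(x, t) \<in> dom" for x t
  proof -
    have "((\<lambda>t. (x, t)) has_derivative (\<lambda>h. (0, h))) (at t)"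
      by (auto intro!: derivative_eq_intros)
    from has_derivative_compose[OF this deriv[OF that]]
    have "((\<lambda>t. f (x, t)) has_derivative (\<lambda>h. D (x, t) (0, h))) (at t)" .
    moreover have "(\<lambda>h. D (x, t) (0, h)) = (*) (D (x, t) (0, 1))"
    proof
      fix h
      show "D (x, t) (0, h) = D (x, t) (0, 1) * h"
        using linear_scale[OF has_derivative_linear[OF deriv[OF that]], of h "(0, 1)"]
        by (simp add: mult.commute)
    qed
    ultimately show ?thesis by (simp only: has_field_derivative_def)
  qed
  \<comment> \<open>A weight depending on the horizontal variable alone is constant along vertical
    lines; the case needed besides \<open>1\<close> is \<open>G x \<bullet> e\<close>.\<close>
  have vert: "integral\<^sup>L lborel (\<lambda>x. indicator dom x * (w (fst x) * D x (0, 1)))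
      = integral\<^sup>L lborel (\<lambda>x. w x * f (x, \<eta> x))" if w: "continuous_on UNIV w" for w
  proof -
    have cw: "continuous_on S (\<lambda>x::'a \<times> real. w (fst x))" for S
      by (rule continuous_on_compose2[OF w]) (auto intro!: continuous_intros)
    have "((\<lambda>t. w x * f (x, t)) has_real_derivative w x * D (x, t) (0, 1)) (at t)"
      if "(x, t) \<in> dom" for x t
      by (rule DERIV_cmult[OF deriv_v[OF that]])
    then have "((\<lambda>t. w (fst (x, t)) * f (x, t)) has_real_derivative w (fst (x, t)) * D (x, t) (0, 1)) (at t)"
      if "(x, t) \<in> dom" for x t
      using that by simp
    from integral_vertical_derivative[OF continuous_on_mult[OF cw cont(1)] continuous_on_mult[OF cw cont(2)] this, of R]
    show ?thesis using supp' by simp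
  qed
  have id: "integrable lborel (\<lambda>x. indicator dom x * (w x * D x h))"
    if "continuous_on (closure dom) w" for w h
    by (rule integrable_on_dom[where R=R]) (use supp' that in \<open>auto intro!: continuous_intros cont\<close>)
  have id1: "integrable lborel (\<lambda>x. indicator dom x * D x h)" for h
    using id[of "\<lambda>x. 1" h] by simp
  have idG: "integrable lborel (\<lambda>x. indicator dom x * ((G (fst x) \<bullet> e) * D x (0, 1)))"
    by (rule id) (intro continuous_intros)
  have tang: "integral\<^sup>L lborel (\<lambda>x. indicator dom x * D x (e, 0))
      = - integral\<^sup>L lborel (\<lambda>x. indicator dom x * ((G (fst x) \<bullet> e) * D x (0, 1)))"
    using integral_tangential_derivative[OF cont deriv supp', where e=e and R=R] id1 idG
    by (simp add: distrib_left)
  have split: "indicator dom x * D x v = indicator dom x * D x (e, 0) + s * (indicator dom x * D x (0, 1))" for x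
  proof (cases "x \<in> dom")
    case True
    have l: "linear (D x)" using deriv[OF True] has_derivative_linear by blast
    show ?thesis
      using linear_add[OF l, of "(e, 0)" "(0, s)"] linear_scale[OF l, of s "(0, 1)"] by (simp add: v True)
  qed simp
  have "integral\<^sup>L lborel (\<lambda>x. indicator dom x * D x v)
      = integral\<^sup>L lborel (\<lambda>x. indicator dom x * D x (e, 0)) + s * integral\<^sup>L lborel (\<lambda>x. indicator dom x * D x (0, 1))"
    unfolding split using id1 by simp
  also have "\<dots> = - integral\<^sup>L lborel (\<lambda>x. (G x \<bullet> e) * f (x, \<eta> x)) + s * integral\<^sup>L lborel (\<lambda>x. 1 * f (x, \<eta> x))"
    unfolding tang using vert[of "\<lambda>x. G x \<bullet> e"] vert[of "\<lambda>x. 1"] by (simp add: continuous_intros)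
  also have "\<dots> = integral\<^sup>L lborel (\<lambda>x. - (f (x, \<eta> x) * (G x \<bullet> e)) + s * (f (x, \<eta> x) * 1))"
    using int_surf[of "\<lambda>x. G x \<bullet> e"] int_surf[of "\<lambda>x. 1"]
    by (simp add: continuous_intros mult.commute)
  also have "(\<lambda>x. - (f (x, \<eta> x) * (G x \<bullet> e)) + s * (f (x, \<eta> x) * 1))
      = (\<lambda>x. f (x, \<eta> x) * (v \<bullet> surface_normal x))"
    by (auto simp: v surface_normal_def inner_commute algebra_simps)
  finally show "integral\<^sup>L lborel (\<lambda>x. indicator dom x * D x v)
       = integral\<^sup>L lborel (\<lambda>x. f (x, \<eta> x) * (v \<bullet> surface_normal x))" .
qed

text \<open>The scalar formula applied to each component \<open>F \<bullet> b\<close> times the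
  cutoff, in the direction \<open>b\<close>, and summed over the basis.\<close>

lemma integral_cutoff_divergence:
  fixes F :: "'a \<times> real \<Rightarrow> 'a \<times> real" and F' :: "'a \<times> real \<Rightarrow> 'a \<times> real \<Rightarrow> 'a \<times> real"
  assumes n: "n \<ge> 2" and R: "R > 0"
    and cont: "continuous_on (closure dom) F" "\<And>h. continuous_on (closure dom) (\<lambda>x. F' x h)"
    and deriv: "\<And>x. x \<in> dom \<Longrightarrow> (F has_derivative F' x) (at x)"
  shows "integral\<^sup>L lborel (\<lambda>x. indicator dom x *
            (cutoff_deriv n R x (F x) + cutoff n R x * (\<Sum>b\<in>Basis. F' x b \<bullet> b)))
       = integral\<^sup>L lborel (\<lambda>x. cutoff n R (x, \<eta> x) * (F (x, \<eta> x) \<bullet> surface_normal x))"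
proof -
  define f where "f = (\<lambda>b x. cutoff n R x * (F x \<bullet> b))"
  define D where "D = (\<lambda>b x h. cutoff_deriv n R x h * (F x \<bullet> b) + cutoff n R x * (F' x h \<bullet> b))"
  have cf: "continuous_on (closure dom) (f b)" "\<And>h. continuous_on (closure dom) (\<lambda>x. D b x h)" for b
    unfolding f_def D_def by (auto intro!: continuous_intros cont)
  have df: "(f b has_derivative D b x) (at x)" if "x \<in> dom" for b x
    unfolding f_def D_def
    by (auto intro!: derivative_eq_intros has_derivative_cutoff[OF n] deriv[OF that])
  have sf: "f b x = 0" "D b x h = 0" if "norm x > R" for b x h
    using cutoff_outside[OF R that] by (auto simp: f_def D_def)
  have surf_i: "integrable lborel (\<lambda>x. f b (x, \<eta> x) * (b \<bullet> surface_normal x))" for b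
    by (rule integral_derivative_compact_support(2)[OF cf df, where R=R]) (use sf in auto)
  have eq: "integral\<^sup>L lborel (\<lambda>x. indicator dom x * D b x b)
      = integral\<^sup>L lborel (\<lambda>x. f b (x, \<eta> x) * (b \<bullet> surface_normal x))" for b
    by (rule integral_derivative_compact_support(1)[OF cf df, where R=R]) (use sf in auto)
  have int: "integrable lborel (\<lambda>x. indicator dom x * D b x b)" for b
    by (rule integrable_on_dom[OF cf(2), where R=R]) (use sf in auto)
  have lin: "(\<Sum>b\<in>Basis. cutoff_deriv n R x b * (F x \<bullet> b)) = cutoff_deriv n R x (F x)" for x :: "'a \<times> real"
  proof -
    have "x \<bullet> F x = (\<Sum>b\<in>Basis. (x \<bullet> b) * (F x \<bullet> b))" by (rule euclidean_inner)
    then show ?thesis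
      unfolding cutoff_deriv_def by (simp add: sum_distrib_left mult_ac)
  qed
  have "integral\<^sup>L lborel (\<lambda>x. indicator dom x *
            (cutoff_deriv n R x (F x) + cutoff n R x * (\<Sum>b\<in>Basis. F' x b \<bullet> b)))
      = integral\<^sup>L lborel (\<lambda>x. \<Sum>b\<in>Basis. indicator dom x * D b x b)"
    by (simp add: D_def sum.distrib lin sum_distrib_left distrib_left flip: sum_distrib_left)
  also have "\<dots> = (\<Sum>b\<in>Basis. integral\<^sup>L lborel (\<lambda>x. indicator dom x * D b x b))"
    by (rule Bochner_Integration.integral_sum) (rule int)
  also have "\<dots> = (\<Sum>b\<in>Basis. integral\<^sup>L lborel (\<lambda>x. f b (x, \<eta> x) * (b \<bullet> surface_normal x)))"
    by (simp only: eq)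
  also have "\<dots> = integral\<^sup>L lborel (\<lambda>x. \<Sum>b\<in>Basis. f b (x, \<eta> x) * (b \<bullet> surface_normal x))"
    by (rule Bochner_Integration.integral_sum[symmetric]) (rule surf_i)
  also have "(\<lambda>x. \<Sum>b\<in>Basis. f b (x, \<eta> x) * (b \<bullet> surface_normal x))
      = (\<lambda>x. cutoff n R (x, \<eta> x) * (F (x, \<eta> x) \<bullet> surface_normal x))"
  proof
    fix x
    have "F (x, \<eta> x) \<bullet> surface_normal x = (\<Sum>b\<in>Basis. (F (x, \<eta> x) \<bullet> b) * (surface_normal x \<bullet> b))"
      by (rule euclidean_inner)
    then show "(\<Sum>b\<in>Basis. f b (x, \<eta> x) * (b \<bullet> surface_normal x))
        = cutoff n R (x, \<eta> x) * (F (x, \<eta> x) \<bullet> surface_normal x)"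
      by (simp add: f_def sum_distrib_left inner_commute mult_ac)
  qed
  finally show ?thesis .
qed

end

section \<open>Flux through infinity as the limit of the cutoff error\<close>

text \<open>The factor of \<open>cutoff_deriv\<close> that remains after rescaling to the unit ball;
  its square is the rescaled cutoff.\<close>

definition cone_weight :: "nat \<Rightarrow> 'a::real_inner \<Rightarrow> real" where
  "cone_weight n y = max 0 (1 - norm y ^ n)"

lemma cone_weight_bounds: "0 \<le> cone_weight n y" "cone_weight n y \<le> 1"
  by (auto simp: cone_weight_def)

lemma cone_weight_outside: "norm y > 1 \<Longrightarrow> cone_weight n y = 0"
  using one_le_power[of "norm y" n] by (simp add: cone_weight_def)

lemma continuous_on_cone_weight [continuous_intros]: "continuous_on S (cone_weight n)"
  unfolding cone_weight_def[abs_def] by (intro continuous_intros)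

lemma AE_snd_neq_0: "AE y in lborel. snd (y :: 'a::euclidean_space \<times> real) \<noteq> 0"
proof -
  have "negligible {y::'a \<times> real. y \<bullet> (0, 1) = 0}"
    by (rule negligible_standard_hyperplane) (simp add: Basis_prod_def)
  moreover have "{y::'a \<times> real. y \<bullet> (0, 1) = 0} = {y. snd y = 0}"
    by (auto simp: inner_prod_def)
  ultimately have "{y::'a \<times> real. snd y = 0} \<in> null_sets (completion lborel)"
    by (simp add: negligible_iff_null_sets)
  moreover have "{y::'a \<times> real. snd y = 0} \<in> sets borel"
    by (intro borel_closed closed_Collect_eq continuous_intros)
  ultimately have "{y::'a \<times> real. snd y = 0} \<in> null_sets lborel"
    by (simp add: null_sets_completion_iff)
  then show ?thesis
    by (rule AE_I') auto
qed

context C1_subgraph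
begin

text \<open>After x = R y the integrand is \<open>cone_weight n y\<close> times |x|^(n-2) (x . F) at
  R y, restricted to the rescaled domain. It is dominated by \<open>B\<close> on the unit ball and
  tends to \<open>cone_weight n y * L y\<close> below the hyperplane and to 0 above it.\<close>

lemma integral_cutoff_deriv_tendsto:
  fixes F :: "'a \<times> real \<Rightarrow> 'a \<times> real" and L :: "'a \<times> real \<Rightarrow> real"
  defines "n \<equiv> DIM('a \<times> real)"
  assumes cont: "continuous_on (closure dom) F"
    and bdd: "\<And>x. x \<in> dom \<Longrightarrow> norm x ^ (n - 2) * \<bar>x \<bullet> F x\<bar> \<le> B"
    and meas: "L \<in> borel_measurable borel"
    and hom: "\<And>r y. r > 0 \<Longrightarrow> L (r *\<^sub>R y) = L y"
    and lim: "((\<lambda>x. norm x ^ (n - 2) * (x \<bullet> F x) - L x) \<longlongrightarrow> 0) (at_infinity_within dom)"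
  shows "(\<lambda>k. integral\<^sup>L lborel (\<lambda>x. indicator dom x * cutoff_deriv n (real (Suc k)) x (F x)))
      \<longlonglongrightarrow> - (2 * real n) * integral\<^sup>L lborel (\<lambda>y. indicator {y. snd y < 0} y * (cone_weight n y * L y))"
proof -
  define h where "h = (\<lambda>x. norm x ^ (n - 2) * (x \<bullet> F x))"
  define s where "s = (\<lambda>k y. indicator dom (real (Suc k) *\<^sub>R y) * (cone_weight n y * h (real (Suc k) *\<^sub>R y)))"
  have hm: "(\<lambda>x. indicator dom x * h x) \<in> borel_measurable borel"
    by (rule measurable_on_dom) (auto simp: h_def intro!: continuous_intros cont)
  have cwm: "(\<lambda>x. cone_weight n (f x)) \<in> borel_measurable borel"
    if "f \<in> borel_measurable borel" for f :: "'a \<times> real \<Rightarrow> 'a \<times> real"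
    using measurable_compose[OF that borel_measurable_continuous_onI[OF continuous_on_cone_weight]] .
  have resc: "integral\<^sup>L lborel (\<lambda>x. indicator dom x * cutoff_deriv n (real (Suc k)) x (F x))
      = - (2 * real n) * integral\<^sup>L lborel (s k)" for k
  proof -
    define R where "R = real (Suc k)"
    have R: "R > 0" by (simp add: R_def)
    have m: "(\<lambda>x. indicator dom x * cutoff_deriv n R x (F x)) \<in> borel_measurable borel"
      by (rule measurable_on_dom) (intro continuous_intros cont)
    \<comment> \<open>The factor 1 / \<open>R ^ n\<close> displayed here is what the Jacobian of the
      dilation cancels.\<close>
    have pt: "indicator dom (R *\<^sub>R y) * cutoff_deriv n R (R *\<^sub>R y) (F (R *\<^sub>R y))
        = - (2 * real n) / R ^ n * s k y" for y
    proof -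
      have "s k y = indicator dom (R *\<^sub>R y) * (cone_weight n y * h (R *\<^sub>R y))"
        by (simp only: s_def R_def)
      then show ?thesis
        using R by (simp add: cutoff_deriv_def h_def cone_weight_def)
    qed
    have "integral\<^sup>L lborel (\<lambda>x. indicator dom x * cutoff_deriv n R x (F x))
        = R ^ n * (integral\<^sup>L lborel (\<lambda>y. - (2 * real n) / R ^ n * s k y))"
      using integral_lborel_scaleR[OF less_imp_neq[OF R, symmetric] m] R
      by (simp only: n_def[symmetric] pt abs_of_pos)
    also have "\<dots> = - (2 * real n) * integral\<^sup>L lborel (s k)"
      using R by simp
    finally show ?thesis unfolding R_def .
  qed
  have sm: "s k \<in> borel_measurable lborel" for k
  proof -
    have "(\<lambda>y. cone_weight n y * (indicator dom (real (Suc k) *\<^sub>R y) * h (real (Suc k) *\<^sub>R y))) \<in> borel_measurable borel"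
      by (intro borel_measurable_times cwm measurable_compose[OF _ hm] borel_measurable_continuous_onI continuous_intros)
    then show ?thesis by (simp add: s_def mult_ac)
  qed
  have "(\<lambda>k. integral\<^sup>L lborel (s k))
      \<longlonglongrightarrow> integral\<^sup>L lborel (\<lambda>y. indicator {y. snd y < 0} y * (cone_weight n y * L y))"
  proof (rule integral_dominated_convergence)
    show "(\<lambda>y. indicator {y. snd y < 0} y * (cone_weight n y * L y)) \<in> borel_measurable lborel"
      using cwm[of "\<lambda>y. y"] meas by (auto simp: borel_prod[symmetric])
    show "integrable lborel (\<lambda>y::'a \<times> real. indicator (cball 0 1) y * B)"
      using emeasure_bounded_finite[of "cball (0::'a \<times> real) 1"] by (simp add: less_top)
    have "norm (s k y) \<le> indicator (cball 0 1) y * B" for k y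
    proof (cases "norm y \<le> 1 \<and> real (Suc k) *\<^sub>R y \<in> dom")
      case True
      have "\<bar>h (real (Suc k) *\<^sub>R y)\<bar> \<le> B"
        using bdd[of "real (Suc k) *\<^sub>R y"] True by (simp only: h_def abs_mult) simp
      then have "\<bar>cone_weight n y * h (real (Suc k) *\<^sub>R y)\<bar> \<le> 1 * B"
        unfolding abs_mult using cone_weight_bounds[of n y] by (intro mult_mono) auto
      then show ?thesis using True by (simp add: s_def)
    next
      case False
      \<comment> \<open>The point \<open>(0, - M - 1)\<close> lies in \<open>dom\<close>, and the
        hypothesis there bounds a nonnegative number by \<open>B\<close>.\<close>
      have "0 \<le> B"
        using bdd[of "(0, - M - 1)"] eta_bound[of 0] by (simp add: dom_def) (smt (verit) mult_nonneg_nonneg zero_le_power norm_ge_zero)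
      then show ?thesis
        using False cone_weight_outside[of y n] by (auto simp: s_def indicator_def)
    qed
    then show "AE y in lborel. norm (s k y) \<le> indicator (cball 0 1) y * B" for k by simp
    have lim_y: "(\<lambda>k. s k y) \<longlonglongrightarrow> indicator {y. snd y < 0} y * (cone_weight n y * L y)" if y: "snd y \<noteq> 0" for y
    proof -
      \<comment> \<open>Once the vertical coordinate of the dilated point exceeds \<open>M\<close>
        in absolute value, its sign alone decides membership in \<open>dom\<close>.\<close>
      have "filterlim (\<lambda>k. real (Suc k) * \<bar>snd y\<bar>) at_top sequentially"
        using y by (intro filterlim_at_top_mult_tendsto_pos[OF tendsto_const] 
            filterlim_compose[OF filterlim_real_sequentially filterlim_Suc]) auto
      then have big: "\<forall>\<^sub>F k in sequentially. real (Suc k) * \<bar>snd y\<bar> > b" for b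
        by (simp add: filterlim_at_top_dense)
      show ?thesis
      proof (cases "snd y < 0")
        case False
        have "\<forall>\<^sub>F k in sequentially. s k y = 0"
          using big[of M]
        proof eventually_elim
          case (elim k)
          then have "real (Suc k) *\<^sub>R y \<notin> dom"
            using False eta_bound[of "real (Suc k) *\<^sub>R fst y"] by (auto simp: dom_def simp del: of_nat_Suc)
          then show ?case by (simp add: s_def)
        qed
        then show ?thesis using False by (simp add: tendsto_eventually)
      next
        case True
        have ind: "\<forall>\<^sub>F k in sequentially. real (Suc k) *\<^sub>R y \<in> dom"
          using big[of M]
        proof eventually_elim
          case (elim k)
          then show ?case
            using True eta_bound[of "real (Suc k) *\<^sub>R fst y"] by (auto simp: dom_def simp del: of_nat_Suc)
        qed
        have "filterlim (\<lambda>k. real (Suc k) *\<^sub>R y) (at_infinity_within dom) sequentially"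
          unfolding at_infinity_within_def
        proof (rule filterlim_inf[THEN iffD2], intro conjI)
          have "filterlim (\<lambda>k. norm (real (Suc k) *\<^sub>R y)) at_top sequentially"
          proof (rule filterlim_at_top_mono)
            show "filterlim (\<lambda>k. real (Suc k) * \<bar>snd y\<bar>) at_top sequentially" by fact
            have "\<bar>snd y\<bar> \<le> norm y" using norm_snd_le[of "snd y" "fst y"] by simp
            then show "\<forall>\<^sub>F k in sequentially. real (Suc k) * \<bar>snd y\<bar> \<le> norm (real (Suc k) *\<^sub>R y)"
              by (intro always_eventually allI) (auto intro!: mult_left_mono simp del: of_nat_Suc)
          qed
          then show "filterlim (\<lambda>k. real (Suc k) *\<^sub>R y) at_infinity sequentially"
            by (rule filterlim_norm_at_top_imp_at_infinity)
          show "filterlim (\<lambda>k. real (Suc k) *\<^sub>R y) (principal dom) sequentially"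
            using ind by (simp add: filterlim_principal)
        qed
        then have "(\<lambda>k. h (real (Suc k) *\<^sub>R y) - L (real (Suc k) *\<^sub>R y)) \<longlonglongrightarrow> 0"
          unfolding h_def by (rule filterlim_compose[OF lim])
        moreover have "L (real (Suc k) *\<^sub>R y) = L y" for k by (rule hom) simp
        ultimately have "(\<lambda>k. h (real (Suc k) *\<^sub>R y)) \<longlonglongrightarrow> L y"
          using LIM_zero_iff[of "\<lambda>k. h (real (Suc k) *\<^sub>R y)" "L y"] by simp
        then have "(\<lambda>k. cone_weight n y * h (real (Suc k) *\<^sub>R y)) \<longlonglongrightarrow> cone_weight n y * L y"
          by (intro tendsto_intros)
        moreover have "\<forall>\<^sub>F k in sequentially. cone_weight n y * h (real (Suc k) *\<^sub>R y) = s k y"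
          using ind by eventually_elim (simp add: s_def)
        ultimately show ?thesis
          using True by (simp add: tendsto_cong)
      qed
    qed
    from AE_snd_neq_0 show "AE y in lborel. (\<lambda>k. s k y) \<longlonglongrightarrow> indicator {y. snd y < 0} y * (cone_weight n y * L y)"
      by eventually_elim (rule lim_y)
  qed (rule sm)
  then show ?thesis
    unfolding resc by (intro tendsto_intros)
qed

text \<open>The second term is the flux through infinity.\<close>

theorem integral_divergence_dom:
  fixes F :: "'a \<times> real \<Rightarrow> 'a \<times> real" and F' :: "'a \<times> real \<Rightarrow> 'a \<times> real \<Rightarrow> 'a \<times> real"
    and L d :: "'a \<times> real \<Rightarrow> real"
  defines "n \<equiv> DIM('a \<times> real)"
  assumes cont: "continuous_on (closure dom) F" "\<And>h. continuous_on (closure dom) (\<lambda>x. F' x h)"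
    and deriv: "\<And>x. x \<in> dom \<Longrightarrow> (F has_derivative F' x) (at x)"
    and div: "\<And>x. x \<in> dom \<Longrightarrow> (\<Sum>b\<in>Basis. F' x b \<bullet> b) = d x"
    and bdd: "\<And>x. x \<in> dom \<Longrightarrow> norm x ^ (n - 2) * \<bar>x \<bullet> F x\<bar> \<le> B"
    and meas: "L \<in> borel_measurable borel"
    and hom: "\<And>r y. r > 0 \<Longrightarrow> L (r *\<^sub>R y) = L y"
    and lim: "((\<lambda>x. norm x ^ (n - 2) * (x \<bullet> F x) - L x) \<longlongrightarrow> 0) (at_infinity_within dom)"
    and int_div: "integrable lborel (\<lambda>x. indicator dom x * d x)"
    and int_flux: "integrable lborel (\<lambda>x. F (x, \<eta> x) \<bullet> surface_normal x)"
  shows "integral\<^sup>L lborel (\<lambda>x. indicator dom x * d x)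
       = integral\<^sup>L lborel (\<lambda>x. F (x, \<eta> x) \<bullet> surface_normal x)
         + 2 * real n * integral\<^sup>L lborel (\<lambda>y. indicator {y. snd y < 0} y * (cone_weight n y * L y))"
proof -
  have n: "n \<ge> 2" by (simp add: n_def)
  define ct where "ct = (\<lambda>k. cutoff n (real (Suc k)) :: 'a \<times> real \<Rightarrow> real)"
  have ctm: "ct k \<in> borel_measurable borel" for k
    unfolding ct_def by (rule borel_measurable_continuous_onI) (intro continuous_intros)
  have ctb: "\<bar>ct k x\<bar> \<le> 1" for k x
    using cutoff_bounds[where x=x and n=n and R="real (Suc k)"] by (simp add: ct_def)
  have ctlim: "(\<lambda>k. ct k x) \<longlonglongrightarrow> 1" for x
    unfolding ct_def using n by (intro cutoff_tendsto_1) auto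
  have graph: "(x, \<eta> x) \<in> closure dom" for x by (simp add: closure_dom)
  have ctgm: "(\<lambda>x. ct k (x, \<eta> x)) \<in> borel_measurable borel" for k
    by (rule measurable_compose[OF _ ctm]) (intro borel_measurable_continuous_onI continuous_intros)
  have 1: "(\<lambda>k. integral\<^sup>L lborel (\<lambda>x. ct k x * (indicator dom x * d x)))
      \<longlonglongrightarrow> integral\<^sup>L lborel (\<lambda>x. indicator dom x * d x)"
  proof (rule integral_dominated_convergence[where w="\<lambda>x. \<bar>indicator dom x * d x\<bar>"])
    show "AE x in lborel. (\<lambda>k. ct k x * (indicator dom x * d x)) \<longlonglongrightarrow> indicator dom x * d x"
      using tendsto_mult[OF ctlim tendsto_const] by simp
    show "AE x in lborel. norm (ct k x * (indicator dom x * d x)) \<le> \<bar>indicator dom x * d x\<bar>" for k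
      using ctb[of k] by (simp add: abs_mult mult_left_le_one_le)
  qed (use int_div ctm in auto)
  have 2: "(\<lambda>k. integral\<^sup>L lborel (\<lambda>x. ct k (x, \<eta> x) * (F (x, \<eta> x) \<bullet> surface_normal x)))
      \<longlonglongrightarrow> integral\<^sup>L lborel (\<lambda>x. F (x, \<eta> x) \<bullet> surface_normal x)"
  proof (rule integral_dominated_convergence[where w="\<lambda>x. \<bar>F (x, \<eta> x) \<bullet> surface_normal x\<bar>"])
    show "AE x in lborel. (\<lambda>k. ct k (x, \<eta> x) * (F (x, \<eta> x) \<bullet> surface_normal x)) \<longlonglongrightarrow> F (x, \<eta> x) \<bullet> surface_normal x"
      using tendsto_mult[OF ctlim tendsto_const] by simp
    show "AE x in lborel. norm (ct k (x, \<eta> x) * (F (x, \<eta> x) \<bullet> surface_normal x)) \<le> \<bar>F (x, \<eta> x) \<bullet> surface_normal x\<bar>" for k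
      using ctb[of k] by (simp add: abs_mult mult_left_le_one_le)
    show "(\<lambda>x. ct k (x, \<eta> x) * (F (x, \<eta> x) \<bullet> surface_normal x)) \<in> borel_measurable lborel" for k
      using ctgm[of k] borel_measurable_integrable[OF int_flux] by simp
  qed (use int_flux in auto)
  note 3 = integral_cutoff_deriv_tendsto[OF cont(1) bdd[unfolded n_def] meas hom lim[unfolded n_def], folded n_def]
  have id: "integral\<^sup>L lborel (\<lambda>x. ct k (x, \<eta> x) * (F (x, \<eta> x) \<bullet> surface_normal x))
      = integral\<^sup>L lborel (\<lambda>x. indicator dom x * cutoff_deriv n (real (Suc k)) x (F x))
        + integral\<^sup>L lborel (\<lambda>x. ct k x * (indicator dom x * d x))" for k
  proof -
    have i1: "integrable lborel (\<lambda>x. indicator dom x * cutoff_deriv n (real (Suc k)) x (F x))"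
      by (rule integrable_on_dom[where R="real (Suc k)"])
        (intro continuous_intros cont cutoff_outside; simp)+
    have i2: "integrable lborel (\<lambda>x. ct k x * (indicator dom x * d x))"
      by (rule Bochner_Integration.integrable_bound[OF int_div])
        (use ctm ctb int_div in \<open>auto simp: abs_mult mult_left_le_one_le\<close>)
    have "integral\<^sup>L lborel (\<lambda>x. ct k (x, \<eta> x) * (F (x, \<eta> x) \<bullet> surface_normal x))
      = integral\<^sup>L lborel (\<lambda>x. indicator dom x *
            (cutoff_deriv n (real (Suc k)) x (F x) + cutoff n (real (Suc k)) x * (\<Sum>b\<in>Basis. F' x b \<bullet> b)))"
      unfolding ct_def by (rule integral_cutoff_divergence[OF n _ cont deriv, symmetric]) simp
    also have "\<dots> = integral\<^sup>L lborel (\<lambda>x. indicator dom x * cutoff_deriv n (real (Suc k)) x (F x)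
        + ct k x * (indicator dom x * d x))"
      by (rule Bochner_Integration.integral_cong) (auto simp: ct_def div indicator_def)
    also have "\<dots> = integral\<^sup>L lborel (\<lambda>x. indicator dom x * cutoff_deriv n (real (Suc k)) x (F x))
        + integral\<^sup>L lborel (\<lambda>x. ct k x * (indicator dom x * d x))"
      using i1 i2 by simp
    finally show ?thesis .
  qed
  have "integral\<^sup>L lborel (\<lambda>x. F (x, \<eta> x) \<bullet> surface_normal x)
      = - (2 * real n) * integral\<^sup>L lborel (\<lambda>y. indicator {y. snd y < 0} y * (cone_weight n y * L y))
        + integral\<^sup>L lborel (\<lambda>x. indicator dom x * d x)"
    using LIMSEQ_unique[OF 2] tendsto_add[OF 3 1] unfolding id by blast
  then show ?thesis by simp
qed

end

section \<open>Decay and integrability\<close>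

text \<open>Dyadic comparison: the function is dominated by a sum of multiples of indicators of the
  balls of radius 2^k. Their volumes grow like 2^(d k) and the weights decay like 2^(-a k), which
  leaves a geometric series of ratio 2^(d-a) < 1.\<close>

lemma integrable_one_plus_norm_powr:
  assumes a: "a > real DIM('a::euclidean_space)"
  shows "integrable lborel (\<lambda>x::'a. (1 + norm x) powr (- a))"
proof (rule integrableI_bounded)
  show "(\<lambda>x::'a. (1 + norm x) powr (- a)) \<in> borel_measurable lborel" by measurable
  define d where "d = real DIM('a)"
  \<comment> \<open>This is 2^(-a (k-2)): the index \<open>k\<close> selected for \<open>x\<close>
    satisfies 2^(k-2) <= 1 + |x| < 2^k.\<close>
  define w where "w = (\<lambda>k::nat. 2 powr (2 * a - a * real k))"
  have dyadic: "ennreal (norm ((1 + norm x) powr (- a)))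
      \<le> (\<Sum>k. ennreal (w k) * indicator (ball 0 (2 ^ k)) x)" for x :: 'a
  proof -
    define k where "k = nat \<lceil>log 2 (1 + norm x)\<rceil> + 1"
    have pos: "1 + norm x > 0" using norm_ge_zero[of x] by linarith
    have log0: "log 2 (1 + norm x) \<ge> 0" using zero_le_log_cancel_iff[of 2 "1 + norm x"] pos by simp
    then have k1: "log 2 (1 + norm x) \<le> real k - 1" "real k - 1 < log 2 (1 + norm x) + 1"
      unfolding k_def by linarith+
    have "1 + norm x \<le> 2 powr (real k - 1)"
      using k1(1) pos by (simp add: log_le_iff)
    also have "\<dots> < 2 powr (real k)" by simp
    finally have xb: "x \<in> ball 0 (2 ^ k)" by (simp add: powr_realpow)
    have "2 powr (real k - 2) \<le> 1 + norm x"
      using k1(2) pos by (simp add: le_log_iff[symmetric])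
    then have "(1 + norm x) powr (- a) \<le> (2 powr (real k - 2)) powr (- a)"
      using a by (intro powr_mono2') auto
    also have "\<dots> = w k"
      by (simp add: w_def powr_powr algebra_simps)
    finally have "ennreal (norm ((1 + norm x) powr (- a))) \<le> ennreal (w k) * indicator (ball 0 (2 ^ k)) x"
      using xb by (simp add: ennreal_leI)
    also have "\<dots> \<le> (\<Sum>k. ennreal (w k) * indicator (ball 0 (2 ^ k)) x)"
    proof -
      define u where "u = (\<lambda>k. ennreal (w k) * indicator (ball 0 (2 ^ k)) x)"
      have "sum u {k} \<le> suminf u" by (rule sum_le_suminf) auto
      then have "u k \<le> suminf u" by simp
      then show ?thesis unfolding u_def .
    qed
    finally show ?thesis .
  qed
  define t where "t = (\<lambda>k::nat. 2 powr (2 * a) * unit_ball_vol d * (2 powr (d - a)) ^ k)"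
  have "(\<integral>\<^sup>+ (x::'a). ennreal (norm ((1 + norm x) powr (- a))) \<partial>lborel)
      \<le> (\<integral>\<^sup>+ (x::'a). (\<Sum>k. ennreal (w k) * indicator (ball 0 (2 ^ k)) x) \<partial>lborel)"
    by (intro nn_integral_mono dyadic)
  also have "\<dots> = (\<Sum>k. (\<integral>\<^sup>+ (x::'a). ennreal (w k) * indicator (ball 0 (2 ^ k)) x \<partial>lborel))"
    by (rule nn_integral_suminf) (intro borel_measurable_times_ennreal borel_measurable_indicator; simp)
  also have "\<dots> = (\<Sum>k. ennreal (t k))"
  proof (rule suminf_cong)
    fix k
    have "(\<integral>\<^sup>+ (x::'a). ennreal (w k) * indicator (ball 0 (2 ^ k)) x \<partial>lborel)
        = ennreal (w k) * emeasure lborel (ball (0::'a) (2 ^ k))"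
      by (simp add: nn_integral_cmult_indicator)
    also have "\<dots> = ennreal (w k * (unit_ball_vol d * (2 ^ k) ^ DIM('a)))"
      by (simp add: emeasure_ball d_def ennreal_mult w_def)
    also have "w k * (unit_ball_vol d * (2 ^ k) ^ DIM('a)) = t k"
    proof -
      have "((2::real) ^ k) ^ DIM('a) = 2 powr (d * real k)"
        by (simp add: d_def powr_realpow[symmetric] powr_powr flip: power_mult)
          (simp add: powr_realpow[symmetric] mult.commute)
      moreover have "(2 powr (d - a)) ^ k = 2 powr ((d - a) * real k)"
        by (simp add: powr_realpow[symmetric] powr_powr)
      moreover have "2 powr (2 * a - a * real k) * 2 powr (d * real k)
          = 2 powr (2 * a) * (2 powr ((d - a) * real k) :: real)"
        by (simp add: powr_add[symmetric] algebra_simps)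
      ultimately show ?thesis by (simp add: w_def t_def mult_ac)
    qed
    finally show "(\<integral>\<^sup>+ (x::'a). ennreal (w k) * indicator (ball 0 (2 ^ k)) x \<partial>lborel) = ennreal (t k)" .
  qed
  also have "\<dots> < \<infinity>"
  proof -
    have "2 powr (d - a) < 2 powr 0" using a by (intro powr_less_mono) (auto simp: d_def)
    then have "summable t"
      unfolding t_def by (intro summable_mult summable_geometric) simp
    moreover have "t k \<ge> 0" for k by (simp add: t_def d_def)
    ultimately have "(\<Sum>k. ennreal (t k)) \<noteq> top" by (rule ennreal_suminf_neq_top)
    then show ?thesis by (simp add: less_top)
  qed
  finally show "(\<integral>\<^sup>+ (x::'a). ennreal (norm ((1 + norm x) powr (- a))) \<partial>lborel) < \<infinity>" .
qed

text \<open>Compactness handles the part of \<open>S\<close> where the asymptotic estimate is not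
  yet valid; the weight 1 + |x| instead of |x| lets one inequality hold on all of \<open>S\<close>,
  the origin included.\<close>

lemma decay_bound:
  fixes f :: "'a::euclidean_space \<Rightarrow> 'b::real_normed_vector"
  assumes S: "closed S" and cont: "continuous_on S f" and a: "a \<ge> 0"
    and ev: "\<forall>\<^sub>F x in at_infinity_within S. norm (f x) \<le> c * norm x powr (- a)"
  obtains C where "C \<ge> 0" "\<And>x. x \<in> S \<Longrightarrow> norm (f x) \<le> C * (1 + norm x) powr (- a)"
proof -
  obtain r where r: "\<And>x. x \<in> S \<Longrightarrow> norm x \<ge> r \<Longrightarrow> norm (f x) \<le> c * norm x powr (- a)"
    using ev unfolding at_infinity_within_def eventually_inf_principal eventually_at_infinity by blast
  define R where "R = max r 1"
  have "compact (S \<inter> cball 0 R)" using S by (intro closed_Int_compact) auto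
  then have "bounded (f ` (S \<inter> cball 0 R))"
    using cont continuous_on_subset compact_continuous_image compact_imp_bounded by blast
  then obtain B where B: "\<forall>y\<in>f ` (S \<inter> cball 0 R). norm y \<le> B"
    unfolding bounded_iff by blast
  \<comment> \<open>The first summand uses 1 + |x| <= 2 |x| for |x| >= 1, the second 1 + |x| <= 1 +
    R inside the ball.\<close>
  define C where "C = \<bar>c\<bar> * 2 powr a + \<bar>B\<bar> * (1 + R) powr a"
  have terms: "0 \<le> \<bar>c\<bar> * 2 powr a" "0 \<le> \<bar>B\<bar> * (1 + R) powr a" by simp_all
  show thesis
  proof
    show "C \<ge> 0" by (simp add: C_def)
    fix x assume x: "x \<in> S"
    have pos: "1 + norm x > 0" using norm_ge_zero[of x] by linarith
    show "norm (f x) \<le> C * (1 + norm x) powr (- a)"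
    proof (cases "norm x \<ge> R")
      case True
      then have n: "norm x \<ge> r" "norm x \<ge> 1" by (auto simp: R_def)
      have "norm (f x) \<le> \<bar>c\<bar> * norm x powr (- a)"
        using r[OF x n(1)] mult_right_mono[OF abs_ge_self[of c], of "norm x powr (- a)"] by simp
      also have "\<dots> \<le> \<bar>c\<bar> * ((1 + norm x) / 2) powr (- a)"
        using n a by (intro mult_left_mono powr_mono2') auto
      also have "((1 + norm x) / 2) powr (- a) = 2 powr a * (1 + norm x) powr (- a)"
        using pos by (simp add: powr_divide powr_minus field_simps)
      finally have "norm (f x) \<le> (\<bar>c\<bar> * 2 powr a) * (1 + norm x) powr (- a)" by simp
      also have "\<dots> \<le> C * (1 + norm x) powr (- a)"
        using terms by (intro mult_right_mono) (auto simp: C_def)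
      finally show ?thesis .
    next
      case False
      have "norm (f x) \<le> \<bar>B\<bar> * 1"
        using B x False by force
      also have "1 \<le> (1 + R) powr a * (1 + norm x) powr (- a)"
      proof -
        have "(1 + norm x) powr a \<le> (1 + R) powr a"
          using False a by (intro powr_mono2) auto
        then show ?thesis using pos by (simp add: powr_minus field_simps)
      qed
      then have "\<bar>B\<bar> * 1 \<le> \<bar>B\<bar> * ((1 + R) powr a * (1 + norm x) powr (- a))"
        by (rule mult_left_mono) simp
      also have "\<dots> = (\<bar>B\<bar> * (1 + R) powr a) * (1 + norm x) powr (- a)" by simp
      also have "\<dots> \<le> C * (1 + norm x) powr (- a)"
        using terms by (intro mult_right_mono) (auto simp: C_def)
      finally show ?thesis .
    qed
  qed
qed

lemma integrable_of_decay:
  fixes f :: "'a::euclidean_space \<Rightarrow> real"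
  assumes "f \<in> borel_measurable borel" and a: "a > real DIM('a)"
    and le: "\<And>x. \<bar>f x\<bar> \<le> C * (1 + norm x) powr (- a)"
  shows "integrable lborel f"
proof (rule Bochner_Integration.integrable_bound)
  show "integrable lborel (\<lambda>x::'a. C * (1 + norm x) powr (- a))"
    using integrable_one_plus_norm_powr[OF a] by simp
  show "AE x in lborel. norm (f x) \<le> norm (C * (1 + norm x) powr (- a))"
    using le by (intro AE_I2) (auto intro: order_trans abs_ge_self)
qed (use assms in simp)

section \<open>Dipole averages over the ball\<close>

text \<open>Symmetry is what makes the divergence of \<open>Z\<close> vanish, and the regularity
  hypothesis supplies the Hessian merely as the derivative of the gradient. The second difference of
  \<open>f\<close> is symmetric in \<open>u\<close> and \<open>v\<close>, while the mean value
  theorem evaluates it as s^2 (H v . u) + o(s^2), using differentiability of \<open>G\<close> at the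
  single point \<open>x\<close>.\<close>

lemma hessian_symmetric:
  fixes f :: "'a::real_inner \<Rightarrow> real"
  assumes U: "open U" "x \<in> U"
    and f: "\<And>y. y \<in> U \<Longrightarrow> GDERIV f y :> G y"
    and G: "(G has_derivative H) (at x)"
  shows "H u \<bullet> v = H v \<bullet> u"
proof -
  have linH: "linear H" using G has_derivative_linear by blast
  have est: "\<exists>r>0. \<forall>s. 0 < s \<and> s < r \<longrightarrow>
      \<bar>f (x + s *\<^sub>R u + s *\<^sub>R v) - f (x + s *\<^sub>R u) - f (x + s *\<^sub>R v) + f x - s\<^sup>2 * (H v \<bullet> u)\<bar>
        \<le> 2 * \<delta> * s\<^sup>2 * (norm u + norm v)\<^sup>2" if \<delta>: "\<delta> > 0" for \<delta> u v
  proof -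
    obtain r1 where r1: "r1 > 0" "ball x r1 \<subseteq> U"
      using U openE by blast
    obtain r2 where r2: "r2 > 0"
      "\<And>y. norm (y - x) < r2 \<Longrightarrow> norm (G y - G x - H (y - x)) \<le> \<delta> * norm (y - x)"
      using G \<delta> unfolding has_derivative_at_alt by meson
    define L where "L = norm u + norm v + 1"
    have L: "L > 0" unfolding L_def by (smt (verit) norm_ge_zero)
    define r where "r = min r1 r2 / L"
    have "r > 0" using r1 r2 L by (simp add: r_def)
    moreover have "\<bar>f (x + s *\<^sub>R u + s *\<^sub>R v) - f (x + s *\<^sub>R u) - f (x + s *\<^sub>R v) + f x - s\<^sup>2 * (H v \<bullet> u)\<bar>
        \<le> 2 * \<delta> * s\<^sup>2 * (norm u + norm v)\<^sup>2" if s: "0 < s" "s < r" for s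
    proof -
      have sL: "s * L < min r1 r2" using s L by (simp add: r_def pos_less_divide_eq)
      have nb: "norm (a *\<^sub>R u + b *\<^sub>R v) \<le> s * (norm u + norm v)" "norm (a *\<^sub>R u + b *\<^sub>R v) < min r1 r2"
        if "0 \<le> a" "a \<le> s" "0 \<le> b" "b \<le> s" for a b
      proof -
        have "norm (a *\<^sub>R u + b *\<^sub>R v) \<le> a * norm u + b * norm v"
          using norm_triangle_ineq[of "a *\<^sub>R u" "b *\<^sub>R v"] that by simp
        also have "\<dots> \<le> s * norm u + s * norm v"
          using that by (intro add_mono mult_right_mono) auto
        finally show 1: "norm (a *\<^sub>R u + b *\<^sub>R v) \<le> s * (norm u + norm v)"
          by (simp add: distrib_left)
        also have "\<dots> \<le> s * L" using s by (simp add: L_def)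
        finally show "norm (a *\<^sub>R u + b *\<^sub>R v) < min r1 r2" using sL by linarith
      qed
      have inU: "x + (a *\<^sub>R u + b *\<^sub>R v) \<in> U" if "0 \<le> a" "a \<le> s" "0 \<le> b" "b \<le> s" for a b
      proof -
        have "dist x (x + w) = norm w" for w by (simp add: dist_norm)
        then have "x + (a *\<^sub>R u + b *\<^sub>R v) \<in> ball x r1"
          using nb(2)[OF that] by (simp only: mem_ball)
        then show ?thesis using r1(2) by blast
      qed
      \<comment> \<open>The remainder of the linearization of \<open>G\<close> at \<open>x\<close>;
        it is at most \<open>\<delta>\<close> times the displacement throughout the small
        parallelogram.\<close>
      define e where "e = (\<lambda>a b. G (x + (a *\<^sub>R u + b *\<^sub>R v)) - G x - H (a *\<^sub>R u + b *\<^sub>R v))"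
      have eb: "norm (e a b) \<le> \<delta> * (s * (norm u + norm v))"
        if "0 \<le> a" "a \<le> s" "0 \<le> b" "b \<le> s" for a b
      proof -
        have "norm (e a b) \<le> \<delta> * norm (a *\<^sub>R u + b *\<^sub>R v)"
          using r2(2)[of "x + (a *\<^sub>R u + b *\<^sub>R v)"] nb(2)[OF that] by (simp add: e_def)
        also have "\<dots> \<le> \<delta> * (s * (norm u + norm v))"
          using nb(1)[OF that] \<delta> by (intro mult_left_mono) auto
        finally show ?thesis .
      qed
      define \<psi> where "\<psi> = (\<lambda>t. f (x + (t *\<^sub>R u + s *\<^sub>R v)) - f (x + (t *\<^sub>R u + 0 *\<^sub>R v)))"
      have line: "((\<lambda>t. f (x + (t *\<^sub>R u + b *\<^sub>R v))) has_real_derivative (G (x + (t *\<^sub>R u + b *\<^sub>R v)) \<bullet> u)) (at t)"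
        if "0 \<le> t" "t \<le> s" "0 \<le> b" "b \<le> s" for t b
      proof -
        have "((\<lambda>t. x + (t *\<^sub>R u + b *\<^sub>R v)) has_derivative (\<lambda>h. h *\<^sub>R u)) (at t)"
          by (auto intro!: derivative_eq_intros)
        from has_derivative_compose[OF this f[OF inU[OF that], unfolded gderiv_def]]
        show ?thesis
          by (simp add: has_field_derivative_def inner_commute mult_commute_abs)
      qed
      \<comment> \<open>The second difference is a first difference of \<open>\<psi>\<close>, so the
        mean value theorem in direction \<open>u\<close> turns it into a difference of gradients at
        two points a step \<open>s *\<^sub>R v\<close> apart.\<close>
      have "\<exists>\<xi>. 0 < \<xi> \<and> \<xi> < s \<and> \<psi> s - \<psi> 0
          = (s - 0) * (G (x + (\<xi> *\<^sub>R u + s *\<^sub>R v)) \<bullet> u - G (x + (\<xi> *\<^sub>R u + 0 *\<^sub>R v)) \<bullet> u)"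
      proof (rule MVT2)
        fix t assume "0 \<le> t" "t \<le> s"
        then show "(\<psi> has_real_derivative
            (G (x + (t *\<^sub>R u + s *\<^sub>R v)) \<bullet> u - G (x + (t *\<^sub>R u + 0 *\<^sub>R v)) \<bullet> u)) (at t)"
          unfolding \<psi>_def using s by (intro DERIV_diff line) auto
      qed (rule s(1))
      then obtain \<xi> where \<xi>: "0 < \<xi>" "\<xi> < s"
        "\<psi> s - \<psi> 0 = s * (G (x + (\<xi> *\<^sub>R u + s *\<^sub>R v)) \<bullet> u - G (x + (\<xi> *\<^sub>R u + 0 *\<^sub>R v)) \<bullet> u)"
        by auto
      have "H (\<xi> *\<^sub>R u + s *\<^sub>R v) = H (\<xi> *\<^sub>R u + 0 *\<^sub>R v) + s *\<^sub>R H v"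
        by (simp add: linear_add[OF linH] linear_scale[OF linH])
      then have "G (x + (\<xi> *\<^sub>R u + s *\<^sub>R v)) - G (x + (\<xi> *\<^sub>R u + 0 *\<^sub>R v)) = s *\<^sub>R H v + (e \<xi> s - e \<xi> 0)"
        unfolding e_def by (simp add: algebra_simps)
      then have "\<psi> s - \<psi> 0 = s * ((s *\<^sub>R H v + (e \<xi> s - e \<xi> 0)) \<bullet> u)"
        using \<xi>(3) by (simp flip: inner_diff_left)
      then have "\<psi> s - \<psi> 0 - s\<^sup>2 * (H v \<bullet> u) = s * ((e \<xi> s - e \<xi> 0) \<bullet> u)"
        by (simp add: algebra_simps power2_eq_square)
      also have "\<bar>\<dots>\<bar> \<le> s * ((norm (e \<xi> s) + norm (e \<xi> 0)) * norm u)"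
        using s Cauchy_Schwarz_ineq2[of "e \<xi> s - e \<xi> 0" u] norm_triangle_ineq4[of "e \<xi> s" "e \<xi> 0"]
        by (simp add: abs_mult) (meson mult_right_mono norm_ge_zero order_trans)
      also have "\<dots> \<le> s * ((\<delta> * (s * (norm u + norm v)) + \<delta> * (s * (norm u + norm v))) * (norm u + norm v))"
        using \<xi> s \<delta> by (intro mult_left_mono mult_mono add_mono eb) auto
      also have "\<dots> = 2 * \<delta> * s\<^sup>2 * (norm u + norm v)\<^sup>2"
        by (simp add: power2_eq_square algebra_simps)
      finally show ?thesis by (simp add: \<psi>_def algebra_simps)
    qed
    ultimately show ?thesis by blast
  qed
  \<comment> \<open>Twice the constant of \<open>est\<close>: the estimate is used for (u, v) and
    for (v, u), and the common second difference drops out.\<close>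
  define A where "A = 4 * (norm u + norm v)\<^sup>2"
  have "\<bar>H u \<bullet> v - H v \<bullet> u\<bar> \<le> \<delta> * A" if \<delta>: "\<delta> > 0" for \<delta>
  proof -
    obtain r1 where r1: "r1 > 0" "\<And>s. 0 < s \<and> s < r1 \<Longrightarrow>
      \<bar>f (x + s *\<^sub>R u + s *\<^sub>R v) - f (x + s *\<^sub>R u) - f (x + s *\<^sub>R v) + f x - s\<^sup>2 * (H v \<bullet> u)\<bar>
        \<le> 2 * \<delta> * s\<^sup>2 * (norm u + norm v)\<^sup>2"
      using est[OF \<delta>, of u v] by blast
    obtain r2 where r2: "r2 > 0" "\<And>s. 0 < s \<and> s < r2 \<Longrightarrow>
      \<bar>f (x + s *\<^sub>R v + s *\<^sub>R u) - f (x + s *\<^sub>R v) - f (x + s *\<^sub>R u) + f x - s\<^sup>2 * (H u \<bullet> v)\<bar>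
        \<le> 2 * \<delta> * s\<^sup>2 * (norm v + norm u)\<^sup>2"
      using est[OF \<delta>, of v u] by blast
    define s where "s = min r1 r2 / 2"
    have s: "0 < s" "s < r1" "s < r2" using r1 r2 by (auto simp: s_def)
    have sym: "f (x + s *\<^sub>R v + s *\<^sub>R u) = f (x + s *\<^sub>R u + s *\<^sub>R v)" "norm v + norm u = norm u + norm v"
      by (simp_all add: add_ac)
    have "\<bar>s\<^sup>2 * (H u \<bullet> v) - s\<^sup>2 * (H v \<bullet> u)\<bar> \<le> 4 * \<delta> * s\<^sup>2 * (norm u + norm v)\<^sup>2"
      using r1(2)[of s] r2(2)[of s] s unfolding sym by linarith
    also have "s\<^sup>2 * (H u \<bullet> v) - s\<^sup>2 * (H v \<bullet> u) = s\<^sup>2 * (H u \<bullet> v - H v \<bullet> u)"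
      by (simp add: algebra_simps)
    finally have "s\<^sup>2 * \<bar>H u \<bullet> v - H v \<bullet> u\<bar> \<le> s\<^sup>2 * (\<delta> * A)"
      by (simp add: abs_mult A_def mult_ac)
    then show ?thesis using s by simp
  qed
  note bound = this
  have "\<bar>H u \<bullet> v - H v \<bullet> u\<bar> \<le> 0"
  proof (rule field_le_epsilon)
    fix e :: real assume "e > 0"
    have "A \<ge> 0" by (simp add: A_def)
    have "\<bar>H u \<bullet> v - H v \<bullet> u\<bar> \<le> e / (A + 1) * A"
      using \<open>e > 0\<close> \<open>A \<ge> 0\<close> by (intro bound) simp
    also have "\<dots> \<le> e" using \<open>e > 0\<close> \<open>A \<ge> 0\<close> by (simp add: field_simps)
    finally show "\<bar>H u \<bullet> v - H v \<bullet> u\<bar> \<le> 0 + e" by simp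
  qed
  then show ?thesis by simp
qed

text \<open>The integral is the volume under the graph of the weight. Sliced at height t, that
  region is a ball of radius (1 - t)^(1/n), hence of volume proportional to 1 - t, and the integral
  of 1 - t over the unit interval supplies the factor 1/2.\<close>

lemma integral_cone_weight:
  "integral\<^sup>L lborel (cone_weight DIM('a) :: 'a::euclidean_space \<Rightarrow> real) = unit_ball_vol (real DIM('a)) / 2"
proof -
  define n where "n = DIM('a)"
  have n: "n > 0" by (simp add: n_def)
  define k where "k = (\<lambda>z::'a \<times> real. indicator {z. 0 \<le> snd z \<and> snd z < 1 - norm (fst z) ^ n} z :: real)"
  have "{z::'a \<times> real. 0 \<le> snd z \<and> snd z < 1 - norm (fst z) ^ n} \<in> sets borel"
    unfolding Collect_conj_eq
    by (intro sets.Int borel_closed borel_open closed_Collect_le open_Collect_less continuous_intros)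
  moreover have "{z::'a \<times> real. 0 \<le> snd z \<and> snd z < 1 - norm (fst z) ^ n} \<subseteq> cball 0 1 \<times> cball 0 1"
  proof (rule subsetI)
    fix z :: "'a \<times> real" assume z: "z \<in> {z. 0 \<le> snd z \<and> snd z < 1 - norm (fst z) ^ n}"
    obtain y t where yt: "z = (y, t)" by (cases z)
    have t: "0 \<le> t" "t < 1 - norm y ^ n" using z by (auto simp: yt)
    then have "norm y ^ n < 1 ^ n" by simp
    then have "norm y < 1" by (rule power_less_imp_less_base) simp
    moreover have "norm y ^ n \<ge> 0" by simp
    ultimately have "norm y \<le> 1 \<and> \<bar>t\<bar> \<le> 1" using t by linarith
    then show "z \<in> cball 0 1 \<times> cball 0 1" by (simp add: yt)
  qed
  then have "bounded {z::'a \<times> real. 0 \<le> snd z \<and> snd z < 1 - norm (fst z) ^ n}"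
    by (rule bounded_subset[rotated]) (intro bounded_Times bounded_cball)
  ultimately have ki: "integrable (lborel \<Otimes>\<^sub>M lborel) (\<lambda>(y, t). k (y, t))"
    unfolding k_def lborel_prod using emeasure_bounded_finite
    by (auto intro!: integrable_real_indicator)
  have inner_t: "(\<integral>t. k (y, t) \<partial>lborel) = cone_weight n y" for y
  proof -
    have "(\<lambda>t. k (y, t)) = indicator {0..<1 - norm y ^ n}"
      by (auto simp: k_def indicator_def)
    moreover have "measure lborel {0..<1 - norm y ^ n} = max 0 (1 - norm y ^ n)"
      by (cases "1 - norm y ^ n \<ge> 0") (simp_all only: measure_lborel_Ico, auto)
    ultimately show ?thesis by (simp add: cone_weight_def)
  qed
  have inner_y: "(\<integral>y. k (y, t) \<partial>lborel) = indicator {0..1} t * (unit_ball_vol (real n) * (1 - t))" for t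
  proof (cases "0 \<le> t \<and> t < 1")
    case True
    have "norm y ^ n < 1 - t \<longleftrightarrow> norm y < root n (1 - t)" for y :: 'a
      using True n real_root_less_iff[of n "norm y ^ n" "1 - t"] by (simp add: real_root_power_cancel)
    then have "(\<lambda>y. k (y, t)) = indicator (ball 0 (root n (1 - t)))"
      using True by (auto simp: k_def indicator_def fun_eq_iff less_diff_eq add.commute)
    then show ?thesis
      using True n by (simp add: content_ball n_def)
  next
    case False
    have "k (y, t) = 0" for y
    proof -
      have "norm y ^ n \<ge> 0" by simp
      then show ?thesis using False by (auto simp: k_def indicator_def simp del: zero_le_power)
    qed
    then show ?thesis using False by (auto simp: indicator_def)
  qed
  have "integral\<^sup>L lborel (cone_weight n :: 'a \<Rightarrow> real) = (\<integral>y. (\<integral>t. k (y, t) \<partial>lborel) \<partial>lborel)"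
    by (simp add: inner_t)
  also have "\<dots> = (\<integral>t. (\<integral>y. k (y, t) \<partial>lborel) \<partial>lborel)"
    using lborel_pair.Fubini_integral[OF ki] by simp
  also have "\<dots> = (\<integral>t. indicator {0..1} t *\<^sub>R (unit_ball_vol (real n) * (1 - t)) \<partial>lborel)"
    by (simp add: inner_y)
  also have "\<dots> = unit_ball_vol (real n) * (1 - 1\<^sup>2 / 2) - unit_ball_vol (real n) * (0 - 0\<^sup>2 / 2)"
  proof (rule integral_FTC_atLeastAtMost)
    fix t :: real
    show "((\<lambda>t. unit_ball_vol (real n) * (t - t\<^sup>2 / 2)) has_vector_derivative unit_ball_vol (real n) * (1 - t)) (at t within {0..1})"
      unfolding has_real_derivative_iff_has_vector_derivative[symmetric]
      by (auto intro!: derivative_eq_intros)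
  qed (auto intro!: continuous_intros)
  finally show ?thesis by (simp add: n_def)
qed


lemma distr_lborel_uminus: "distr lborel borel uminus = (lborel :: 'a::euclidean_space measure)"
  using lborel_affine[of "-1" "0 :: 'a"] by (simp add: density_1)

lemma distr_lborel_reflect_Basis:
  fixes b :: "'a::euclidean_space"
  assumes b: "b \<in> Basis"
  shows "distr lborel borel (\<lambda>y. y - (2 * (y \<bullet> b)) *\<^sub>R b) = lborel"
proof -
  define c where "c = (\<lambda>j::'a. if j = b then -1 else 1 :: real)"
  have "(\<lambda>y. 0 + (\<Sum>j\<in>Basis. (c j * (y \<bullet> j)) *\<^sub>R j)) = (\<lambda>y. y - (2 * (y \<bullet> b)) *\<^sub>R b)"
  proof
    fix y :: 'a
    have "(\<Sum>j\<in>Basis. (c j * (y \<bullet> j)) *\<^sub>R j) \<bullet> i = (y - (2 * (y \<bullet> b)) *\<^sub>R b) \<bullet> i" if "i \<in> Basis" for i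
      using that b by (simp add: c_def inner_diff_left inner_Basis)
    then show "0 + (\<Sum>j\<in>Basis. (c j * (y \<bullet> j)) *\<^sub>R j) = y - (2 * (y \<bullet> b)) *\<^sub>R b"
      by (simp add: euclidean_eq_iff[where 'a='a])
  qed
  moreover have "(\<Prod>j\<in>(Basis::'a set). \<bar>c j\<bar>) = 1" by (rule prod.neutral) (simp add: c_def)
  ultimately show ?thesis
    using lborel_affine_euclidean[of c "0::'a"] by (simp add: c_def density_1)
qed

text \<open>The map exchanges the coordinates along \<open>b\<close> and \<open>b'\<close>, so the
  preimage of a box is a box with the same side lengths in permuted order, and boxes determine
  Lebesgue measure.\<close>

lemma distr_lborel_swap_Basis:
  fixes b b' :: "'a::euclidean_space"
  assumes b: "b \<in> Basis" "b' \<in> Basis"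
  shows "distr lborel borel (\<lambda>y. y - (y \<bullet> b - y \<bullet> b') *\<^sub>R (b - b')) = lborel"
proof (rule lborel_eqI[symmetric])
  define T where "T = (\<lambda>y::'a. y - (y \<bullet> b - y \<bullet> b') *\<^sub>R (b - b'))"
  define p where "p = (\<lambda>i. if i = b then b' else if i = b' then b else i)"
  have p: "p i \<in> Basis" "p (p i) = i" if "i \<in> Basis" for i
    using that b by (auto simp: p_def)
  have bij: "bij_betw p Basis Basis"
    by (rule bij_betwI[where g=p]) (use p in auto)
  have T: "T y \<bullet> i = y \<bullet> p i" if "i \<in> Basis" for y i
    using that b by (auto simp: T_def p_def inner_diff_left inner_diff_right inner_Basis algebra_simps)
  show "sets (distr lborel borel (\<lambda>y. y - (y \<bullet> b - y \<bullet> b') *\<^sub>R (b - b'))) = sets borel" by simp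
  fix l u :: 'a assume le: "\<And>i. i \<in> Basis \<Longrightarrow> l \<bullet> i \<le> u \<bullet> i"
  have Tm: "T \<in> borel_measurable borel"
    unfolding T_def by (intro borel_measurable_continuous_onI continuous_intros)
  have vimage: "T -` box l u = box (T l) (T u)"
  proof (rule set_eqI)
    fix y
    have "y \<in> T -` box l u \<longleftrightarrow> (\<forall>i\<in>Basis. l \<bullet> i < y \<bullet> p i \<and> y \<bullet> p i < u \<bullet> i)"
      by (auto simp: mem_box T)
    also have "\<dots> \<longleftrightarrow> (\<forall>i\<in>Basis. l \<bullet> p i < y \<bullet> i \<and> y \<bullet> i < u \<bullet> p i)"
      using p by metis
    also have "\<dots> \<longleftrightarrow> y \<in> box (T l) (T u)"
      by (auto simp: mem_box T)
    finally show "y \<in> T -` box l u \<longleftrightarrow> y \<in> box (T l) (T u)" .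
  qed
  have "emeasure (distr lborel borel T) (box l u) = emeasure lborel (box (T l) (T u))"
    using Tm by (simp add: emeasure_distr vimage)
  also have "\<dots> = (\<Prod>i\<in>Basis. (T u - T l) \<bullet> i)"
    by (rule emeasure_lborel_box) (use le p in \<open>simp add: T\<close>)
  also have "(\<Prod>i\<in>Basis. (T u - T l) \<bullet> i) = (\<Prod>i\<in>Basis. (u - l) \<bullet> p i)"
    by (rule prod.cong) (simp_all add: inner_diff_left T)
  also have "\<dots> = (\<Prod>i\<in>Basis. (u - l) \<bullet> i)"
    by (rule prod.reindex_bij_betw[OF bij])
  finally show "emeasure (distr lborel borel (\<lambda>y. y - (y \<bullet> b - y \<bullet> b') *\<^sub>R (b - b'))) (box l u)
      = (\<Prod>i\<in>Basis. (u - l) \<bullet> i)"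
    by (simp add: T_def)
qed

text \<open>The moments form a multiple of the identity: reflecting one coordinate kills the
  off-diagonal entries, exchanging two coordinates makes the diagonal entries equal, and their sum
  is the integral of the weight since the squares of the coordinates of y / |y| add up to 1.\<close>

lemma integral_cone_weight_quadratic:
  fixes p q :: "'a::euclidean_space"
  defines "n \<equiv> DIM('a)"
  shows "integral\<^sup>L lborel (\<lambda>y. cone_weight n y * ((p \<bullet> y) * (q \<bullet> y) / (norm y)\<^sup>2))
       = (p \<bullet> q) / real n * integral\<^sup>L lborel (cone_weight n :: 'a \<Rightarrow> real)" (is "?lhs = ?rhs")
    and "integrable lborel (\<lambda>y. cone_weight n y * ((p \<bullet> y) * (q \<bullet> y) / (norm y)\<^sup>2))"
proof -
  define k where "k = (\<lambda>p q y::'a. cone_weight n y * ((p \<bullet> y) * (q \<bullet> y) / (norm y)\<^sup>2))"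
  have cwm[measurable]: "(cone_weight n :: 'a \<Rightarrow> real) \<in> borel_measurable borel"
    by (intro borel_measurable_continuous_onI continuous_intros)
  have km[measurable]: "k p q \<in> borel_measurable borel" for p q
    unfolding k_def by measurable
  have ki: "integrable lborel (k p q)" for p q
  proof (rule Bochner_Integration.integrable_bound)
    show "integrable lborel (\<lambda>y::'a. indicator (cball 0 1) y * (norm p * norm q))"
      using emeasure_bounded_finite[of "cball (0::'a) 1"] by (simp add: less_top)
    show "AE y in lborel. norm (k p q y) \<le> norm (indicator (cball 0 1) y * (norm p * norm q))"
    proof (rule AE_I2)
      fix y :: 'a
      have "\<bar>(p \<bullet> y) * (q \<bullet> y) / (norm y)\<^sup>2\<bar> \<le> norm p * norm q"
      proof (cases "y = 0")
        case False
        have "\<bar>p \<bullet> y\<bar> * \<bar>q \<bullet> y\<bar> \<le> (norm p * norm y) * (norm q * norm y)"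
          by (intro mult_mono Cauchy_Schwarz_ineq2) auto
        then show ?thesis using False by (simp add: abs_mult field_simps power2_eq_square)
      qed simp
      then have "\<bar>k p q y\<bar> \<le> 1 * (norm p * norm q)"
        unfolding k_def abs_mult[of "cone_weight n y"]
        using cone_weight_bounds[of n y] by (intro mult_mono) auto
      then show "norm (k p q y) \<le> norm (indicator (cball 0 1) y * (norm p * norm q))"
        using cone_weight_outside[of y n] by (cases "norm y \<le> 1") (auto simp: k_def)
    qed
  qed simp
  define Q where "Q = (\<lambda>p q. integral\<^sup>L lborel (k p q))"
  have Qinv: "Q p q = integral\<^sup>L lborel (\<lambda>y. k p q (T y))"
    if "distr lborel borel T = lborel" "T \<in> borel_measurable borel" for T :: "'a \<Rightarrow> 'a" and p q
    unfolding Q_def by (rule integral_distr_invariant(1)[OF that km, symmetric])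
  have off: "Q b b' = 0" if b: "b \<in> Basis" "b' \<in> Basis" "b \<noteq> b'" for b b'
  proof -
    let ?T = "\<lambda>y. y - (2 * (y \<bullet> b)) *\<^sub>R b"
    have bb: "b \<bullet> b = 1" "b \<bullet> b' = 0" "b' \<bullet> b = 0" using b by (simp_all add: inner_Basis)
    have nT: "norm (?T y) = norm y" for y
      by (rule norm_eq[THEN iffD2]) (simp add: inner_diff_left inner_diff_right bb inner_commute algebra_simps)
    have "k b b' (?T y) = - k b b' y" for y
      using nT[of y] by (simp add: k_def cone_weight_def inner_diff_right bb inner_commute)
    moreover have "?T \<in> borel_measurable borel"
      by (intro borel_measurable_continuous_onI continuous_intros)
    ultimately have "Q b b' = - Q b b'"
      using Qinv[OF distr_lborel_reflect_Basis[OF b(1)], of b b'] by (simp add: Q_def)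
    then show ?thesis by simp
  qed
  have diag: "Q b b = Q b' b'" if b: "b \<in> Basis" "b' \<in> Basis" for b b'
  proof (cases "b = b'")
    case False
    let ?T = "\<lambda>y. y - (y \<bullet> b - y \<bullet> b') *\<^sub>R (b - b')"
    have bb: "b \<bullet> b = 1" "b \<bullet> b' = 0" "b' \<bullet> b = 0" "b' \<bullet> b' = 1"
      using b False by (simp_all add: inner_Basis)
    have nT: "norm (?T y) = norm y" for y
      by (rule norm_eq[THEN iffD2]) (simp add: inner_diff_left inner_diff_right bb inner_commute algebra_simps)
    have "k b b (?T y) = k b' b' y" for y
      using nT[of y] by (simp add: k_def cone_weight_def inner_diff_right bb inner_commute)
    moreover have "?T \<in> borel_measurable borel"
      by (intro borel_measurable_continuous_onI continuous_intros)
    ultimately show ?thesis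
      using Qinv[OF distr_lborel_swap_Basis[OF b], of b b] by (simp add: Q_def)
  qed simp
  have tr: "(\<Sum>b\<in>Basis. Q b b) = integral\<^sup>L lborel (cone_weight n :: 'a \<Rightarrow> real)"
  proof -
    have "(\<Sum>b\<in>Basis. Q b b) = integral\<^sup>L lborel (\<lambda>y. \<Sum>b\<in>Basis. k b b y)"
      unfolding Q_def by (rule Bochner_Integration.integral_sum[symmetric]) (rule ki)
    also have "\<dots> = integral\<^sup>L lborel (cone_weight n :: 'a \<Rightarrow> real)"
    proof (rule integral_cong_AE)
      \<comment> \<open>At the origin the quotients are 0 by the convention for division by 0,
        whereas the weight is 1 there, so the trace identity holds off this point only.\<close>
      have "AE y in lborel. y \<noteq> (0::'a)" by (rule AE_lborel_singleton)
      then show "AE y in lborel. (\<Sum>b\<in>Basis. k b b y) = cone_weight n (y::'a)"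
      proof eventually_elim
        case (elim y)
        have "(norm y)\<^sup>2 = (\<Sum>b\<in>Basis. (b \<bullet> y) * (b \<bullet> y))"
          unfolding power2_norm_eq_inner by (subst euclidean_inner) (simp add: inner_commute)
        then have "(\<Sum>b\<in>Basis. k b b y) = cone_weight n y * ((norm y)\<^sup>2 / (norm y)\<^sup>2)"
          unfolding k_def by (simp add: sum_distrib_left[symmetric] sum_divide_distrib[symmetric])
        then show ?case using elim by simp
      qed
    qed simp_all
    finally show ?thesis .
  qed
  have Qb: "Q b b = integral\<^sup>L lborel (cone_weight n :: 'a \<Rightarrow> real) / real n" if "b \<in> Basis" for b
  proof -
    have "(\<Sum>b'\<in>Basis. Q b' b') = (\<Sum>b'\<in>(Basis :: 'a set). Q b b)"
      by (rule sum.cong) (rule refl, rule diag[OF _ that])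
    then show ?thesis unfolding tr by (simp add: n_def)
  qed
  have expand: "k p q y = (\<Sum>b\<in>Basis. \<Sum>b'\<in>Basis. (p \<bullet> b) * (q \<bullet> b') * k b b' y)" for y
  proof -
    have "(p \<bullet> y) * (q \<bullet> y) = (\<Sum>b\<in>Basis. \<Sum>b'\<in>Basis. ((p \<bullet> b) * (y \<bullet> b)) * ((q \<bullet> b') * (y \<bullet> b')))"
      unfolding euclidean_inner[of p y] euclidean_inner[of q y] sum_product ..
    then show ?thesis
      unfolding k_def by (simp add: sum_distrib_left sum_divide_distrib inner_commute mult_ac)
  qed
  have "Q p q = (\<Sum>b\<in>Basis. \<Sum>b'\<in>Basis. (p \<bullet> b) * (q \<bullet> b') * Q b b')"
  proof -
    have "Q p q = integral\<^sup>L lborel (\<lambda>y. \<Sum>b\<in>Basis. \<Sum>b'\<in>Basis. (p \<bullet> b) * (q \<bullet> b') * k b b' y)"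
      unfolding Q_def by (rule Bochner_Integration.integral_cong) (rule refl, rule expand)
    then show ?thesis unfolding Q_def by (simp add: ki)
  qed
  also have "\<dots> = (\<Sum>b\<in>Basis. (p \<bullet> b) * (q \<bullet> b) * (integral\<^sup>L lborel (cone_weight n :: 'a \<Rightarrow> real) / real n))"
  proof (rule sum.cong)
    fix b :: 'a assume b: "b \<in> Basis"
    have "(\<Sum>b'\<in>Basis. (p \<bullet> b) * (q \<bullet> b') * Q b b') = (\<Sum>b'\<in>Basis. if b' = b then (p \<bullet> b) * (q \<bullet> b) * Q b b else 0)"
      by (rule sum.cong) (use off b in auto)
    then show "(\<Sum>b'\<in>Basis. (p \<bullet> b) * (q \<bullet> b') * Q b b')
        = (p \<bullet> b) * (q \<bullet> b) * (integral\<^sup>L lborel (cone_weight n :: 'a \<Rightarrow> real) / real n)"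
      using b by (simp add: Qb)
  qed simp
  also have "\<dots> = ?rhs"
    by (subst euclidean_inner[of p q]) (simp add: sum_distrib_right sum_divide_distrib)
  finally show "?lhs = ?rhs" by (simp add: Q_def k_def)
  show "integrable lborel (\<lambda>y. cone_weight n y * ((p \<bullet> y) * (q \<bullet> y) / (norm y)\<^sup>2))"
    using ki[of p q] by (simp add: k_def)
qed

text \<open>The map y -> -y exchanges the two open half spaces, and the hyperplane between them is
  null.\<close>

lemma integral_half_space_even:
  fixes f :: "'a::euclidean_space \<times> real \<Rightarrow> real"
  assumes f: "integrable lborel f" and even: "\<And>y. f (- y) = f y"
  shows "integral\<^sup>L lborel (\<lambda>y. indicator {y. snd y < 0} y * f y) = integral\<^sup>L lborel f / 2"
proof -
  have fm[measurable]: "f \<in> borel_measurable borel" using f by auto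
  have sm: "{y::'a \<times> real. snd y < 0} \<in> sets borel" "{y::'a \<times> real. snd y > 0} \<in> sets borel"
    by (intro borel_open open_Collect_less continuous_intros)+
  have i: "integrable lborel (\<lambda>y. indicator A y * f y)" if "A \<in> sets borel" for A
    using integrable_mult_indicator[OF _ f, of A] that by simp
  have "integral\<^sup>L lborel (\<lambda>y. indicator {y. snd y < 0} y * f y)
      = integral\<^sup>L lborel (\<lambda>y. indicator {y. snd y < 0} (- y) * f (- y))"
    by (rule integral_distr_invariant(1)[OF distr_lborel_uminus, symmetric]) (use sm in simp_all)
  also have "\<dots> = integral\<^sup>L lborel (\<lambda>y. indicator {y. snd y > 0} y * f y)"
    by (simp add: even indicator_def)
  finally have half: "integral\<^sup>L lborel (\<lambda>y. indicator {y. snd y < 0} y * f y)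
      = integral\<^sup>L lborel (\<lambda>y. indicator {y. snd y > 0} y * f y)" .
  have "integral\<^sup>L lborel f
      = integral\<^sup>L lborel (\<lambda>y. indicator {y. snd y < 0} y * f y + indicator {y. snd y > 0} y * f y)"
  proof (rule integral_cong_AE)
    show "AE y in lborel. f y = indicator {y. snd y < 0} y * f y + indicator {y. snd y > 0} y * f y"
      using AE_snd_neq_0 by eventually_elim (auto simp: indicator_def)
  qed (use sm in auto)
  also have "\<dots> = 2 * integral\<^sup>L lborel (\<lambda>y. indicator {y. snd y < 0} y * f y)"
    using i[OF sm(1)] i[OF sm(2)] half by simp
  finally show ?thesis by simp
qed

section \<open>Weighted integration by parts\<close>

text \<open>Here \<open>f\<close> may fail to be integrable by one power of |x|. The loss is
  recovered from the cutoff: its derivative is at most 4 |x| |e| / R^2 and lives on |x| <= R, so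
  multiplied by \<open>f\<close> it is dominated by a multiple of \<open>g\<close> and tends to 0
  pointwise.\<close>

lemma integral_directional_derivative_eq_0_weighted:
  fixes f g :: "'a::euclidean_space \<Rightarrow> real"
  assumes deriv: "\<And>x. (f has_derivative D x) (at x)"
    and cont: "continuous_on UNIV (\<lambda>x. D x e)"
    and int: "integrable lborel (\<lambda>x. D x e)"
    and g: "integrable lborel g" and le: "\<And>x. \<bar>f x\<bar> \<le> (1 + norm x) * g x"
  shows "integral\<^sup>L lborel (\<lambda>x. D x e) = 0"
proof -
  have cf: "continuous_on UNIV f"
    by (rule has_derivative_continuous_on) (use deriv in auto)
  define u where "u = (\<lambda>k x. cutoff 2 (real (Suc k)) x * f x)"
  define v where "v = (\<lambda>k x. cutoff_deriv 2 (real (Suc k)) x e * f x)"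
  define w where "w = (\<lambda>k x. cutoff 2 (real (Suc k)) x * D x e)"
  have ui: "integrable lborel (u k)" and vi: "integrable lborel (v k)" and wi: "integrable lborel (w k)" for k
    by (rule integrable_continuous_compact_support[where R="real (Suc k)"],
        auto simp: u_def v_def w_def cutoff_outside intro!: continuous_intros cf cont)+
  have g0: "g x \<ge> 0" for x
  proof -
    have "0 \<le> (1 + norm x) * g x" using le[of x] by linarith
    then show ?thesis using norm_ge_zero[of x] by (simp add: zero_le_mult_iff)
  qed
  have zero: "integral\<^sup>L lborel (\<lambda>x. v k x + w k x) = 0" for k
  proof (rule integral_directional_derivative_eq_0)
    show "integrable lborel (u k)" by (rule ui)
    show "integrable lborel (\<lambda>x. v k x + w k x)" using vi wi by simp
    fix x
    have "((\<lambda>s. v k (x + s *\<^sub>R e) + w k (x + s *\<^sub>R e)) has_integral u k (x + 1 *\<^sub>R e) - u k (x + 0 *\<^sub>R e)) {0..1}"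
    proof (rule fundamental_theorem_of_calculus)
      fix s :: real
      let ?y = "x + s *\<^sub>R e"
      have du: "(u k has_derivative (\<lambda>h. cutoff 2 (real (Suc k)) ?y * D ?y h + cutoff_deriv 2 (real (Suc k)) ?y h * f ?y)) (at ?y)"
        unfolding u_def by (rule has_derivative_mult[OF has_derivative_cutoff deriv]) simp
      have "((\<lambda>s. x + s *\<^sub>R e) has_derivative (\<lambda>h. h *\<^sub>R e)) (at s within {0..1})"
        by (auto intro!: derivative_eq_intros)
      from has_derivative_compose[OF this du]
      have "((\<lambda>s. u k (x + s *\<^sub>R e)) has_derivative
          (\<lambda>h. cutoff 2 (real (Suc k)) ?y * D ?y (h *\<^sub>R e) + cutoff_deriv 2 (real (Suc k)) ?y (h *\<^sub>R e) * f ?y))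
          (at s within {0..1})" .
      moreover have "cutoff 2 (real (Suc k)) ?y * D ?y (h *\<^sub>R e) + cutoff_deriv 2 (real (Suc k)) ?y (h *\<^sub>R e) * f ?y
          = h *\<^sub>R (v k ?y + w k ?y)" for h
      proof -
        have "cutoff_deriv 2 (real (Suc k)) z (h *\<^sub>R e) = h * cutoff_deriv 2 (real (Suc k)) z e" for z
          by (simp add: cutoff_deriv_def)
        then show ?thesis
          using linear_scale[OF has_derivative_linear[OF deriv[of ?y]], of h e]
          by (simp add: v_def w_def distrib_left mult_ac)
      qed
      ultimately show "((\<lambda>s. u k (x + s *\<^sub>R e)) has_vector_derivative v k ?y + w k ?y) (at s within {0..1})"
        by (simp add: has_vector_derivative_def)
    qed simp
    then show "((\<lambda>s. v k (x + s *\<^sub>R e) + w k (x + s *\<^sub>R e)) has_integral u k (x + e) - u k x) {0..1}"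
      by simp
  qed
  have v_le: "\<bar>v k x\<bar> \<le> 4 / (real (Suc k))\<^sup>2 * (norm x * norm e * \<bar>f x\<bar>)" for k x
  proof -
    have "\<bar>cutoff_deriv 2 (real (Suc k)) x e\<bar>
        = 4 / (real (Suc k))\<^sup>2 * (max 0 (1 - (norm x / real (Suc k))\<^sup>2) * \<bar>x \<bullet> e\<bar>)"
      unfolding cutoff_deriv_def abs_mult by (simp del: of_nat_Suc)
    also have "\<dots> \<le> 4 / (real (Suc k))\<^sup>2 * (1 * (norm x * norm e))"
      by (intro mult_left_mono mult_mono Cauchy_Schwarz_ineq2) auto
    finally have "\<bar>cutoff_deriv 2 (real (Suc k)) x e\<bar> * \<bar>f x\<bar> \<le> 4 / (real (Suc k))\<^sup>2 * (1 * (norm x * norm e)) * \<bar>f x\<bar>"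
      by (rule mult_right_mono) simp
    then show ?thesis by (simp add: v_def abs_mult del: of_nat_Suc)
  qed
  have "(\<lambda>k. integral\<^sup>L lborel (v k)) \<longlonglongrightarrow> integral\<^sup>L lborel (\<lambda>x::'a. 0::real)"
  proof (rule integral_dominated_convergence[where w="\<lambda>x. 8 * norm e * g x"])
    show "integrable lborel (\<lambda>x. 8 * norm e * g x)" using g by simp
    have "(\<lambda>k. v k x) \<longlonglongrightarrow> 0" for x
    proof (rule Lim_null_comparison)
      show "\<forall>\<^sub>F k in sequentially. norm (v k x) \<le> 4 * (1 / real (Suc k))\<^sup>2 * (norm x * norm e * \<bar>f x\<bar>)"
        using v_le[of _ x] by (simp add: power_divide del: of_nat_Suc)
      have "(\<lambda>k. 4 * (1 / real (Suc k))\<^sup>2 * (norm x * norm e * \<bar>f x\<bar>)) \<longlonglongrightarrow> 4 * 0\<^sup>2 * (norm x * norm e * \<bar>f x\<bar>)"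
        by (rule tendsto_mult[OF tendsto_mult[OF tendsto_const tendsto_power[OF LIMSEQ_Suc[OF lim_1_over_n[where 'a=real]]]] tendsto_const])
      then show "(\<lambda>k. 4 * (1 / real (Suc k))\<^sup>2 * (norm x * norm e * \<bar>f x\<bar>)) \<longlonglongrightarrow> 0" by simp
    qed
    then show "AE x in lborel. (\<lambda>k. v k x) \<longlonglongrightarrow> 0" by simp
    \<comment> \<open>The factor 4 comes from the derivative of the cutoff and 2 from 1 + |x| <= 2
      R, where R = \<open>real (Suc k)\<close> is at least 1 and |x| <= R on the support.\<close>
    have "\<bar>v k x\<bar> \<le> 8 * norm e * g x" for k x
    proof (cases "norm x \<le> real (Suc k)")
      case True
      let ?R = "real (Suc k)"
      have "norm x * \<bar>f x\<bar> \<le> ?R * ((1 + norm x) * g x)"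
        using True le[of x] by (intro mult_mono) auto
      also have "\<dots> \<le> ?R * ((2 * ?R) * g x)"
        using True g0[of x] by (intro mult_left_mono mult_right_mono) auto
      finally have "4 / ?R\<^sup>2 * (norm x * norm e * \<bar>f x\<bar>) \<le> 4 / ?R\<^sup>2 * (norm e * (?R * ((2 * ?R) * g x)))"
        by (intro mult_left_mono) (auto simp: mult_ac intro: mult_left_mono)
      also have "\<dots> = 8 * norm e * g x"
        by (simp add: power2_eq_square field_simps del: of_nat_Suc)
      finally show ?thesis using v_le[of k x] by linarith
    next
      case False
      then have "v k x = 0" by (simp add: v_def cutoff_outside)
      then show ?thesis using g0[of x] by simp
    qed
    then show "AE x in lborel. norm (v k x) \<le> 8 * norm e * g x" for k by simp
  qed (use vi in auto)
  moreover have "(\<lambda>k. integral\<^sup>L lborel (w k)) \<longlonglongrightarrow> integral\<^sup>L lborel (\<lambda>x. D x e)"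
  proof (rule integral_dominated_convergence[where w="\<lambda>x. \<bar>D x e\<bar>"])
    have "(\<lambda>k. w k x) \<longlonglongrightarrow> 1 * D x e" for x
      unfolding w_def by (intro tendsto_mult tendsto_const cutoff_tendsto_1) simp
    then show "AE x in lborel. (\<lambda>k. w k x) \<longlonglongrightarrow> D x e" by simp
    have "\<bar>w k x\<bar> \<le> \<bar>D x e\<bar>" for k x
      using cutoff_bounds[where R="real (Suc k)" and n=2 and x=x]
      by (simp add: w_def abs_mult mult_left_le_one_le)
    then show "AE x in lborel. norm (w k x) \<le> \<bar>D x e\<bar>" for k by simp
  qed (use int wi in auto)
  ultimately have "(\<lambda>k. integral\<^sup>L lborel (v k) + integral\<^sup>L lborel (w k)) \<longlonglongrightarrow> 0 + integral\<^sup>L lborel (\<lambda>x. D x e)"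
    by (intro tendsto_add) simp_all
  moreover have "integral\<^sup>L lborel (v k) + integral\<^sup>L lborel (w k) = 0" for k
    using zero[of k] vi wi by simp
  ultimately have "(\<lambda>k::nat. 0) \<longlonglongrightarrow> integral\<^sup>L lborel (\<lambda>x. D x e)" by simp
  from LIMSEQ_unique[OF this tendsto_const] show ?thesis .
qed

lemma has_derivative_inverse_arc_length:
  fixes G :: "'a::real_normed_vector \<Rightarrow> 'b::real_inner"
  assumes "(G has_derivative G') (at x)"
  shows "((\<lambda>x. 1 / sqrt (1 + (norm (G x))\<^sup>2)) has_derivative
      (\<lambda>h. - (G x \<bullet> G' h) / sqrt (1 + (norm (G x))\<^sup>2) ^ 3)) (at x)"
proof -
  define s where "s = sqrt (1 + (norm (G x))\<^sup>2)"
  have pos: "1 + (norm (G x))\<^sup>2 > 0" by (simp add: add_pos_nonneg)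
  then have s: "s > 0" by (simp add: s_def)
  have "((\<lambda>x. 1 + (norm (G x))\<^sup>2) has_derivative (\<lambda>h. 2 * (G x \<bullet> G' h))) (at x)"
    unfolding power2_norm_eq_inner
    by (auto intro!: derivative_eq_intros assms simp: inner_commute)
  moreover have "((\<lambda>u. 1 / sqrt u) has_real_derivative - 1 / (2 * s ^ 3)) (at (1 + (norm (G x))\<^sup>2))"
    using pos s
    by (auto intro!: derivative_eq_intros simp: s_def[symmetric] power3_eq_cube field_simps)
  ultimately have "((\<lambda>x. 1 / sqrt (1 + (norm (G x))\<^sup>2)) has_derivative (\<lambda>h. - 1 / (2 * s ^ 3) * (2 * (G x \<bullet> G' h)))) (at x)"
    unfolding has_field_derivative_def using has_derivative_compose by blast
  then show ?thesis by (simp add: s_def[symmetric])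
qed

text \<open>The mean curvature is the divergence of \<open>P\<close>, and |P| <= |G|. Since |G| is
  integrable and the derivatives of \<open>P\<close> decay at the same rate, each summand integrates
  to 0 with nothing left at infinity.\<close>

lemma mean_curvature_integral:
  fixes G :: "'a::euclidean_space \<Rightarrow> 'a" and H :: "'a \<Rightarrow> 'a \<Rightarrow> 'a"
  defines "P \<equiv> \<lambda>x. (1 / sqrt (1 + (norm (G x))\<^sup>2)) *\<^sub>R G x"
    and "P' \<equiv> \<lambda>x h. (1 / sqrt (1 + (norm (G x))\<^sup>2)) *\<^sub>R H x h
      - ((G x \<bullet> H x h) / sqrt (1 + (norm (G x))\<^sup>2) ^ 3) *\<^sub>R G x"
  assumes deriv: "\<And>x. (G has_derivative H x) (at x)"
    and cont: "\<And>h. continuous_on UNIV (\<lambda>x. H x h)"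
    and a: "a > real DIM('a)"
    and le: "\<And>x. norm (G x) \<le> C * (1 + norm x) powr (- a)"
      "\<And>x b. b \<in> Basis \<Longrightarrow> norm (H x b) \<le> C * (1 + norm x) powr (- a)"
  shows "(P has_derivative P' x) (at x)"
    and "integrable lborel (\<lambda>x. \<Sum>b\<in>Basis. P' x b \<bullet> b)"
    and "integral\<^sup>L lborel (\<lambda>x. \<Sum>b\<in>Basis. P' x b \<bullet> b) = 0"
proof -
  have pos: "1 + (norm (G x))\<^sup>2 > 0" for x by (simp add: add_pos_nonneg)
  have cG: "continuous_on UNIV G"
    by (rule has_derivative_continuous_on) (use deriv in auto)
  have dP: "(P has_derivative P' x) (at x)" for x
  proof -
    have "(P has_derivative (\<lambda>h. (1 / sqrt (1 + (norm (G x))\<^sup>2)) *\<^sub>R H x h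
        + (- (G x \<bullet> H x h) / sqrt (1 + (norm (G x))\<^sup>2) ^ 3) *\<^sub>R G x)) (at x)"
      unfolding P_def by (rule has_derivative_scaleR[OF has_derivative_inverse_arc_length deriv]) (rule deriv)
    moreover have "(\<lambda>h. (1 / sqrt (1 + (norm (G x))\<^sup>2)) *\<^sub>R H x h
        + (- (G x \<bullet> H x h) / sqrt (1 + (norm (G x))\<^sup>2) ^ 3) *\<^sub>R G x) = P' x"
      by (auto simp: P'_def)
    ultimately show ?thesis by simp
  qed
  then show "(P has_derivative P' x) (at x)" .
  have s1: "sqrt (1 + (norm (G x))\<^sup>2) \<ge> 1" for x by simp
  have cP': "continuous_on UNIV (\<lambda>x. P' x b \<bullet> c)" for b c
    unfolding P'_def using s1
    by (intro continuous_intros cont cG) (auto simp: add_nonneg_eq_0_iff)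
  have P'_le: "\<bar>P' x b \<bullet> b\<bar> \<le> 2 * C * (1 + norm x) powr (- a)" if b: "b \<in> Basis" for x b
  proof -
    define s where "s = sqrt (1 + (norm (G x))\<^sup>2)"
    have s: "s \<ge> 1" "s\<^sup>2 = 1 + (norm (G x))\<^sup>2" using pos[of x] by (auto simp: s_def)
    have nb: "norm b = 1" using b by simp
    have 1: "\<bar>H x b \<bullet> b\<bar> / s \<le> norm (H x b)"
    proof -
      have "\<bar>H x b \<bullet> b\<bar> / s \<le> \<bar>H x b \<bullet> b\<bar> / 1" using s by (intro divide_left_mono) auto
      then show ?thesis using Cauchy_Schwarz_ineq2[of "H x b" b] nb by simp
    qed
    \<comment> \<open>The two factors of \<open>G\<close> are absorbed by the denominator: |G|^2 <=
      s^2 <= s^3.\<close>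
    have 2: "\<bar>G x \<bullet> H x b\<bar> / s ^ 3 * \<bar>G x \<bullet> b\<bar> \<le> norm (H x b)"
    proof -
      have "\<bar>G x \<bullet> H x b\<bar> * \<bar>G x \<bullet> b\<bar> \<le> (norm (G x) * norm (H x b)) * (norm (G x) * norm b)"
        by (intro mult_mono Cauchy_Schwarz_ineq2) auto
      also have "\<dots> = (norm (G x))\<^sup>2 * norm (H x b)" by (simp add: nb power2_eq_square)
      also have "\<dots> \<le> s ^ 3 * norm (H x b)"
      proof (rule mult_right_mono)
        have "(norm (G x))\<^sup>2 \<le> s\<^sup>2" using s(2) by simp
        also have "\<dots> \<le> s ^ 3" using s(1) by (intro power_increasing) auto
        finally show "(norm (G x))\<^sup>2 \<le> s ^ 3" .
      qed simp
      finally show ?thesis using s(1) by (simp add: divide_le_eq mult_ac)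
    qed
    have "P' x b \<bullet> b = H x b \<bullet> b / s - (G x \<bullet> H x b) / s ^ 3 * (G x \<bullet> b)"
      by (simp add: P'_def s_def[symmetric] inner_diff_left)
    also have "\<bar>\<dots>\<bar> \<le> \<bar>H x b \<bullet> b / s\<bar> + \<bar>(G x \<bullet> H x b) / s ^ 3 * (G x \<bullet> b)\<bar>"
      by (rule abs_triangle_ineq4)
    also have "\<dots> \<le> norm (H x b) + norm (H x b)"
      using 1 2 s(1) by (intro add_mono) (simp_all add: abs_mult)
    finally show ?thesis using le(2)[OF b, of x] by simp
  qed
  have i: "integrable lborel (\<lambda>x. P' x b \<bullet> b)" if "b \<in> Basis" for b
    by (rule integrable_of_decay[OF borel_measurable_continuous_onI[OF cP'] a P'_le[OF that]])
  have z: "integral\<^sup>L lborel (\<lambda>x. P' x b \<bullet> b) = 0" if b: "b \<in> Basis" for b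
  proof (rule integral_directional_derivative_eq_0_weighted[where f="\<lambda>x. P x \<bullet> b" and g="\<lambda>x. norm (G x)"
        and e=b and D="\<lambda>x h. P' x h \<bullet> b"])
    show "((\<lambda>x. P x \<bullet> b) has_derivative (\<lambda>h. P' x h \<bullet> b)) (at x)" for x
      by (auto intro!: derivative_eq_intros dP)
    show "integrable lborel (\<lambda>x. norm (G x))"
      by (rule integrable_of_decay[OF borel_measurable_continuous_onI a])
        (use le(1) in \<open>auto intro!: continuous_intros cG\<close>)
    fix x
    have "\<bar>P x \<bullet> b\<bar> \<le> norm (P x)" using Cauchy_Schwarz_ineq2[of "P x" b] b by simp
    also have "\<dots> = norm (G x) / sqrt (1 + (norm (G x))\<^sup>2)" by (simp add: P_def)
    also have "\<dots> \<le> norm (G x) / 1" using s1[of x] pos[of x] by (intro divide_left_mono) auto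
    also have "\<dots> \<le> (1 + norm x) * norm (G x)" by (simp add: distrib_right)
    finally show "\<bar>P x \<bullet> b\<bar> \<le> (1 + norm x) * norm (G x)" .
  qed (use cP' i b in auto)
  show "integrable lborel (\<lambda>x. \<Sum>b\<in>Basis. P' x b \<bullet> b)" using i by simp
  show "integral\<^sup>L lborel (\<lambda>x. \<Sum>b\<in>Basis. P' x b \<bullet> b) = 0" using i z by simp
qed

section \<open>Harmonic potentials below a graph\<close>

lemma filterlim_norm_at_infinity_within:
  "filterlim norm at_top (at_infinity_within S)"
  unfolding at_infinity_within_def
  by (rule filterlim_mono[OF filterlim_norm_at_top order_refl]) simp

lemma tendsto_inverse_norm_at_infinity_within:
  "((\<lambda>x. a * inverse (norm x)) \<longlongrightarrow> 0) (at_infinity_within S)"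
  using tendsto_mult_right_zero[OF tendsto_inverse_0_at_top[OF filterlim_norm_at_infinity_within]] .

lemma eventually_at_infinity_within_mem: "\<forall>\<^sub>F x in at_infinity_within S. x \<in> S \<and> x \<noteq> 0"
proof -
  have "\<forall>\<^sub>F x in at_infinity. x \<noteq> (0::'a)"
    unfolding eventually_at_infinity by (intro exI[of _ 1]) auto
  then show ?thesis
    unfolding at_infinity_within_def eventually_inf_principal by (rule eventually_mono) auto
qed

text \<open>Collects the partial derivatives occurring in a divergence into one directional
  derivative, so that symmetry of the Hessian can be applied.\<close>

lemma sum_Basis_inner_linear:
  fixes F :: "'a::euclidean_space \<Rightarrow> 'a"
  assumes "linear F"
  shows "(\<Sum>b\<in>Basis. (F b \<bullet> u) * (v \<bullet> b)) = F v \<bullet> u"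
proof -
  have "F v = F (\<Sum>b\<in>Basis. (v \<bullet> b) *\<^sub>R b)" by (simp add: euclidean_representation)
  also have "\<dots> = (\<Sum>b\<in>Basis. (v \<bullet> b) *\<^sub>R F b)"
    by (simp add: linear_sum[OF assms] linear_scale[OF assms])
  finally show ?thesis by (simp add: inner_sum_left mult.commute)
qed

text \<open>\<open>V\<close> is the gradient extended continuously to the closure and
  \<open>H\<close> the corresponding extension of the Hessian. The decay bounds are the dipole
  rates, written as products with powers of 1 + |x| so that a lower power of |x| can be split off
  without treating the origin separately.\<close>

locale C1_subgraph_potential = C1_subgraph \<eta> G M
  for \<eta> :: "'a::euclidean_space \<Rightarrow> real" and G :: "'a \<Rightarrow> 'a" and M :: real +
  fixes \<phi> :: "'a \<times> real \<Rightarrow> real" and V :: "'a \<times> real \<Rightarrow> 'a \<times> real"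
    and H :: "'a \<times> real \<Rightarrow> 'a \<times> real \<Rightarrow> 'a \<times> real"
    and c :: "'a \<times> real" and C :: real and n :: nat
  assumes n_def: "n = DIM('a \<times> real)"
    and cont_phi: "continuous_on (closure dom) \<phi>" and cont_V: "continuous_on (closure dom) V"
    and cont_H: "\<And>h. continuous_on (closure dom) (\<lambda>x. H x h)"
    and deriv_phi: "\<And>x. x \<in> dom \<Longrightarrow> GDERIV \<phi> x :> V x"
    and deriv_V: "\<And>x. x \<in> dom \<Longrightarrow> (V has_derivative H x) (at x)"
    and harmonic: "\<And>x. x \<in> dom \<Longrightarrow> (\<Sum>b\<in>Basis. H x b \<bullet> b) = 0"
    and kinematic: "\<And>x. V (x, \<eta> x) \<bullet> surface_normal x = c \<bullet> surface_normal x"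
    and c_horizontal: "snd c = 0"
    and phi_le: "\<And>x. x \<in> closure dom \<Longrightarrow> \<bar>\<phi> x\<bar> * (1 + norm x) ^ (n - 1) \<le> C"
    and V_le: "\<And>x. x \<in> closure dom \<Longrightarrow> norm (V x) * (1 + norm x) ^ n \<le> C"
begin

lemma n_ge_2: "n \<ge> 2"
  by (simp add: n_def)

lemma power_n_minus:
  fixes z :: real
  shows "z ^ (n - 2) * z = z ^ (n - 1)" and "z ^ (n - 1) * z = z ^ n"
proof -
  have "z ^ (n - 2) * z = z ^ Suc (n - 2)" "z ^ (n - 1) * z = z ^ Suc (n - 1)"
    by (simp_all only: power_Suc2)
  moreover have "Suc (n - 2) = n - 1" "Suc (n - 1) = n" using n_ge_2 by simp_all
  ultimately show "z ^ (n - 2) * z = z ^ (n - 1)" "z ^ (n - 1) * z = z ^ n" by simp_all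
qed

lemma C_nonneg: "C \<ge> 0"
proof -
  have "0 \<le> \<bar>\<phi> (0, \<eta> 0)\<bar> * (1 + norm (0::'a, \<eta> 0)) ^ (n - 1)" by simp
  also have "\<dots> \<le> C" by (rule phi_le) (simp add: closure_dom)
  finally show ?thesis .
qed

lemma V_le_weak:
  assumes x: "x \<in> closure dom" and k: "k \<le> n"
  shows "norm (V x) * norm x ^ k \<le> C"
proof -
  have "norm x ^ k \<le> (1 + norm x) ^ k" by (intro power_mono) auto
  also have "\<dots> \<le> (1 + norm x) ^ n" using k by (intro power_increasing) auto
  finally have "norm (V x) * norm x ^ k \<le> norm (V x) * (1 + norm x) ^ n"
    by (rule mult_left_mono) simp
  then show ?thesis using V_le[OF x] by linarith
qed

lemma phi_le_weak:
  assumes x: "x \<in> closure dom"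
  shows "\<bar>\<phi> x\<bar> * norm x ^ (n - 1) \<le> C"
proof -
  have "norm x ^ (n - 1) \<le> (1 + norm x) ^ (n - 1)" by (intro power_mono) auto
  then have "\<bar>\<phi> x\<bar> * norm x ^ (n - 1) \<le> \<bar>\<phi> x\<bar> * (1 + norm x) ^ (n - 1)"
    by (rule mult_left_mono) simp
  then show ?thesis using phi_le[OF x] by linarith
qed

lemma V_bound: "x \<in> closure dom \<Longrightarrow> norm (V x) \<le> C"
  using V_le_weak[of x 0] by simp

lemma integrable_energy: "integrable lborel (\<lambda>x. indicator dom x * (norm (V x))\<^sup>2)"
proof (rule integrable_of_decay)
  show "(\<lambda>x. indicator dom x * (norm (V x))\<^sup>2) \<in> borel_measurable borel"
    by (rule measurable_on_dom) (intro continuous_intros cont_V)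
  show "real (2 * n) > real DIM('a \<times> real)" by (simp add: n_def)
  fix x :: "'a \<times> real"
  have pos: "1 + norm x > 0" using norm_ge_zero[of x] by linarith
  show "\<bar>indicator dom x * (norm (V x))\<^sup>2\<bar> \<le> C\<^sup>2 * (1 + norm x) powr - real (2 * n)"
  proof (cases "x \<in> dom")
    case True
    then have "(norm (V x) * (1 + norm x) ^ n)\<^sup>2 \<le> C\<^sup>2"
      using V_le[of x] closure_subset[of dom] pos by (intro power_mono) auto
    then have "(norm (V x))\<^sup>2 \<le> C\<^sup>2 / (1 + norm x) ^ (2 * n)"
      using pos by (simp add: pos_le_divide_eq power_mult_distrib power_mult[symmetric] mult.commute)
    also have "\<dots> = C\<^sup>2 * (1 + norm x) powr - real (2 * n)"
      using pos by (simp only: powr_minus powr_realpow divide_inverse)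
    finally show ?thesis using True by simp
  qed simp
qed

text \<open>The two terms on the right are the flux of \<open>K\<close> through the surface and its
  flux through infinity. The weights |x|^(n-1) and |x|^n in the asymptotic hypotheses are those with
  which \<phi> and \<open>V\<close> enter the part of |x|^(n-2) (x . K) that is linear in
  them.\<close>

theorem kinetic_energy:
  fixes p :: "'a \<times> real"
  assumes phi_asymp: "((\<lambda>x. norm x ^ (n - 1) * (\<phi> x - p \<bullet> x / norm x ^ n)) \<longlongrightarrow> 0) (at_infinity_within dom)"
    and V_asymp: "((\<lambda>x. norm x ^ n * norm (V x - ((1 / norm x ^ n) *\<^sub>R p
        - (real n * (p \<bullet> x) / norm x ^ (n + 2)) *\<^sub>R x))) \<longlongrightarrow> 0) (at_infinity_within dom)"
    and a: "a > real DIM('a)"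
    and eta_le: "\<And>x. \<bar>\<eta> x\<bar> \<le> A * (1 + norm x) powr (- a)"
    and G_le: "\<And>x. norm (G x) \<le> A * (1 + norm x) powr (- (a + 1))"
  shows "integral\<^sup>L lborel (\<lambda>x. indicator dom x * (norm (V x))\<^sup>2)
      = (norm c)\<^sup>2 * integral\<^sup>L lborel \<eta> - real n * unit_ball_vol (real n) / 2 * (c \<bullet> p)"
proof -
  define e where "e = fst c"
  have ce: "c = (e, 0)" using c_horizontal by (simp add: e_def prod_eq_iff)
  define K where "K = (\<lambda>x. \<phi> x *\<^sub>R V x - \<phi> x *\<^sub>R c + (c \<bullet> x) *\<^sub>R V x)"
  define K' where "K' = (\<lambda>x h. (V x \<bullet> h) *\<^sub>R V x + \<phi> x *\<^sub>R H x h - (V x \<bullet> h) *\<^sub>R c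
      + ((c \<bullet> h) *\<^sub>R V x + (c \<bullet> x) *\<^sub>R H x h))"
  \<comment> \<open>The value of |x|^(n-2) (x . K) on a pure dipole without the quadratic term: the
    part with \<phi> gives the coefficient -1 and the part with \<open>V\<close> gives 1 -
    n.\<close>
  define h0 where "h0 = (\<lambda>x. - real n * ((p \<bullet> x) * (c \<bullet> x) / (norm x)\<^sup>2))"
  \<comment> \<open>By the kinematic condition the two terms with \<phi> cancel, and in the last
    term \<open>V\<close> may be replaced by \<open>c\<close>.\<close>
  have flux: "K (x, \<eta> x) \<bullet> surface_normal x = - ((e \<bullet> x) * (G x \<bullet> e))" for x
    using kinematic[of x] by (simp add: K_def inner_add_left inner_diff_left)
      (simp add: ce surface_normal_def inner_commute)
  have eta_i: "integrable lborel \<eta>"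
    by (rule integrable_of_decay[OF borel_measurable_continuous_onI[OF cont_eta] a eta_le])
  \<comment> \<open>The gradient decays one power faster than \<eta>, which pays for the linear
    factor.\<close>
  have xG_i: "integrable lborel (\<lambda>x. (e \<bullet> x) * (G x \<bullet> e))"
  proof (rule integrable_of_decay[OF _ a])
    show "(\<lambda>x. (e \<bullet> x) * (G x \<bullet> e)) \<in> borel_measurable borel"
      by (intro borel_measurable_continuous_onI continuous_intros)
    fix x
    have "\<bar>(e \<bullet> x) * (G x \<bullet> e)\<bar> \<le> (norm e * norm x) * (norm (G x) * norm e)"
      unfolding abs_mult by (intro mult_mono Cauchy_Schwarz_ineq2) auto
    also have "\<dots> \<le> (norm e * (1 + norm x)) * ((A * (1 + norm x) powr (- (a + 1))) * norm e)"
      using order_trans[OF norm_ge_zero G_le[of x]] by (intro mult_mono G_le order_refl) auto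
    also have "\<dots> = ((norm e)\<^sup>2 * A) * ((1 + norm x) powr 1 * (1 + norm x) powr (- (a + 1)))"
      by (simp add: power2_eq_square)
    also have "(1 + norm x) powr 1 * (1 + norm x) powr (- (a + 1)) = (1 + norm x) powr (- a)"
      by (simp only: powr_add[symmetric]) simp
    finally show "\<bar>(e \<bullet> x) * (G x \<bullet> e)\<bar> \<le> ((norm e)\<^sup>2 * A) * (1 + norm x) powr (- a)" .
  qed
  \<comment> \<open>The primitive \<open>(e \<bullet> x) * \<eta> x\<close> loses one power against
    the integrable \<eta>, which is exactly what the weighted version permits.\<close>
  have parts: "integral\<^sup>L lborel (\<lambda>x. (e \<bullet> x) * (G x \<bullet> e)) = - (norm e)\<^sup>2 * integral\<^sup>L lborel \<eta>"
  proof -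
    have "integral\<^sup>L lborel (\<lambda>x. (e \<bullet> x) * (G x \<bullet> e) + (e \<bullet> e) * \<eta> x) = 0"
    proof (rule integral_directional_derivative_eq_0_weighted[where g="\<lambda>x. norm e * \<bar>\<eta> x\<bar>"
          and f="\<lambda>x. (e \<bullet> x) * \<eta> x" and D="\<lambda>x h. (e \<bullet> x) * (G x \<bullet> h) + (e \<bullet> h) * \<eta> x"])
      show "((\<lambda>x. (e \<bullet> x) * \<eta> x) has_derivative (\<lambda>h. (e \<bullet> x) * (G x \<bullet> h) + (e \<bullet> h) * \<eta> x)) (at x)" for x
        by (rule has_derivative_mult[OF _ deriv_eta]) (auto intro!: derivative_eq_intros)
      show "continuous_on UNIV (\<lambda>x. (e \<bullet> x) * (G x \<bullet> e) + (e \<bullet> e) * \<eta> x)"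
        by (intro continuous_intros)
      fix x
      have "\<bar>(e \<bullet> x) * \<eta> x\<bar> \<le> (norm e * (1 + norm x)) * \<bar>\<eta> x\<bar>"
        unfolding abs_mult using Cauchy_Schwarz_ineq2[of e x] norm_ge_zero[of e]
        by (intro mult_right_mono) (auto simp: distrib_left simp del: norm_ge_zero)
      then show "\<bar>(e \<bullet> x) * \<eta> x\<bar> \<le> (1 + norm x) * (norm e * \<bar>\<eta> x\<bar>)" by (simp add: mult_ac)
    qed (use eta_i xG_i in auto)
    then show ?thesis using eta_i xG_i by (simp add: power2_norm_eq_inner)
  qed
  have "integral\<^sup>L lborel (\<lambda>x. indicator dom x * (norm (V x))\<^sup>2)
      = integral\<^sup>L lborel (\<lambda>x. K (x, \<eta> x) \<bullet> surface_normal x)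
        + 2 * real DIM('a \<times> real) * integral\<^sup>L lborel (\<lambda>y. indicator {y. snd y < 0} y * (cone_weight DIM('a \<times> real) y * h0 y))"
  proof (rule integral_divergence_dom)
    show "continuous_on (closure dom) K"
      unfolding K_def by (intro continuous_intros cont_phi cont_V)
    show "continuous_on (closure dom) (\<lambda>x. K' x h)" for h
      unfolding K'_def by (intro continuous_intros cont_phi cont_V cont_H)
    show "integrable lborel (\<lambda>x. indicator dom x * (norm (V x))\<^sup>2)" by (rule integrable_energy)
    show "integrable lborel (\<lambda>x. K (x, \<eta> x) \<bullet> surface_normal x)"
      unfolding flux using xG_i by simp
    show "h0 \<in> borel_measurable borel" unfolding h0_def by measurable
    show "h0 (r *\<^sub>R y) = h0 y" if "r > 0" for r y
      using that by (simp add: h0_def power2_eq_square)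
    fix x assume x: "x \<in> dom"
    then have xc: "x \<in> closure dom" using closure_subset by blast
    have "(\<phi> has_derivative (\<lambda>h. V x \<bullet> h)) (at x)"
      using deriv_phi[OF x] by (simp add: gderiv_def inner_commute)
    then show "(K has_derivative K' x) (at x)"
      unfolding K_def K'_def
      by (auto intro!: derivative_eq_intros deriv_V[OF x])
    have "(\<Sum>b\<in>Basis. K' x b \<bullet> b) = (\<Sum>b\<in>Basis. (V x \<bullet> b) * (V x \<bullet> b) + (\<phi> x + c \<bullet> x) * (H x b \<bullet> b))"
      by (rule sum.cong) (simp_all add: K'_def inner_add_left inner_diff_left algebra_simps)
    also have "\<dots> = (norm (V x))\<^sup>2"
      by (simp add: sum.distrib harmonic[OF x] power2_norm_eq_inner flip: sum_distrib_left)
        (simp flip: euclidean_inner)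
    finally show "(\<Sum>b\<in>Basis. K' x b \<bullet> b) = (norm (V x))\<^sup>2" .
    have "norm x ^ (n - 2) * \<bar>x \<bullet> K x\<bar> \<le> norm x ^ (n - 2) * (norm x * norm (K x))"
      by (intro mult_left_mono Cauchy_Schwarz_ineq2) simp
    also have "\<dots> = norm x ^ (n - 1) * norm (K x)" by (simp only: mult.assoc[symmetric] power_n_minus)
    also have "norm (K x) \<le> \<bar>\<phi> x\<bar> * norm (V x) + \<bar>\<phi> x\<bar> * norm c + (norm c * norm x) * norm (V x)"
    proof -
      have "norm (K x) \<le> norm (\<phi> x *\<^sub>R V x) + norm (\<phi> x *\<^sub>R c) + norm ((c \<bullet> x) *\<^sub>R V x)"
        unfolding K_def by (intro order_trans[OF norm_triangle_ineq] add_right_mono norm_triangle_ineq4)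
      also have "\<dots> \<le> \<bar>\<phi> x\<bar> * norm (V x) + \<bar>\<phi> x\<bar> * norm c + (norm c * norm x) * norm (V x)"
        using mult_right_mono[OF Cauchy_Schwarz_ineq2[of c x], of "norm (V x)"] by simp
      finally show ?thesis .
    qed
    also have "norm x ^ (n - 1) * (\<bar>\<phi> x\<bar> * norm (V x) + \<bar>\<phi> x\<bar> * norm c + (norm c * norm x) * norm (V x))
        = (\<bar>\<phi> x\<bar> * norm x ^ (n - 1)) * (norm (V x) + norm c) + norm c * (norm (V x) * norm x ^ n)"
      by (simp add: power_n_minus(2)[symmetric] algebra_simps)
    also have "\<dots> \<le> C * (C + norm c) + norm c * C"
      using phi_le_weak[OF xc] V_bound[OF xc] V_le_weak[OF xc, of n] C_nonneg
      by (intro add_mono mult_mono mult_left_mono) auto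
    finally show "norm x ^ (DIM('a \<times> real) - 2) * \<bar>x \<bullet> K x\<bar> \<le> C * (C + norm c) + norm c * C"
      by (simp add: n_def mult_left_mono)
  next
    let ?d\<phi> = "\<lambda>x. norm x ^ (n - 1) * (\<phi> x - p \<bullet> x / norm x ^ n)"
    let ?dV = "\<lambda>x. norm x ^ n * norm (V x - ((1 / norm x ^ n) *\<^sub>R p - (real n * (p \<bullet> x) / norm x ^ (n + 2)) *\<^sub>R x))"
    have "((\<lambda>x. norm x ^ (n - 2) * (x \<bullet> K x) - h0 x) \<longlongrightarrow> 0) (at_infinity_within dom)"
    proof (rule Lim_null_comparison)
      show "\<forall>\<^sub>F x in at_infinity_within dom. norm (norm x ^ (n - 2) * (x \<bullet> K x) - h0 x)
          \<le> (C * C) * inverse (norm x) + norm c * \<bar>?d\<phi> x\<bar> + norm c * ?dV x"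
        using eventually_at_infinity_within_mem[of dom]
      proof eventually_elim
        case (elim x)
        then have xc: "x \<in> closure dom" and x0: "x \<noteq> 0" using closure_subset by auto
        obtain m where "n = 2 + m" using n_ge_2 le_Suc_ex by blast
        then have m: "n = Suc (Suc m)" by simp
        define r where "r = norm x"
        have r: "r > 0" using x0 by (simp add: r_def)
        define W where "W = V x - ((1 / r ^ n) *\<^sub>R p - (real n * (p \<bullet> x) / r ^ (n + 2)) *\<^sub>R x)"
        define w where "w = \<phi> x - p \<bullet> x / r ^ n"
        have xx: "x \<bullet> x = r\<^sup>2" by (simp add: r_def power2_norm_eq_inner)
        \<comment> \<open>Euler's relation: the dipole potential is homogeneous of degree 1 - n.
          \<open>W\<close> is the error of \<open>V\<close> against the dipole field.\<close>
        have xV: "x \<bullet> V x = x \<bullet> W + (1 - real n) * (p \<bullet> x) / r ^ n"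
        proof -
          have "x \<bullet> V x = x \<bullet> (W + ((1 / r ^ n) *\<^sub>R p - (real n * (p \<bullet> x) / r ^ (n + 2)) *\<^sub>R x))"
            by (simp add: W_def)
          also have "\<dots> = x \<bullet> W + (1 / r ^ n * (p \<bullet> x) - real n * (p \<bullet> x) / r ^ (n + 2) * r\<^sup>2)"
            by (simp only: inner_add_right inner_diff_right inner_scaleR_right xx inner_commute[of x p])
          also have "real n * (p \<bullet> x) / r ^ (n + 2) * r\<^sup>2 = real n * (p \<bullet> x) / r ^ n"
            using r by (simp only: power_add) simp
          finally show ?thesis by (simp add: diff_divide_distrib left_diff_distrib)
        qed
        have "r ^ (n - 2) * (x \<bullet> K x) - h0 x
            = r ^ m * (\<phi> x * (x \<bullet> V x)) - r ^ m * (w * (c \<bullet> x)) + r ^ m * ((c \<bullet> x) * (x \<bullet> W))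
              + (r ^ m * ((c \<bullet> x) * ((1 - real n) * (p \<bullet> x) / r ^ n)) - r ^ m * (p \<bullet> x / r ^ n * (c \<bullet> x)) - h0 x)"
        proof -
          have "x \<bullet> K x = \<phi> x * (x \<bullet> V x) - (w + p \<bullet> x / r ^ n) * (c \<bullet> x)
              + (c \<bullet> x) * (x \<bullet> W + (1 - real n) * (p \<bullet> x) / r ^ n)"
            unfolding xV[symmetric]
            by (simp only: K_def inner_add_right inner_diff_right inner_scaleR_right inner_commute[of x c])
              (simp add: w_def)
          moreover have "n - 2 = m" using m by simp
          ultimately show ?thesis by (simp only: xV) (simp add: distrib_left distrib_right left_diff_distrib right_diff_distrib)
        qed
        \<comment> \<open>The pure dipole contributions cancel \<open>h0\<close> exactly: (1 - n) -
          1 = -n, and \<open>r ^ m / r ^ n\<close> is 1 / r^2 because m = n - 2.\<close>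
        also have "r ^ m * ((c \<bullet> x) * ((1 - real n) * (p \<bullet> x) / r ^ n)) - r ^ m * (p \<bullet> x / r ^ n * (c \<bullet> x)) - h0 x = 0"
        proof -
          have "r ^ m / r ^ n = 1 / r\<^sup>2" using r by (simp add: m power2_eq_square)
          moreover have "r ^ m * (z / r ^ n) = z * (r ^ m / r ^ n)" for z by simp
          ultimately have e: "r ^ m * (z / r ^ n) = z / r\<^sup>2" for z by simp
          have A: "r ^ m * ((c \<bullet> x) * ((1 - real n) * (p \<bullet> x) / r ^ n)) = ((c \<bullet> x) * ((1 - real n) * (p \<bullet> x))) / r\<^sup>2"
            using e[of "(c \<bullet> x) * ((1 - real n) * (p \<bullet> x))"] by simp
          have B: "r ^ m * (p \<bullet> x / r ^ n * (c \<bullet> x)) = ((p \<bullet> x) * (c \<bullet> x)) / r\<^sup>2"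
            using e[of "(p \<bullet> x) * (c \<bullet> x)"] by simp
          show ?thesis
            unfolding A B h0_def r_def[symmetric] using r by (simp add: field_simps)
        qed
        finally have eq: "r ^ (n - 2) * (x \<bullet> K x) - h0 x
            = r ^ m * (\<phi> x * (x \<bullet> V x)) - r ^ m * (w * (c \<bullet> x)) + r ^ m * ((c \<bullet> x) * (x \<bullet> W))" by simp
        have t1: "\<bar>r ^ m * (\<phi> x * (x \<bullet> V x))\<bar> \<le> (C * C) * inverse r"
        proof -
          have "\<bar>r ^ m * (\<phi> x * (x \<bullet> V x))\<bar> \<le> r ^ m * (\<bar>\<phi> x\<bar> * (r * norm (V x)))"
            unfolding abs_mult r_def using Cauchy_Schwarz_ineq2[of x "V x"]
            by (intro mult_mono) auto
          also have "\<dots> = (\<bar>\<phi> x\<bar> * r ^ (n - 1)) * (norm (V x) * r ^ 1) * inverse r"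
            using r by (simp add: m)
          also have "\<dots> \<le> (C * C) * inverse r"
            using phi_le_weak[OF xc] V_le_weak[OF xc, of 1] n_ge_2 r C_nonneg
            by (intro mult_right_mono mult_mono) (auto simp: r_def)
          finally show ?thesis .
        qed
        have t2: "\<bar>r ^ m * (w * (c \<bullet> x))\<bar> \<le> norm c * \<bar>r ^ (n - 1) * w\<bar>"
        proof -
          have "\<bar>r ^ m * (w * (c \<bullet> x))\<bar> \<le> r ^ m * (\<bar>w\<bar> * (norm c * r))"
            unfolding abs_mult r_def using Cauchy_Schwarz_ineq2[of c x]
            by (intro mult_mono) auto
          also have "\<dots> = norm c * \<bar>r ^ (n - 1) * w\<bar>" using r by (simp add: m abs_mult)
          finally show ?thesis .
        qed
        have t3: "\<bar>r ^ m * ((c \<bullet> x) * (x \<bullet> W))\<bar> \<le> norm c * (r ^ n * norm W)"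
        proof -
          have "\<bar>r ^ m * ((c \<bullet> x) * (x \<bullet> W))\<bar> \<le> r ^ m * ((norm c * r) * (r * norm W))"
            unfolding abs_mult r_def using Cauchy_Schwarz_ineq2[of c x] Cauchy_Schwarz_ineq2[of x W]
            by (intro mult_mono) auto
          also have "\<dots> = norm c * (r ^ n * norm W)" by (simp add: m)
          finally show ?thesis .
        qed
        have "\<bar>r ^ (n - 2) * (x \<bullet> K x) - h0 x\<bar>
            \<le> (C * C) * inverse r + norm c * \<bar>r ^ (n - 1) * w\<bar> + norm c * (r ^ n * norm W)"
          unfolding eq using t1 t2 t3 by linarith
        then show ?case by (simp only: real_norm_def r_def w_def W_def)
      qed
      have "((\<lambda>x. (C * C) * inverse (norm x) + norm c * \<bar>?d\<phi> x\<bar> + norm c * ?dV x) \<longlongrightarrow> 0 + norm c * \<bar>0\<bar> + norm c * 0)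
          (at_infinity_within dom)"
        by (intro tendsto_add tendsto_mult tendsto_const tendsto_rabs phi_asymp V_asymp
            tendsto_inverse_norm_at_infinity_within)
      then show "((\<lambda>x. (C * C) * inverse (norm x) + norm c * \<bar>?d\<phi> x\<bar> + norm c * ?dV x) \<longlongrightarrow> 0)
          (at_infinity_within dom)" by simp
    qed
    then show "((\<lambda>x. norm x ^ (DIM('a \<times> real) - 2) * (x \<bullet> K x) - h0 x) \<longlongrightarrow> 0) (at_infinity_within dom)"
      by (simp add: n_def)
  qed
  also have "integral\<^sup>L lborel (\<lambda>x. K (x, \<eta> x) \<bullet> surface_normal x) = (norm e)\<^sup>2 * integral\<^sup>L lborel \<eta>"
    unfolding flux using parts by simp
  also have "integral\<^sup>L lborel (\<lambda>y. indicator {y. snd y < 0} y * (cone_weight DIM('a \<times> real) y * h0 y))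
      = - real n * (integral\<^sup>L lborel (\<lambda>y::'a \<times> real. cone_weight n y * ((p \<bullet> y) * (c \<bullet> y) / (norm y)\<^sup>2)) / 2)"
  proof -
    have i: "integrable lborel (\<lambda>y::'a \<times> real. cone_weight n y * ((p \<bullet> y) * (c \<bullet> y) / (norm y)\<^sup>2))"
      unfolding n_def by (rule integral_cone_weight_quadratic(2))
    have "integral\<^sup>L lborel (\<lambda>y::'a \<times> real. indicator {y. snd y < 0} y * (cone_weight n y * ((p \<bullet> y) * (c \<bullet> y) / (norm y)\<^sup>2)))
        = integral\<^sup>L lborel (\<lambda>y::'a \<times> real. cone_weight n y * ((p \<bullet> y) * (c \<bullet> y) / (norm y)\<^sup>2)) / 2"
      by (rule integral_half_space_even[OF i]) (simp add: cone_weight_def)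
    moreover have "(\<lambda>y. indicator {y. snd y < 0} y * (cone_weight DIM('a \<times> real) y * h0 y))
        = (\<lambda>y. - real n * (indicator {y. snd y < 0} y * (cone_weight n y * ((p \<bullet> y) * (c \<bullet> y) / (norm y)\<^sup>2))))"
      by (simp only: n_def[symmetric] h0_def) (simp add: mult_ac)
    ultimately show ?thesis by (simp only: integral_mult_right_zero)
  qed
  also have "integral\<^sup>L lborel (\<lambda>y::'a \<times> real. cone_weight n y * ((p \<bullet> y) * (c \<bullet> y) / (norm y)\<^sup>2))
      = (p \<bullet> c) / real n * (unit_ball_vol (real n) / 2)"
    unfolding n_def integral_cone_weight_quadratic(1) integral_cone_weight ..
  also have "(norm e)\<^sup>2 * integral\<^sup>L lborel \<eta>
      + 2 * real DIM('a \<times> real) * (- real n * ((p \<bullet> c) / real n * (unit_ball_vol (real n) / 2) / 2))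
      = (norm c)\<^sup>2 * integral\<^sup>L lborel \<eta> - real n * unit_ball_vol (real n) / 2 * (c \<bullet> p)"
    using n_ge_2 by (simp only: n_def[symmetric]) (simp add: ce inner_commute field_simps)
  finally show ?thesis .
qed

text \<open>Conservation of vertical momentum, from the divergence-free field \<open>Z\<close>.\<close>

theorem mean_elevation_eq_0:
  fixes \<kappa> :: "'a \<Rightarrow> real"
  assumes dynamic: "\<And>x. 1/2 * (norm (V (x, \<eta> x)))\<^sup>2 - c \<bullet> V (x, \<eta> x) + g * \<eta> x = \<sigma> * \<kappa> x"
    and g: "g \<noteq> 0" and eta_i: "integrable lborel \<eta>"
    and kappa: "integrable lborel \<kappa>" "integral\<^sup>L lborel \<kappa> = 0"
  shows "integral\<^sup>L lborel \<eta> = 0"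
proof -
  define e where "e = (0::'a, 1::real)"
  have e: "e \<bullet> e = 1" "norm e = 1" "c \<bullet> e = 0" "e \<bullet> surface_normal x = 1" for x
    using c_horizontal by (simp_all add: e_def inner_prod_def surface_normal_def)
  define Z where "Z = (\<lambda>x. (c \<bullet> V x) *\<^sub>R e - (V x \<bullet> e) *\<^sub>R c - (1/2 * (V x \<bullet> V x)) *\<^sub>R e + (V x \<bullet> e) *\<^sub>R V x)"
  define Z' where "Z' = (\<lambda>x h. (c \<bullet> H x h) *\<^sub>R e - (H x h \<bullet> e) *\<^sub>R c - (V x \<bullet> H x h) *\<^sub>R e
      + ((V x \<bullet> e) *\<^sub>R H x h + (H x h \<bullet> e) *\<^sub>R V x))"
  \<comment> \<open>The kinematic condition cancels the two terms carrying
    \<open>V x \<bullet> e\<close>; as the vertical component of the unnormalized normal is 1, what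
    remains is c . V - |V|^2 / 2.\<close>
  have flux: "Z (x, \<eta> x) \<bullet> surface_normal x = g * \<eta> x - \<sigma> * \<kappa> x" for x
    using kinematic[of x] dynamic[of x]
    by (simp add: Z_def inner_add_left inner_diff_left e power2_norm_eq_inner)
  \<comment> \<open>\<open>Z\<close> is linear plus quadratic in the bounded field \<open>V\<close>,
    hence of order |V| = O(|x|^(-n)). The right side is therefore O(1/|x|), and the flux through
    infinity has limit 0.\<close>
  have Z_le: "norm x ^ (n - 2) * \<bar>x \<bullet> Z x\<bar> \<le> (2 * norm c + 2 * C) * (norm (V x) * norm x ^ (n - 1))"
    if "x \<in> dom" for x
  proof -
    have xc: "x \<in> closure dom" using that closure_subset by blast
    have Ve: "\<bar>V x \<bullet> e\<bar> \<le> norm (V x)" using Cauchy_Schwarz_ineq2[of "V x" e] by (simp add: e)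
    have "norm (Z x) \<le> norm ((c \<bullet> V x) *\<^sub>R e) + norm ((V x \<bullet> e) *\<^sub>R c) + norm ((1/2 * (V x \<bullet> V x)) *\<^sub>R e) + norm ((V x \<bullet> e) *\<^sub>R V x)"
      unfolding Z_def
      by (intro order_trans[OF norm_triangle_ineq] add_right_mono order_trans[OF norm_triangle_ineq4] norm_triangle_ineq4)
    also have "\<dots> \<le> norm c * norm (V x) + norm (V x) * norm c + 1/2 * (norm (V x) * norm (V x)) + norm (V x) * norm (V x)"
      using Cauchy_Schwarz_ineq2[of c "V x"] Ve mult_right_mono[OF Ve norm_ge_zero[of c]] mult_right_mono[OF Ve norm_ge_zero[of "V x"]]
      by (simp add: e abs_mult power2_eq_square[symmetric] power2_norm_eq_inner[symmetric]
          mult.commute[of "norm c" "norm (V x)"])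
    also have "\<dots> = (2 * norm c + 3/2 * norm (V x)) * norm (V x)" by (simp add: algebra_simps)
    also have "\<dots> \<le> (2 * norm c + 2 * C) * norm (V x)"
      using V_bound[OF xc] C_nonneg by (intro mult_right_mono) auto
    finally have nZ: "norm (Z x) \<le> (2 * norm c + 2 * C) * norm (V x)" .
    have "norm x ^ (n - 2) * \<bar>x \<bullet> Z x\<bar> \<le> norm x ^ (n - 2) * (norm x * norm (Z x))"
      by (intro mult_left_mono Cauchy_Schwarz_ineq2) simp
    also have "\<dots> = norm x ^ (n - 1) * norm (Z x)" by (simp only: mult.assoc[symmetric] power_n_minus)
    also have "\<dots> \<le> norm x ^ (n - 1) * ((2 * norm c + 2 * C) * norm (V x))"
      by (intro mult_left_mono nZ) simp
    finally show ?thesis by (simp add: mult_ac)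
  qed
  have "integral\<^sup>L lborel (\<lambda>x. indicator dom x * (0::real))
      = integral\<^sup>L lborel (\<lambda>x. Z (x, \<eta> x) \<bullet> surface_normal x)
        + 2 * real DIM('a \<times> real) * integral\<^sup>L lborel (\<lambda>y::'a \<times> real. indicator {y. snd y < 0} y * (cone_weight DIM('a \<times> real) y * 0))"
  proof (rule integral_divergence_dom[where F=Z and F'=Z' and L="\<lambda>y. 0" and d="\<lambda>x. 0"
        and B="(2 * norm c + 2 * C) * C"])
    show "continuous_on (closure dom) Z"
      unfolding Z_def by (intro continuous_intros cont_V)
    show "continuous_on (closure dom) (\<lambda>x. Z' x h)" for h
      unfolding Z'_def by (intro continuous_intros cont_V cont_H)
    show "integrable lborel (\<lambda>x. Z (x, \<eta> x) \<bullet> surface_normal x)"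
      unfolding flux using eta_i kappa(1) by simp
    fix x assume x: "x \<in> dom"
    then have xc: "x \<in> closure dom" using closure_subset by blast
    show "(Z has_derivative Z' x) (at x)"
      unfolding Z_def Z'_def
      by (auto intro!: derivative_eq_intros deriv_V[OF x] simp: inner_commute)
    have lin: "linear (H x)" using deriv_V[OF x] has_derivative_linear by blast
    have sym: "H x u \<bullet> v = H x v \<bullet> u" for u v
      by (rule hessian_symmetric[OF open_dom x deriv_phi deriv_V[OF x]])
    have "Z' x b \<bullet> b = (H x b \<bullet> c) * (e \<bullet> b) - (H x b \<bullet> e) * (c \<bullet> b) - (H x b \<bullet> V x) * (e \<bullet> b)
        + (V x \<bullet> e) * (H x b \<bullet> b) + (H x b \<bullet> e) * (V x \<bullet> b)" for b
      by (simp add: Z'_def inner_add_left inner_diff_left inner_commute[of c "H x b"] inner_commute[of "V x" "H x b"])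
    then have "(\<Sum>b\<in>Basis. Z' x b \<bullet> b)
        = (\<Sum>b\<in>Basis. (H x b \<bullet> c) * (e \<bullet> b)) - (\<Sum>b\<in>Basis. (H x b \<bullet> e) * (c \<bullet> b))
          - (\<Sum>b\<in>Basis. (H x b \<bullet> V x) * (e \<bullet> b)) + (V x \<bullet> e) * (\<Sum>b\<in>Basis. H x b \<bullet> b)
          + (\<Sum>b\<in>Basis. (H x b \<bullet> e) * (V x \<bullet> b))"
      by (simp add: sum.distrib sum_subtractf sum_distrib_left)
    \<comment> \<open>By symmetry of the Hessian the first two sums cancel, and so do the third and
      the last; the remaining one is the Laplacian of the potential.\<close>
    also have "\<dots> = 0"
      by (simp add: sum_Basis_inner_linear[OF lin] harmonic[OF x] sym[of e])
    finally show "(\<Sum>b\<in>Basis. Z' x b \<bullet> b) = 0" .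
    have "(2 * norm c + 2 * C) * (norm (V x) * norm x ^ (n - 1)) \<le> (2 * norm c + 2 * C) * C"
      using V_le_weak[OF xc, of "n - 1"] C_nonneg by (intro mult_left_mono) auto
    then show "norm x ^ (DIM('a \<times> real) - 2) * \<bar>x \<bullet> Z x\<bar> \<le> (2 * norm c + 2 * C) * C"
      using Z_le[OF x] unfolding n_def[symmetric] by linarith
  next
    show "((\<lambda>x. norm x ^ (DIM('a \<times> real) - 2) * (x \<bullet> Z x) - 0) \<longlongrightarrow> 0) (at_infinity_within dom)"
      unfolding n_def[symmetric]
    proof (rule Lim_null_comparison)
      show "\<forall>\<^sub>F x in at_infinity_within dom. norm (norm x ^ (n - 2) * (x \<bullet> Z x) - 0)
          \<le> ((2 * norm c + 2 * C) * C) * inverse (norm x)"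
        using eventually_at_infinity_within_mem[of dom]
      proof eventually_elim
        case (elim x)
        then have xc: "x \<in> closure dom" and x0: "norm x > 0" using closure_subset by auto
        have "norm (V x) * norm x ^ (n - 1) \<le> C * inverse (norm x)"
          using V_le_weak[OF xc, of n] x0 by (simp add: power_n_minus(2)[symmetric] field_simps)
        then have "(2 * norm c + 2 * C) * (norm (V x) * norm x ^ (n - 1)) \<le> (2 * norm c + 2 * C) * (C * inverse (norm x))"
          using C_nonneg by (intro mult_left_mono) auto
        then show ?case using Z_le[of x] elim by (simp add: abs_mult mult.assoc)
      qed
    qed (rule tendsto_inverse_norm_at_infinity_within)
  qed simp_all
  then have "integral\<^sup>L lborel (\<lambda>x. g * \<eta> x - \<sigma> * \<kappa> x) = 0"
    by (simp add: flux)
  then show ?thesis using eta_i kappa g by simp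
qed

end

section \<open>Gradients, far-field expansions and the normal\<close>

lemma gradient_eq:
  assumes "GDERIV f x :> D"
  shows "gradient f x = D"
  unfolding gradient_def
proof (rule the_equality)
  fix E assume "GDERIV f x :> E"
  then have "(\<lambda>h. h \<bullet> E) = (\<lambda>h. h \<bullet> D)"
    using assms unfolding gderiv_def by (rule has_derivative_unique)
  then have "(E - D) \<bullet> E = (E - D) \<bullet> D" by meson
  then have "(E - D) \<bullet> (E - D) = 0" by (simp add: inner_diff_right)
  then show "E = D" by simp
qed (rule assms)

lemma gradient_inner_Basis:
  fixes f :: "'a::euclidean_space \<Rightarrow> real"
  assumes f: "(f has_derivative l) (at x)" and b: "b \<in> Basis"
  shows "gradient f x \<bullet> b = l b"
proof -
  have lin: "linear l" using f has_derivative_linear by blast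
  have "l h = h \<bullet> (\<Sum>b\<in>Basis. l b *\<^sub>R b)" for h
  proof -
    have "l h = l (\<Sum>b\<in>Basis. (h \<bullet> b) *\<^sub>R b)" by (simp add: euclidean_representation)
    also have "\<dots> = h \<bullet> (\<Sum>b\<in>Basis. l b *\<^sub>R b)"
      by (simp add: linear_sum[OF lin] linear_scale[OF lin] inner_sum_right mult.commute)
    finally show ?thesis .
  qed
  then have "l = (\<lambda>h. h \<bullet> (\<Sum>b\<in>Basis. l b *\<^sub>R b))" by blast
  then have "GDERIV f x :> (\<Sum>b\<in>Basis. l b *\<^sub>R b)"
    using f unfolding gderiv_def by argo
  then have "gradient f x = (\<Sum>b\<in>Basis. l b *\<^sub>R b)" by (rule gradient_eq)
  then show ?thesis using b by simp
qed

text \<open>The boundary gradient is defined through \<open>Lim\<close>, so uniqueness of limits is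
  what identifies it with the continuous extension. A point of the closure outside \<open>U\<close>
  is a limit point of \<open>U\<close>, hence the filter is nontrivial.\<close>

lemma gradient_closure_eq:
  fixes f :: "'a::euclidean_space \<Rightarrow> real"
  assumes deriv: "\<And>x. x \<in> U \<Longrightarrow> GDERIV f x :> V x"
    and cont: "continuous_on (closure U) V" and x: "x \<in> closure U"
  shows "gradient_closure U f x = V x"
proof (cases "x \<in> U")
  case True
  then show ?thesis by (simp add: gradient_closure_def gradient_eq[OF deriv])
next
  case False
  have "(V \<longlongrightarrow> V x) (at x within closure U)"
    using cont x by (simp add: continuous_on_def)
  then have "(V \<longlongrightarrow> V x) (at x within U)"
    by (rule tendsto_within_subset) (rule closure_subset)
  moreover have "\<forall>\<^sub>F y in at x within U. V y = gradient f y"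
    unfolding eventually_at_filter by (rule always_eventually) (simp add: gradient_eq[OF deriv])
  ultimately have "(gradient f \<longlongrightarrow> V x) (at x within U)"
    by (rule Lim_transform_eventually)
  moreover have "at x within U \<noteq> bot"
    using x False by (simp add: closure_def trivial_limit_within)
  ultimately show ?thesis
    using False by (simp add: gradient_closure_def tendsto_Lim)
qed

lemma divergence_eq:
  assumes "(F has_derivative F') (at x)"
  shows "divergence F x = (\<Sum>b\<in>Basis. F' b \<bullet> b)"
  using frechet_derivative_at[OF assms] by (simp add: divergence_def)

lemma gradient_dipole:
  fixes p x :: "'a::euclidean_space"
  assumes n: "n \<ge> 2" and x: "x \<noteq> 0"
  shows "gradient (\<lambda>y. p \<bullet> y / norm y ^ n) x = (1 / norm x ^ n) *\<^sub>R p - (real n * (p \<bullet> x) / norm x ^ (n + 2)) *\<^sub>R x"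
proof (rule gradient_eq)
  define r where "r = norm x"
  have r: "r > 0" using x by (simp add: r_def)
  obtain m where "n = 2 + m" using n le_Suc_ex by blast
  then have m: "n = Suc (Suc m)" by simp
  have "((\<lambda>y. p \<bullet> y / norm y ^ n) has_derivative
      (\<lambda>h. - (p \<bullet> x) * (inverse (r ^ n) * (real n * r ^ (n - 2) * (x \<bullet> h)) * inverse (r ^ n)) + (p \<bullet> h) / r ^ n)) (at x)"
    unfolding r_def
    by (rule has_derivative_divide[OF _ has_derivative_norm_power[OF n]])
      (use x in \<open>auto intro!: derivative_eq_intros\<close>)
  moreover have "(\<lambda>h. - (p \<bullet> x) * (inverse (r ^ n) * (real n * r ^ (n - 2) * (x \<bullet> h)) * inverse (r ^ n)) + (p \<bullet> h) / r ^ n)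
      = (\<lambda>h. h \<bullet> ((1 / r ^ n) *\<^sub>R p - (real n * (p \<bullet> x) / r ^ (n + 2)) *\<^sub>R x))"
  proof
    fix h
    have "inverse (r ^ n) * r ^ (n - 2) * inverse (r ^ n) = 1 / r ^ (n + 2)"
      using r by (simp add: m field_simps power_add)
    moreover have "(p \<bullet> x) * (a * (real n * b * (x \<bullet> h)) * a) = real n * (p \<bullet> x) * (x \<bullet> h) * (a * b * a)"
      for a b :: real by (simp only: mult_ac)
    ultimately have "(p \<bullet> x) * (inverse (r ^ n) * (real n * r ^ (n - 2) * (x \<bullet> h)) * inverse (r ^ n))
        = real n * (p \<bullet> x) * (x \<bullet> h) * (1 / r ^ (n + 2))"
      by (simp only:)
    then show "- (p \<bullet> x) * (inverse (r ^ n) * (real n * r ^ (n - 2) * (x \<bullet> h)) * inverse (r ^ n)) + (p \<bullet> h) / r ^ n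
        = h \<bullet> ((1 / r ^ n) *\<^sub>R p - (real n * (p \<bullet> x) / r ^ (n + 2)) *\<^sub>R x)"
      by (simp add: inner_diff_right inner_commute)
  qed
  ultimately show "GDERIV (\<lambda>y. p \<bullet> y / norm y ^ n) x :>
      (1 / norm x ^ n) *\<^sub>R p - (real n * (p \<bullet> x) / norm x ^ (n + 2)) *\<^sub>R x"
    unfolding gderiv_def r_def by (simp only:)
qed

section \<open>Decay bounds from asymptotic expansions, and the divergence of the normal\<close>

lemma at_infinity_within_UNIV: "at_infinity_within UNIV = at_infinity"
  by (simp add: at_infinity_within_def)

lemma at_infinity_within_mono: "S \<subseteq> T \<Longrightarrow> at_infinity_within S \<le> at_infinity_within T"
  unfolding at_infinity_within_def by (intro inf_mono) auto

lemma eventually_at_infinity_within_norm_ge: "\<forall>\<^sub>F x in at_infinity_within S. norm x \<ge> b"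
  using filterlim_norm_at_infinity_within unfolding filterlim_at_top by blast

lemma bigo_inverse_powrE:
  fixes f :: "'a::real_normed_vector \<Rightarrow> real"
  assumes "f \<in> O[F](\<lambda>x. 1 / norm x powr a)"
  obtains c where "\<forall>\<^sub>F x in F. \<bar>f x\<bar> \<le> c * norm x powr (- a)"
proof -
  obtain c where "\<forall>\<^sub>F x in F. norm (f x) \<le> c * norm (1 / norm x powr a)"
    using assms by (rule landau_o.bigE)
  then have "\<forall>\<^sub>F x in F. \<bar>f x\<bar> \<le> c * norm x powr (- a)"
    by eventually_elim (simp add: powr_minus_divide)
  then show thesis by (rule that)
qed

lemma bigo_decay_bound:
  fixes f :: "'a::euclidean_space \<Rightarrow> real"
  assumes "f \<in> O[at_infinity](\<lambda>x. 1 / norm x powr a)" and "continuous_on UNIV f" and "a \<ge> 0"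
  obtains C where "C \<ge> 0" "\<And>x. \<bar>f x\<bar> \<le> C * (1 + norm x) powr (- a)"
proof -
  obtain c where "\<forall>\<^sub>F x in at_infinity. \<bar>f x\<bar> \<le> c * norm x powr (- a)"
    using assms(1) by (rule bigo_inverse_powrE)
  then have "\<forall>\<^sub>F x in at_infinity_within UNIV. norm (f x) \<le> c * norm x powr (- a)"
    by (simp add: at_infinity_within_UNIV)
  from decay_bound[OF closed_UNIV assms(2,3) this] that show thesis
    by (metis UNIV_I real_norm_def)
qed

lemma vec_bigo_decay_bound:
  fixes F :: "'a::euclidean_space \<Rightarrow> real ^ 'm"
  assumes O: "\<And>i. (\<lambda>x. F x $ i) \<in> O[at_infinity](\<lambda>x. 1 / norm x powr a)"
    and cont: "continuous_on UNIV F" and a: "a \<ge> 0"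
  obtains C where "C \<ge> 0" "\<And>x. norm (F x) \<le> C * (1 + norm x) powr (- a)"
proof -
  have "\<exists>C\<ge>0. \<forall>x. \<bar>F x $ i\<bar> \<le> C * (1 + norm x) powr (- a)" for i
    by (rule bigo_decay_bound[OF O _ a, of i]) (use cont in \<open>auto intro!: continuous_intros\<close>)
  then obtain C where C: "\<And>i. C i \<ge> 0" "\<And>i x. \<bar>F x $ i\<bar> \<le> C i * (1 + norm x) powr (- a)"
    by metis
  show thesis
  proof
    show "sum C UNIV \<ge> 0" using C(1) by (simp add: sum_nonneg)
    fix x
    have "norm (F x) \<le> (\<Sum>i\<in>UNIV. \<bar>F x $ i\<bar>)" by (rule norm_le_l1_cart)
    also have "\<dots> \<le> (\<Sum>i\<in>UNIV. C i * (1 + norm x) powr (- a))" by (intro sum_mono C(2))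
    finally show "norm (F x) \<le> sum C UNIV * (1 + norm x) powr (- a)" by (simp add: sum_distrib_right)
  qed
qed

lemma weighted_decay_tendsto_0:
  fixes f :: "'a::real_normed_vector \<Rightarrow> real"
  assumes ev: "\<forall>\<^sub>F x in at_infinity_within S. \<bar>f x\<bar> \<le> c * norm x powr (- (real k + \<epsilon>))" and eps: "\<epsilon> > 0"
  shows "((\<lambda>x. norm x ^ k * f x) \<longlongrightarrow> 0) (at_infinity_within S)"
proof (rule Lim_null_comparison)
  show "\<forall>\<^sub>F x in at_infinity_within S. norm (norm x ^ k * f x) \<le> c * norm x powr (- \<epsilon>)"
    using ev eventually_at_infinity_within_mem
  proof eventually_elim
    case (elim x)
    then have pos: "norm x > 0" by simp
    have "norm (norm x ^ k * f x) \<le> norm x ^ k * (c * norm x powr (- (real k + \<epsilon>)))"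
      using elim by (simp add: abs_mult mult_left_mono)
    also have "\<dots> = c * (norm x powr real k * norm x powr (- (real k + \<epsilon>)))"
      using pos by (simp add: powr_realpow)
    also have "\<dots> = c * norm x powr (- \<epsilon>)" by (simp only: powr_add[symmetric]) simp
    finally show ?case .
  qed
  have "((\<lambda>x. norm x powr (- \<epsilon>)) \<longlongrightarrow> 0) (at_infinity_within S)"
    by (rule tendsto_neg_powr[OF _ filterlim_norm_at_infinity_within]) (use eps in simp)
  then show "((\<lambda>x. c * norm x powr (- \<epsilon>)) \<longlongrightarrow> 0) (at_infinity_within S)"
    by (rule tendsto_mult_right_zero)
qed

text \<open>The error beats the leading term \<open>g\<close> by a factor |x|^(-\<epsilon>), so
  \<open>f\<close> inherits the rate of \<open>g\<close>. This turns the dipole expansion into the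
  uniform bounds on the potential and its gradient.\<close>

lemma decay_bound_power:
  fixes f g :: "'a::euclidean_space \<Rightarrow> 'b::real_normed_vector"
  assumes S: "closed S" and cont: "continuous_on S f" and eps: "\<epsilon> > 0"
    and ev: "\<forall>\<^sub>F x in at_infinity_within S. norm (f x - g x) \<le> c * norm x powr (- (real k + \<epsilon>))"
    and g: "\<forall>\<^sub>F x in at_infinity_within S. norm (g x) \<le> B / norm x ^ k"
  obtains C where "\<And>x. x \<in> S \<Longrightarrow> norm (f x) * (1 + norm x) ^ k \<le> C"
proof -
  have "\<forall>\<^sub>F x in at_infinity_within S. norm (f x) \<le> (\<bar>c\<bar> + B) * norm x powr (- real k)"
    using ev g eventually_at_infinity_within_norm_ge[of 1]
  proof eventually_elim
    case (elim x)
    have "c * norm x powr (- (real k + \<epsilon>)) \<le> \<bar>c\<bar> * norm x powr (- real k)"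
      using elim eps by (intro mult_mono powr_mono) auto
    moreover have "B / norm x ^ k = B * norm x powr (- real k)"
    proof -
      have "norm x > 0" using elim(3) by linarith
      then show ?thesis by (simp only: powr_minus_divide powr_realpow) simp
    qed
    ultimately have "norm (f x - g x) + norm (g x) \<le> (\<bar>c\<bar> + B) * norm x powr (- real k)"
      using elim by (simp add: distrib_right)
    then show ?case using norm_triangle_sub[of "f x" "g x"] by linarith
  qed
  then obtain C where C: "\<And>x. x \<in> S \<Longrightarrow> norm (f x) \<le> C * (1 + norm x) powr (- real k)"
    using decay_bound[OF S cont of_nat_0_le_iff] by blast
  have "norm (f x) * (1 + norm x) ^ k \<le> C" if "x \<in> S" for x
  proof -
    have pos: "1 + norm x > 0" using norm_ge_zero[of x] by linarith
    have "norm (f x) * (1 + norm x) ^ k \<le> C * (1 + norm x) powr (- real k) * (1 + norm x) ^ k"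
      using C[OF that] pos by (intro mult_right_mono) auto
    also have "\<dots> = C" using pos by (simp add: powr_minus powr_realpow)
    finally show ?thesis .
  qed
  then show thesis by (rule that)
qed

lemma sum_Basis_prod:
  fixes f :: "'a::euclidean_space \<times> 'b::euclidean_space \<Rightarrow> 'c::comm_monoid_add"
  shows "sum f Basis = (\<Sum>i\<in>Basis. f (i, 0)) + (\<Sum>i\<in>Basis. f (0, i))"
proof -
  have "inj_on (\<lambda>u. (u::'a, 0::'b)) Basis" "inj_on (\<lambda>u. (0::'a, u::'b)) Basis"
    by (auto intro!: inj_onI)
  moreover have "(\<lambda>u. (u::'a, 0::'b)) ` Basis \<inter> (\<lambda>v. (0, v)) ` Basis = {}"
    by auto
  ultimately show ?thesis
    unfolding Basis_prod_def by (simp add: sum.union_disjoint sum.reindex)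
qed

text \<open>The normal field is constant along vertical lines, so its vertical component contributes
  the derivative in a direction with zero horizontal part, that is \<open>Q' 0\<close>, which is
  0.\<close>

lemma divergence_upward_normal:
  fixes \<eta> :: "real ^ 'm \<Rightarrow> real"
  assumes P: "((\<lambda>x. (1 / sqrt (1 + (norm (gradient \<eta> x))\<^sup>2)) *\<^sub>R gradient \<eta> x) has_derivative P') (at (fst x))"
    and G: "(gradient \<eta> has_derivative G') (at (fst x))"
  shows "divergence (\<lambda>x. upward_normal \<eta> (fst x)) x = - (\<Sum>b\<in>Basis. P' b \<bullet> b)"
proof -
  define Q' where "Q' = (\<lambda>h. - (gradient \<eta> (fst x) \<bullet> G' h) / sqrt (1 + (norm (gradient \<eta> (fst x)))\<^sup>2) ^ 3)"
  have fst': "(fst has_derivative fst) (at x)" by (rule has_derivative_fst[OF has_derivative_ident])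
  have "((\<lambda>x. 1 / sqrt (1 + (norm (gradient \<eta> x))\<^sup>2)) has_derivative Q') (at (fst x))"
    unfolding Q'_def by (rule has_derivative_inverse_arc_length[OF G])
  from has_derivative_Pair[OF has_derivative_minus[OF has_derivative_compose[OF fst' P]] has_derivative_compose[OF fst' this]]
  have "((\<lambda>x. upward_normal \<eta> (fst x)) has_derivative (\<lambda>h. (- P' (fst h), Q' (fst h)))) (at x)"
    unfolding upward_normal_def by simp
  then have "divergence (\<lambda>x. upward_normal \<eta> (fst x)) x = (\<Sum>b\<in>Basis. (- P' (fst b), Q' (fst b)) \<bullet> b)"
    by (rule divergence_eq)
  also have "\<dots> = (\<Sum>b\<in>Basis. - (P' b \<bullet> b)) + Q' 0"
    by (subst sum_Basis_prod) simp
  also have "Q' 0 = 0"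
    using linear_0[OF has_derivative_linear[OF G]] by (simp add: Q'_def)
  finally show ?thesis by (simp add: sum_negf)
qed

section \<open>The energy identity for the solitary wave\<close>

theorem theorem2:
  fixes n :: nat
    and g \<sigma> \<epsilon> :: real
    and c p :: "(real ^ 'm) \<times> real"
    and \<eta> :: "real ^ 'm \<Rightarrow> real"
    and \<phi> :: "(real ^ 'm) \<times> real \<Rightarrow> real"
    and \<Omega> S :: "((real ^ 'm) \<times> real) set"
    and N :: "(real ^ 'm) \<times> real \<Rightarrow> (real ^ 'm) \<times> real"
  assumes dim: "n \<in> {2, 3}" "CARD('m) = n - 1"
    and g_pos: "g > 0" and sigma_nonneg: "\<sigma> \<ge> 0"
    and c_horizontal: "snd c = 0" and c_nonzero: "c \<noteq> 0"
    and eta_C2: "C2_closure UNIV \<eta>"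
    and Omega_eq: "\<Omega> = {x. snd x < \<eta> (fst x)}"
    and S_eq: "S = {x. snd x = \<eta> (fst x)}"
    and N_eq: "N = (\<lambda>x. upward_normal \<eta> (fst x))"
    and phi_C2: "C2_closure \<Omega> \<phi>"
    and harmonic: "\<And>x. x \<in> \<Omega> \<Longrightarrow> laplacian \<phi> x = 0"
    and kinematic: "\<And>x. x \<in> S \<Longrightarrow> gradient_closure \<Omega> \<phi> x \<bullet> N x = c \<bullet> N x"
    and dynamic: "\<And>x. x \<in> S \<Longrightarrow>
          1/2 * (norm (gradient_closure \<Omega> \<phi> x))\<^sup>2 - c \<bullet> gradient_closure \<Omega> \<phi> x + g * \<eta> (fst x)
            = - \<sigma> * divergence N x"
    and eta_lim: "(\<eta> \<longlongrightarrow> 0) at_infinity"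
    and phi_lim: "(\<phi> \<longlongrightarrow> 0) (at_infinity_within (closure \<Omega>))"
    and grad_phi_lim: "(gradient_closure \<Omega> \<phi> \<longlongrightarrow> 0) (at_infinity_within (closure \<Omega>))"
    and eps: "0 < \<epsilon>" "\<epsilon> < 1"
    and phi_decay: "\<phi> \<in> o[at_infinity_within (closure \<Omega>)](\<lambda>x. 1 / norm x ^ (n - 2))"
    and eta_decay: "\<eta> \<in> O[at_infinity](\<lambda>x'. 1 / norm x' powr (real n - 1 + \<epsilon>))"
    and d_eta_decay: "\<And>i. (\<lambda>x'. gradient \<eta> x' $ i)
          \<in> O[at_infinity](\<lambda>x'. 1 / norm x' powr (real n + \<epsilon>))"
    and dd_eta_decay: "\<And>i j. (\<lambda>x'. gradient (\<lambda>y'. gradient \<eta> y' $ j) x' $ i)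
          \<in> O[at_infinity](\<lambda>x'. 1 / norm x' powr (real n + 1 + \<epsilon>))"
    and dipole: "is_dipole_moment n \<epsilon> \<Omega> \<phi> p"
  shows "set_integrable lborel \<Omega> (\<lambda>x. (norm (gradient \<phi> x))\<^sup>2) \<and>
         1/2 * (LINT x:\<Omega>|lborel. (norm (gradient \<phi> x))\<^sup>2)
           = - (pi powr (real n / 2) / (2 * Gamma (real n / 2))) * (c \<bullet> p)"
proof -
  have n2: "n \<ge> 2" using dim(1) by auto
  have n_dim: "n = DIM((real ^ 'm) \<times> real)" using dim(2) n2 by simp
  have m_dim: "real DIM(real ^ 'm) = real n - 1" using dim(2) n2 by simp

  define G where "G = gradient \<eta>"
  obtain G0 H0 where G0: "\<And>x. GDERIV \<eta> x :> G0 x"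
      "\<And>x. (G0 has_derivative blinfun_apply (H0 x)) (at x)"
    and cG0: "continuous_on UNIV G0" and cH0: "continuous_on UNIV (H0 :: _ \<Rightarrow> (real ^ 'm) \<Rightarrow>\<^sub>L (real ^ 'm))"
    using eta_C2 unfolding C2_closure_def closure_UNIV by auto
  have "G = G0" unfolding G_def using gradient_eq[OF G0(1)] by blast
  then have eta_deriv: "\<And>x. GDERIV \<eta> x :> G x" and cG: "continuous_on UNIV G"
    using G0(1) cG0 by auto
  define H where "H = (\<lambda>x. blinfun_apply (H0 x))"
  have G_deriv: "(G has_derivative H x) (at x)" for x
    using G0(2) \<open>G = G0\<close> by (simp add: H_def)
  have cH: "continuous_on UNIV (\<lambda>x. H x h)" for h
    unfolding H_def by (intro continuous_intros cH0)
  have c_eta: "continuous_on UNIV \<eta>"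
    using eta_C2 unfolding C2_closure_def closure_UNIV by auto

  obtain A1 where A1: "A1 \<ge> 0" "\<And>x. \<bar>\<eta> x\<bar> \<le> A1 * (1 + norm x) powr (- (real n - 1 + \<epsilon>))"
    using bigo_decay_bound[OF eta_decay c_eta] n2 eps by auto
  obtain A2 where A2: "A2 \<ge> 0" "\<And>x. norm (G x) \<le> A2 * (1 + norm x) powr (- (real n + \<epsilon>))"
    using vec_bigo_decay_bound[OF d_eta_decay cG[unfolded G_def]] n2 eps by (auto simp: G_def)
  have "\<exists>C\<ge>0. \<forall>x. norm (H x (axis i 1)) \<le> C * (1 + norm x) powr (- (real n + 1 + \<epsilon>))" for i
  proof -
    \<comment> \<open>Translates the coordinatewise second-derivative hypothesis into columns of the
      Hessian: differentiation in direction \<open>i\<close> of the component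
      \<open>j\<close>.\<close>
    have "gradient (\<lambda>y'. gradient \<eta> y' $ j) x' $ i = H x' (axis i 1) $ j" for x' j
    proof -
      have "((\<lambda>y. G y $ j) has_derivative (\<lambda>h. H x' h $ j)) (at x')"
        by (rule bounded_linear.has_derivative[OF bounded_linear_vec_nth G_deriv])
      from gradient_inner_Basis[OF this, of "axis i 1"] show ?thesis
        by (simp add: G_def axis_in_Basis_iff inner_axis)
    qed
    then have "(\<lambda>x. H x (axis i 1) $ j) \<in> O[at_infinity](\<lambda>x'. 1 / norm x' powr (real n + 1 + \<epsilon>))" for j
      using dd_eta_decay[of j i] by simp
    moreover have "0 \<le> real n + 1 + \<epsilon>" using eps by simp
    ultimately obtain C where "C \<ge> 0" "\<And>x. norm (H x (axis i 1)) \<le> C * (1 + norm x) powr (- (real n + 1 + \<epsilon>))"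
      using vec_bigo_decay_bound[OF _ cH] by blast
    then show ?thesis by blast
  qed
  then obtain B where B: "\<And>i. B i \<ge> 0"
    "\<And>i x. norm (H x (axis i 1)) \<le> B i * (1 + norm x) powr (- (real n + 1 + \<epsilon>))" by metis
  define A where "A = A1 + A2 + sum B UNIV"
  have sB: "sum B UNIV \<ge> 0" using B(1) by (simp add: sum_nonneg)
  have A: "A1 \<le> A" "A2 \<le> A" "B i \<le> A" for i
    using A1(1) A2(1) sB member_le_sum[of i UNIV B] B(1) by (auto simp: A_def)
  have eta_le: "\<bar>\<eta> x\<bar> \<le> A * (1 + norm x) powr (- (real n - 1 + \<epsilon>))" for x
    by (rule order_trans[OF A1(2) mult_right_mono[OF A(1) powr_ge_zero]])
  have G_le: "norm (G x) \<le> A * (1 + norm x) powr (- (real n + \<epsilon>))" for x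
    by (rule order_trans[OF A2(2) mult_right_mono[OF A(2) powr_ge_zero]])
  \<comment> \<open>One power of decay is given up here so that gradient and Hessian share a single
    rate, as \<open>mean_curvature_integral\<close> requires.\<close>
  have H_le: "norm (H x b) \<le> A * (1 + norm x) powr (- (real n + \<epsilon>))" if "b \<in> Basis" for x b
  proof -
    obtain i where i: "b = axis i 1" using \<open>b \<in> Basis\<close> by (auto simp: Basis_vec_def)
    have "norm (H x b) \<le> B i * (1 + norm x) powr (- (real n + 1 + \<epsilon>))" using B(2) i by simp
    also have "\<dots> \<le> A * (1 + norm x) powr (- (real n + \<epsilon>))"
      using A(3)[of i] B(1)[of i] order_trans[OF B(1) A(3)] by (intro mult_mono powr_mono) auto
    finally show ?thesis .
  qed

  have eta_bound: "\<bar>\<eta> x\<bar> \<le> A1" for x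
  proof -
    have "(1 + norm x) powr (- (real n - 1 + \<epsilon>)) \<le> (1 + norm x) powr 0"
      using n2 eps by (intro powr_mono) auto
    also have "\<dots> = 1" using norm_ge_zero[of x] by (simp add: add_nonneg_eq_0_iff)
    finally have "A1 * (1 + norm x) powr (- (real n - 1 + \<epsilon>)) \<le> A1 * 1" using A1(1) by (rule mult_left_mono)
    then show ?thesis using A1(2)[of x] by linarith
  qed
  interpret surface: C1_subgraph \<eta> G A1
  proof
    show "(\<eta> has_derivative (\<lambda>h. G x \<bullet> h)) (at x)" for x
      using eta_deriv[of x] by (simp add: gderiv_def inner_commute)
  qed (use cG eta_bound in auto)
  have dom: "surface.dom = \<Omega>" by (simp add: surface.dom_def Omega_eq)
  have on_S: "(x, \<eta> x) \<in> S" for x by (simp add: S_eq)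
  have in_closure: "(x, \<eta> x) \<in> closure \<Omega>" for x
    unfolding dom[symmetric] by (simp add: surface.closure_dom)

  obtain V HV where V: "\<And>x. x \<in> \<Omega> \<Longrightarrow> GDERIV \<phi> x :> V x"
      "\<And>x. x \<in> \<Omega> \<Longrightarrow> (V has_derivative blinfun_apply (HV x)) (at x)"
    and cV: "continuous_on (closure \<Omega>) V"
    and cHV: "continuous_on (closure \<Omega>) (HV :: _ \<Rightarrow> ((real ^ 'm) \<times> real) \<Rightarrow>\<^sub>L ((real ^ 'm) \<times> real))"
    using phi_C2 unfolding C2_closure_def by auto
  have c_phi: "continuous_on (closure \<Omega>) \<phi>" using phi_C2 unfolding C2_closure_def by auto
  have grad: "gradient \<phi> x = V x" if "x \<in> \<Omega>" for x by (rule gradient_eq[OF V(1)[OF that]])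
  have grad_cl: "gradient_closure \<Omega> \<phi> x = V x" if "x \<in> closure \<Omega>" for x
    by (rule gradient_closure_eq[OF V(1) cV that])
  have lap: "(\<Sum>b\<in>Basis. HV x b \<bullet> b) = 0" if x: "x \<in> \<Omega>" for x
  proof -
    have "(gradient \<phi> has_derivative blinfun_apply (HV x)) (at x)"
      by (rule has_derivative_transform_within_open[OF V(2)[OF x] surface.open_dom[unfolded dom] x])
        (simp add: grad)
    then show ?thesis using harmonic[OF x] by (simp add: laplacian_def divergence_eq)
  qed

  obtain c1 where c1: "\<forall>\<^sub>F x in at_infinity_within (closure \<Omega>).
      \<bar>\<phi> x - p \<bullet> x / norm x ^ n\<bar> \<le> c1 * norm x powr (- (real n - 1 + \<epsilon>))"
    using dipole unfolding is_dipole_moment_def by (auto elim: bigo_inverse_powrE)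
  define W where "W = (\<lambda>x. (1 / norm x ^ n) *\<^sub>R p - (real n * (p \<bullet> x) / norm x ^ (n + 2)) *\<^sub>R x)"
  obtain c2 where "\<forall>\<^sub>F x in at_infinity_within (closure \<Omega>).
      \<bar>norm (gradient_closure \<Omega> \<phi> x - gradient (\<lambda>y. p \<bullet> y / norm y ^ n) x)\<bar> \<le> c2 * norm x powr (- (real n + \<epsilon>))"
    using dipole unfolding is_dipole_moment_def by (auto elim: bigo_inverse_powrE)
  \<comment> \<open>The explicit dipole field is available away from the origin, and the continuous
    extension \<open>V\<close> on the closure; both restrictions hold eventually.\<close>
  with eventually_at_infinity_within_mem[of "closure \<Omega>"]
  have c2: "\<forall>\<^sub>F x in at_infinity_within (closure \<Omega>). norm (V x - W x) \<le> c2 * norm x powr (- (real n + \<epsilon>))"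
    by eventually_elim (simp add: grad_cl gradient_dipole[OF n2] W_def)
  have n1: "real n - 1 = real (n - 1)" using n2 by simp
  have p_le: "norm (p \<bullet> x / norm x ^ n) \<le> norm p / norm x ^ (n - 1)" if "norm x \<ge> 1" for x
  proof -
    have pos: "norm x > 0" using that by linarith
    have "norm (p \<bullet> x / norm x ^ n) \<le> (norm p * norm x) / norm x ^ n"
      using Cauchy_Schwarz_ineq2[of p x] pos by (simp add: divide_right_mono)
    also have "\<dots> = (norm p * norm x) / (norm x * norm x ^ (n - 1))"
      using n2 by (simp only: power_Suc[symmetric]) simp
    also have "\<dots> = norm p / norm x ^ (n - 1)" using pos by simp
    finally show ?thesis .
  qed
  have W_le: "norm (W x) \<le> (norm p + real n * norm p) / norm x ^ n" if "norm x \<ge> 1" for x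
  proof -
    have pos: "norm x > 0" using that by linarith
    have "norm (W x) \<le> norm ((1 / norm x ^ n) *\<^sub>R p) + norm ((real n * (p \<bullet> x) / norm x ^ (n + 2)) *\<^sub>R x)"
      unfolding W_def by (rule norm_triangle_ineq4)
    also have "\<dots> = norm p / norm x ^ n + real n * \<bar>p \<bullet> x\<bar> / norm x ^ (n + 2) * norm x"
      by (simp add: abs_mult)
    also have "\<dots> \<le> norm p / norm x ^ n + real n * (norm p * norm x) / norm x ^ (n + 2) * norm x"
      using Cauchy_Schwarz_ineq2[of p x] by (intro add_left_mono mult_right_mono divide_right_mono mult_left_mono) auto
    also have "\<dots> = (norm p + real n * norm p) / norm x ^ n"
      using pos by (simp add: power_add power2_eq_square add_divide_distrib)
    finally show ?thesis .
  qed
  have ev1: "\<forall>\<^sub>F x in at_infinity_within (closure \<Omega>). norm (p \<bullet> x / norm x ^ n) \<le> norm p / norm x ^ (n - 1)"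
    using eventually_at_infinity_within_norm_ge[of 1] by (rule eventually_mono) (rule p_le)
  obtain C1 where C1: "\<And>x. x \<in> closure \<Omega> \<Longrightarrow> norm (\<phi> x) * (1 + norm x) ^ (n - 1) \<le> C1"
    using decay_bound_power[OF closed_closure c_phi eps(1) c1[unfolded n1, folded real_norm_def] ev1] by blast
  have ev2: "\<forall>\<^sub>F x in at_infinity_within (closure \<Omega>). norm (W x) \<le> (norm p + real n * norm p) / norm x ^ n"
    using eventually_at_infinity_within_norm_ge[of 1] by (rule eventually_mono) (rule W_le)
  obtain C2 where C2: "\<And>x. x \<in> closure \<Omega> \<Longrightarrow> norm (V x) * (1 + norm x) ^ n \<le> C2"
    using decay_bound_power[OF closed_closure cV eps(1) c2 ev2] by blast

  interpret wave: C1_subgraph_potential \<eta> G A1 \<phi> V "\<lambda>x. blinfun_apply (HV x)" c "max C1 C2" n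
  proof (unfold_locales, unfold dom)
    show "continuous_on (closure \<Omega>) (\<lambda>x. HV x h)" for h
      by (intro continuous_intros cHV)
    show "\<bar>\<phi> x\<bar> * (1 + norm x) ^ (n - 1) \<le> max C1 C2" if "x \<in> closure \<Omega>" for x
      using C1[OF that] by simp
    show "norm (V x) * (1 + norm x) ^ n \<le> max C1 C2" if "x \<in> closure \<Omega>" for x
      using C2[OF that] by simp
    \<comment> \<open>The unit normal is a positive multiple of the unnormalized one, and the factor
      cancels.\<close>
    show "V (x, \<eta> x) \<bullet> surface.surface_normal x = c \<bullet> surface.surface_normal x" for x
    proof -
      have pos: "sqrt (1 + (norm (G x))\<^sup>2) > 0" by (simp add: add_pos_nonneg)
      have "N (x, \<eta> x) = (1 / sqrt (1 + (norm (G x))\<^sup>2)) *\<^sub>R surface.surface_normal x"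
        unfolding N_eq upward_normal_def surface.surface_normal_def G_def[symmetric] by simp
      then show ?thesis
        using kinematic[OF on_S[of x]] pos by (simp add: grad_cl[OF in_closure])
    qed
  qed (use n_dim c_phi cV V lap c_horizontal in auto)

  define \<kappa> where "\<kappa> = (\<lambda>x. \<Sum>b\<in>Basis. ((1 / sqrt (1 + (norm (G x))\<^sup>2)) *\<^sub>R H x b
      - ((G x \<bullet> H x b) / sqrt (1 + (norm (G x))\<^sup>2) ^ 3) *\<^sub>R G x) \<bullet> b)"
  have "real n + \<epsilon> > real DIM(real ^ 'm)" unfolding m_dim using eps by simp
  note curv = mean_curvature_integral[OF G_deriv cH this G_le H_le]
  have kappa: "integrable lborel \<kappa>" "integral\<^sup>L lborel \<kappa> = 0"
    unfolding \<kappa>_def by (rule curv(2,3); assumption)+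
  have dyn: "1/2 * (norm (V (x, \<eta> x)))\<^sup>2 - c \<bullet> V (x, \<eta> x) + g * \<eta> x = \<sigma> * \<kappa> x" for x
  proof -
    \<comment> \<open>With this sign the surface tension term - \<sigma> div N becomes \<sigma>
      \<open>\<kappa>\<close>, the form in which its integral is known to vanish.\<close>
    have "divergence N (x, \<eta> x) = - \<kappa> x"
      unfolding N_eq \<kappa>_def
      by (rule divergence_upward_normal) (use curv(1) G_deriv in \<open>simp_all add: G_def\<close>)
    then show ?thesis
      using dynamic[OF on_S[of x]] by (simp add: grad_cl[OF in_closure])
  qed
  have a: "real n - 1 + \<epsilon> > real DIM(real ^ 'm)" unfolding m_dim using eps by simp
  have eta_i: "integrable lborel \<eta>"
    by (rule integrable_of_decay[OF borel_measurable_continuous_onI[OF c_eta] a eta_le])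
  have eta_0: "integral\<^sup>L lborel \<eta> = 0"
    by (rule wave.mean_elevation_eq_0[OF dyn _ eta_i kappa]) (use g_pos in simp)
  have mono: "at_infinity_within \<Omega> \<le> at_infinity_within (closure \<Omega>)"
    by (rule at_infinity_within_mono[OF closure_subset])
  have energy: "integral\<^sup>L lborel (\<lambda>x. indicator surface.dom x * (norm (V x))\<^sup>2)
      = (norm c)\<^sup>2 * integral\<^sup>L lborel \<eta> - real n * unit_ball_vol (real n) / 2 * (c \<bullet> p)"
  proof (rule wave.kinetic_energy[OF _ _ a eta_le])
    show "((\<lambda>x. norm x ^ (n - 1) * (\<phi> x - p \<bullet> x / norm x ^ n)) \<longlongrightarrow> 0) (at_infinity_within surface.dom)"
      unfolding dom by (rule tendsto_mono[OF mono weighted_decay_tendsto_0[OF c1[unfolded n1] eps(1)]])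
    have "\<forall>\<^sub>F x in at_infinity_within (closure \<Omega>). \<bar>norm (V x - W x)\<bar> \<le> c2 * norm x powr (- (real n + \<epsilon>))"
      using c2 by simp
    from tendsto_mono[OF mono weighted_decay_tendsto_0[OF this eps(1)]]
    show "((\<lambda>x. norm x ^ n * norm (V x - ((1 / norm x ^ n) *\<^sub>R p
        - (real n * (p \<bullet> x) / norm x ^ (n + 2)) *\<^sub>R x))) \<longlongrightarrow> 0) (at_infinity_within surface.dom)"
      unfolding dom W_def .
    show "norm (G x) \<le> A * (1 + norm x) powr (- (real n - 1 + \<epsilon> + 1))" for x
      using G_le[of x] by simp
  qed
  have eq: "(\<lambda>x. indicator \<Omega> x *\<^sub>R (norm (gradient \<phi> x))\<^sup>2) = (\<lambda>x. indicator surface.dom x * (norm (V x))\<^sup>2)"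
    by (auto simp: dom grad indicator_def)
  have "set_integrable lborel \<Omega> (\<lambda>x. (norm (gradient \<phi> x))\<^sup>2)"
    unfolding set_integrable_def eq by (rule wave.integrable_energy)
  \<comment> \<open>The volume of the unit ball is \<pi>^(n/2) / \<Gamma>(n/2 + 1), and the
    functional equation of \<Gamma> absorbs the factor n/2.\<close>
  moreover have "real n * unit_ball_vol (real n) / 2 = pi powr (real n / 2) / Gamma (real n / 2)"
  proof -
    have "real n / 2 \<notin> \<int>\<^sub>\<le>\<^sub>0" using n2 by (auto elim!: nonpos_Ints_cases)
    then have "Gamma (real n / 2 + 1) = real n / 2 * Gamma (real n / 2)" by (rule Gamma_plus1)
    then show ?thesis using n2 by (simp add: unit_ball_vol_def)
  qed
  then have "1/2 * (LINT x:\<Omega>|lborel. (norm (gradient \<phi> x))\<^sup>2)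
           = - (pi powr (real n / 2) / (2 * Gamma (real n / 2))) * (c \<bullet> p)"
    unfolding set_lebesgue_integral_def eq energy eta_0 by simp
  ultimately show ?thesis by blast
qed

end
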